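(* Let $1\leq m<n$ be integers and let $F\subseteq\mathbb{R}^n$ satisfy $\dim_{\mathrm{qA}}F<m$. (a) If $F$ is bounded then $$\dim_{\mathrm H}\{V\in G(n,m):\overline{\dim}_{\mathrm B}\,\pi_VF<\overline{\dim}_{\mathrm B}F\}\ \leq\ m(n-m)-(m-\dim_{\mathrm{qA}}F),$$ and likewise $$\dim_{\mathrm H}\{V\in G(n,m):\underline{\dim}_{\mathrm B}\,\pi_VF<\underline{\dim}_{\mathrm B}F\}\ \leq\ m(n-m)-(m-\dim_{\mathrm{qA}}F).$$ (b) If $F$ is Borel then $$\dim_{\mathrm H}\{V\in G(n,m):\dim_{\mathrm P}\pi_VF<\dim_{\mathrm P}F\}\ \leq\ m(n-m)-(m-\dim_{\mathrm{qA}}F).$$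
   Context: All sets $F$ are non-empty. $G(n,m)$ is the Grassmannian of $m$-dimensional linear subspaces of $\mathbb{R}^n$ (a compact manifold of dimension $m(n-m)$, with its usual metric, e.g. $d(V,W)=\|\pi_V-\pi_W\|$), $\pi_V:\mathbb{R}^n\to V$ is orthogonal projection onto $V$, and $\dim_{\mathrm H}$ is Hausdorff dimension. For non-empty bounded $E\subseteq\mathbb{R}^n$ and $r>0$, $N_r(E)$ is the minimum number of sets of diameter $r$ (using diameter at most $r$ gives the same dimensions) that can cover $E$. The lower and upper box dimensions are $\underline{\dim}_{\mathrm B}E=\liminf_{r\to0}\frac{\log N_r(E)}{-\log r}$ and $\overline{\dim}_{\mathrm B}E=\limsup_{r\to0}\frac{\log N_r(E)}{-\log r}$. The packing dimension of a (not necessarily bounded) set $F$ is $\dim_{\mathrm P}F=\inf\{\sup_j\overline{\dim}_{\mathrm B}F_j: F\subseteq\bigcup_{j=1}^\infty F_j,\ F_j\text{ compact}\}$. For $\theta\in(0,1)$ the upper Assouad spectrum $\overline{\dim}_{\mathrm A}^{\theta}F$ is the infimum of $\alpha$ for which there is a constant $C>0$ such that $N_r(B(x,R)\cap F)\leq C(R/r)^\alpha$ for all $0<r\leq R^{1/\theta}<R<1$ and $x\in F$; it is non-decreasing in $\theta$. The quasi-Assouad dimension is $\dim_{\mathrm{qA}}F=\lim_{\theta\nearrow1}\overline{\dim}_{\mathrm A}^{\theta}F$. *)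

theory Defs
  imports "HOL-Analysis.Analysis"
begin

section \<open>The Grassmannian\<close>

text \<open>The linear subspaces (of all dimensions) of a Euclidean space form a metric space under
  the distance \<open>dist V W = \<parallel>\<pi>\<^sub>V - \<pi>\<^sub>W\<parallel>\<close> (operator norm). Its subset \<open>grassmannian m\<close>
  plays the role of $G(n,m)$.\<close>

typedef (overloaded) ('a :: euclidean_space) linsub = "{V :: 'a set. subspace V}"
  morphisms points Abs_linsub
  by (rule exI[of _ UNIV]) simp

lemma subspace_points: "subspace (points V)"
  using points by blast

definition orth_proj :: "'a :: euclidean_space linsub \<Rightarrow> 'a \<Rightarrow> 'a" where
  "orth_proj V x = (THE y. y \<in> points V \<and> (\<forall>v\<in>points V. orthogonal (x - y) v))"

lemma orth_proj_unique:
  assumes "y \<in> points V" "\<And>v. v \<in> points V \<Longrightarrow> orthogonal (x - y) v"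
  shows "orth_proj V x = y"
  unfolding orth_proj_def
proof (rule the_equality)
  show "y \<in> points V \<and> (\<forall>v\<in>points V. orthogonal (x - y) v)" using assms by blast
next
  fix z assume z: "z \<in> points V \<and> (\<forall>v\<in>points V. orthogonal (x - z) v)"
  have d: "z - y \<in> points V" using z assms(1) subspace_points subspace_diff by blast
  have "orthogonal ((x - y) - (x - z)) (z - y)"
    using d z assms(2) by (simp add: orthogonal_def inner_diff_left)
  then show "z = y" by (simp add: orthogonal_def)
qed

lemma
  shows orth_proj_in: "orth_proj V x \<in> points V"
    and orth_proj_orthogonal: "v \<in> points V \<Longrightarrow> orthogonal (x - orth_proj V x) v"
proof -
  obtain y z where *: "y \<in> span (points V)" "\<And>w. w \<in> span (points V) \<Longrightarrow> orthogonal z w" "x = y + z"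
    using orthogonal_subspace_decomp_exists[of "points V" x] by blast
  have s: "span (points V) = points V" using subspace_points span_eq_iff by blast
  have "orth_proj V x = y"
    by (rule orth_proj_unique) (use * s in auto)
  then show "orth_proj V x \<in> points V" "v \<in> points V \<Longrightarrow> orthogonal (x - orth_proj V x) v"
    using * s by auto
qed

lemma orth_proj_id: "x \<in> points V \<Longrightarrow> orth_proj V x = x"
  by (rule orth_proj_unique) (auto simp: orthogonal_def)

lemma linear_orth_proj: "linear (orth_proj V)"
proof (rule linearI)
  fix x y :: 'a and c :: real
  show "orth_proj V (x + y) = orth_proj V x + orth_proj V y"
  proof (rule orth_proj_unique)
    show "orth_proj V x + orth_proj V y \<in> points V"
      by (simp add: orth_proj_in subspace_add subspace_points)
    show "orthogonal (x + y - (orth_proj V x + orth_proj V y)) v" if "v \<in> points V" for v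
      using orth_proj_orthogonal[OF that, of x] orth_proj_orthogonal[OF that, of y]
      by (simp add: orthogonal_def inner_diff_left inner_add_left)
  qed
  show "orth_proj V (c *\<^sub>R x) = c *\<^sub>R orth_proj V x"
  proof (rule orth_proj_unique)
    show "c *\<^sub>R orth_proj V x \<in> points V"
      by (simp add: orth_proj_in subspace_scale subspace_points)
    show "orthogonal (c *\<^sub>R x - c *\<^sub>R orth_proj V x) v" if "v \<in> points V" for v
      using orth_proj_orthogonal[OF that, of x]
      by (simp add: orthogonal_def inner_diff_left)
  qed
qed

lemma orth_proj_inj:
  assumes "orth_proj V = orth_proj W"
  shows "V = W"
proof -
  have "points V = points W"
    using assms orth_proj_id orth_proj_in by (metis subset_antisym subsetI)
  then show ?thesis by (simp add: points_inject)
qed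

instantiation linsub :: (euclidean_space) metric_space
begin

definition dist_linsub :: "'a linsub \<Rightarrow> 'a linsub \<Rightarrow> real" where
  "dist_linsub V W = onorm (\<lambda>x. orth_proj V x - orth_proj W x)"

definition uniformity_linsub :: "('a linsub \<times> 'a linsub) filter" where
  "uniformity_linsub = (INF e\<in>{0<..}. principal {(V, W). dist V W < e})"

definition open_linsub :: "'a linsub set \<Rightarrow> bool" where
  "open_linsub S = (\<forall>V\<in>S. \<forall>\<^sub>F (V', W) in uniformity. V' = V \<longrightarrow> W \<in> S)"

instance
proof
  have bl: "bounded_linear (\<lambda>x. orth_proj V x - orth_proj W x)" for V W :: "'a linsub"
    by (intro bounded_linear_sub linear_conv_bounded_linear[THEN iffD1] linear_orth_proj)
  fix V W U :: "'a linsub"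
  show "dist V W = 0 \<longleftrightarrow> V = W"
    using onorm_eq_0[OF bl, of V W] orth_proj_inj[of V W]
    by (auto simp: dist_linsub_def fun_eq_iff)
  have "dist V W \<le> dist V U + dist U W"
    using onorm_triangle[OF bl[of V U] bl[of U W]] by (simp add: dist_linsub_def)
  moreover have "dist U W = dist W U"
    using onorm_neg[of "\<lambda>x. orth_proj U x - orth_proj W x"] by (simp add: dist_linsub_def)
  ultimately show "dist V W \<le> dist V U + dist W U" by simp
qed (simp_all add: uniformity_linsub_def open_linsub_def)

end

definition grassmannian :: "nat \<Rightarrow> 'a :: euclidean_space linsub set" where
  "grassmannian m = {V. dim (points V) = m}"


section \<open>Hausdorff dimension\<close>

text \<open>The library gives unbounded sets an unspecified real diameter, so boundedness of covering
  sets is required explicitly here and below.\<close>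

definition hausdorff_premeasure :: "real \<Rightarrow> real \<Rightarrow> 'a :: metric_space set \<Rightarrow> ennreal" where
  "hausdorff_premeasure s \<delta> A =
     Inf {(\<Sum>i. ennreal (diameter (U i) powr s)) | U :: nat \<Rightarrow> 'a set.
            A \<subseteq> (\<Union>i. U i) \<and> (\<forall>i. bounded (U i) \<and> diameter (U i) \<le> \<delta>)}"

definition hausdorff_measure :: "real \<Rightarrow> 'a :: metric_space set \<Rightarrow> ennreal" where
  "hausdorff_measure s A = (SUP \<delta>\<in>{0<..}. hausdorff_premeasure s \<delta> A)"

text \<open>Restricting to \<open>s > 0\<close> does not change the infimum over \<open>s \<ge> 0\<close>, and
  avoids the value \<open>0 powr 0 = 0\<close>.\<close>

definition hausdorff_dim :: "'a :: metric_space set \<Rightarrow> ereal" where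
  "hausdorff_dim A = Inf {ereal s | s. 0 < s \<and> hausdorff_measure s A = 0}"


section \<open>Box, packing and quasi-Assouad dimensions\<close>

text \<open>Minimal number of sets of diameter at most \<open>r\<close> covering \<open>E\<close>; only meaningful
  if such a finite cover exists, e.g. if \<open>E\<close> is a bounded subset of a Euclidean space.\<close>

definition covering_number :: "real \<Rightarrow> 'a :: metric_space set \<Rightarrow> nat" where
  "covering_number r E =
     Inf {card \<U> | \<U>. finite \<U> \<and> E \<subseteq> \<Union>\<U> \<and> (\<forall>U\<in>\<U>. bounded U \<and> diameter U \<le> r)}"

definition lower_box_dim :: "'a :: metric_space set \<Rightarrow> ereal" where
  "lower_box_dim E = Liminf (at_right 0) (\<lambda>r. ereal (ln (real (covering_number r E)) / - ln r))"

definition upper_box_dim :: "'a :: metric_space set \<Rightarrow> ereal" where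
  "upper_box_dim E = Limsup (at_right 0) (\<lambda>r. ereal (ln (real (covering_number r E)) / - ln r))"

text \<open>Some \<open>K j\<close> may be empty; since \<open>ln 0 = 0\<close>, empty sets have box dimension 0 and
  do not affect the supremum for non-empty \<open>F\<close>.\<close>

definition packing_dim :: "'a :: metric_space set \<Rightarrow> ereal" where
  "packing_dim F =
     Inf {(SUP j. upper_box_dim (K j)) | K :: nat \<Rightarrow> 'a set.
            F \<subseteq> (\<Union>j. K j) \<and> (\<forall>j. compact (K j))}"

definition upper_assouad_spectrum :: "real \<Rightarrow> 'a :: metric_space set \<Rightarrow> ereal" where
  "upper_assouad_spectrum \<theta> F =
     Inf {ereal \<alpha> | \<alpha>. \<exists>C>0. \<forall>r R. \<forall>x\<in>F.
            0 < r \<and> r \<le> R powr (1 / \<theta>) \<and> R powr (1 / \<theta>) < R \<and> R < 1 \<longrightarrow>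
            real (covering_number r (cball x R \<inter> F)) \<le> C * (R / r) powr \<alpha>}"

definition quasi_assouad_dim :: "'a :: metric_space set \<Rightarrow> ereal" where
  "quasi_assouad_dim F = Lim (at_left 1) (\<lambda>\<theta>. upper_assouad_spectrum \<theta> F)"

end

theory Submission
  imports Defs
begin

text \<open>If the projection of \<open>F\<close> to \<open>V\<close> is covered by few sets of diameter \<open>r\<close>, then by Cauchy-Schwarz a
  maximal \<open>r\<close>-separated subset \<open>A\<close> of \<open>F\<close> has many pairs whose projections are \<open>r\<close>-close. A measure
  \<open>\<mu>\<close> on the Grassmannian with \<open>\<mu> (cball V \<delta>) \<le> \<delta> powr s\<close> and \<open>s = m * (n - 1 - m) + t\<close> gives
  mass at most a constant times \<open>(r / dist x y) powr t\<close> to the \<open>V\<close> for which a given pair \<open>x, y\<close> is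
  close, and for \<open>t\<close> above the quasi-Assouad dimension these bounds sum over \<open>y \<in> A\<close> to at most a
  constant times \<open>r powr - \<epsilon>\<close>. So the \<open>V\<close> that are bad at scale \<open>r\<close> form a set of \<open>s\<close>-dimensional
  content at most a positive power of \<open>r\<close>, by a Frostman lemma that is only needed for finite
  sets. An exceptional \<open>V\<close> is bad at infinitely many scales of a geometrically decaying sequence,
  which settles the box dimensions.

  For the packing dimension, a Borel set is the projection of a closed set in a Polish space.
  Removing countably many open pieces with images of small packing dimension leaves a closed set
  all of whose non-empty open pieces have images of large upper box dimension. If the packing
  dimension drops under the projection to \<open>V\<close>, then by Baire's theorem the upper box dimension of
  one of countably many such pieces drops as well.\<close>

section \<open>Covers of small power sum\<close>

text \<open>With q the quasi-Assouad dimension,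
  \<open>m * (n - m) - (m - q) = m * (n - 1 - m) + q\<close>, so it is enough to treat the exponent
  \<open>m * (n - 1 - m) + t\<close> for every t > q. Nothing is known about the measurability of
  the set of bad V. It is therefore replaced by a finite net of mesh \<open>r / L\<close>, where L
  bounds the distances in F. For two points of F at distance at least r the ratio
  \<open>r / dist x y\<close> is never below this mesh, so weights controlled on balls of at least
  that radius suffice, and these exist on any finite set. The quasi-Assouad dimension controls F
  only up to a factor \<open>r powr (- \<epsilon>)\<close>. Badness is therefore defined with a gain
  \<open>r powr (2 * \<epsilon>)\<close>: after the loss there remains
  \<open>r powr \<epsilon>\<close>, which is summable along the scales used. For the packing
  dimension the pieces have to be fixed before V is given, to be countable in number, and have to
  lie in F, to inherit its Assouad bound.\<close>

definition content_le :: "real \<Rightarrow> real \<Rightarrow> 'a :: metric_space set \<Rightarrow> bool" where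
  "content_le s c E \<longleftrightarrow> (\<exists>U :: nat \<Rightarrow> 'a set. E \<subseteq> (\<Union>i. U i) \<and> (\<forall>i. bounded (U i)) \<and>
     (\<Sum>i. ennreal (diameter (U i) powr s)) \<le> ennreal c)"

text \<open>The mesh of the covers is unrestricted. For \<open>s > 0\<close> vanishing content
  already forces covers by small sets, so nothing is lost against Hausdorff measure, and an estimate
  at scale r needs no control of diameters.\<close>

definition content_null :: "real \<Rightarrow> 'a :: metric_space set \<Rightarrow> bool" where
  "content_null s E \<longleftrightarrow> (\<forall>c>0. content_le s c E)"

lemma content_le_mono: "content_le s c E \<Longrightarrow> E' \<subseteq> E \<Longrightarrow> c \<le> c' \<Longrightarrow> content_le s c' E'"
  unfolding content_le_def by (meson ennreal_leI order_trans)

lemma content_null_subset: "content_null s E \<Longrightarrow> E' \<subseteq> E \<Longrightarrow> content_null s E'"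
  unfolding content_null_def using content_le_mono by blast

lemma content_le_finite:
  assumes "finite I" "E \<subseteq> (\<Union>i\<in>I. W i)" "\<And>i. i \<in> I \<Longrightarrow> bounded (W i)"
    "(\<Sum>i\<in>I. diameter (W i) powr s) \<le> c"
  shows "content_le s c E"
proof -
  obtain e where e: "bij_betw e {..<card I} I"
    using ex_bij_betw_nat_finite[OF assms(1)] by (auto simp: atLeast0LessThan)
  \<comment> \<open>Padding is free: the empty set has diameter 0, and
    \<open>0 powr s = 0\<close>.\<close>
  define U where "U i = (if i < card I then W (e i) else {})" for i
  have im: "e ` {..<card I} = I" using e by (simp add: bij_betw_def)
  have "(\<Union>i\<in>I. W i) \<subseteq> (\<Union>i. U i)"
  proof
    fix x assume "x \<in> (\<Union>i\<in>I. W i)"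
    then obtain i where "i \<in> I" "x \<in> W i" by blast
    then obtain k where "k < card I" "e k = i" using im by force
    then show "x \<in> (\<Union>i. U i)" using \<open>x \<in> W i\<close> by (auto simp: U_def intro!: exI[of _ k])
  qed
  moreover have "bounded (U i)" for i
    using assms(3) e by (auto simp: U_def bij_betw_def)
  moreover have "(\<Sum>i. ennreal (diameter (U i) powr s)) \<le> ennreal c"
  proof -
    have "(\<Sum>i. ennreal (diameter (U i) powr s)) = (\<Sum>i<card I. ennreal (diameter (U i) powr s))"
      by (rule suminf_finite) (auto simp: U_def)
    also have "\<dots> = ennreal (\<Sum>i<card I. diameter (U i) powr s)"
      by (rule sum_ennreal) simp
    also have "(\<Sum>i<card I. diameter (U i) powr s) = (\<Sum>i<card I. diameter (W (e i)) powr s)"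
      by (rule sum.cong) (auto simp: U_def)
    also have "\<dots> = (\<Sum>i\<in>I. diameter (W i) powr s)"
      using sum.reindex_bij_betw[OF e, of "\<lambda>i. diameter (W i) powr s"] by simp
    finally show ?thesis using assms(4) by (simp add: ennreal_leI)
  qed
  ultimately show ?thesis
    unfolding content_le_def using assms(2) by (intro exI[of _ U]) auto
qed

lemma content_le_UN:
  fixes E :: "nat \<Rightarrow> 'a :: metric_space set"
  assumes "\<And>j. content_le s (c j) (E j)" "\<And>j. 0 \<le> c j" "summable c"
  shows "content_le s (suminf c) (\<Union>j. E j)"
proof -
  have "\<exists>U. \<forall>j. E j \<subseteq> (\<Union>i. U j i) \<and> (\<forall>i. bounded (U j i)) \<and>
     (\<Sum>i. ennreal (diameter (U j i :: 'a set) powr s)) \<le> ennreal (c j)"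
    by (rule choice) (use assms(1) in \<open>auto simp: content_le_def\<close>)
  then obtain U where U: "\<And>j. E j \<subseteq> (\<Union>i. U j i)" "\<And>j i. bounded (U j i)"
     "\<And>j. (\<Sum>i. ennreal (diameter (U j i :: 'a set) powr s)) \<le> ennreal (c j)"
    by blast
  define W where "W k = U (fst (prod_decode k)) (snd (prod_decode k))" for k
  have "(\<Union>j. E j) \<subseteq> (\<Union>k. W k)"
  proof
    fix x assume "x \<in> (\<Union>j. E j)"
    then obtain j i where "x \<in> U j i" using U(1) by blast
    then have "x \<in> W (prod_encode (j, i))" by (simp add: W_def)
    then show "x \<in> (\<Union>k. W k)" by blast
  qed
  moreover have "(\<Sum>k. ennreal (diameter (W k) powr s)) \<le> ennreal (suminf c)"
  proof -
    have "(\<Sum>k. ennreal (diameter (W k) powr s))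
        = (\<Sum>j. \<Sum>i. ennreal (diameter (U j i) powr s))"
      unfolding W_def
      by (rule suminf_ennreal_2dimen
          [where f = "\<lambda>p. ennreal (diameter (U (fst p) (snd p)) powr s)"]) simp
    also have "\<dots> \<le> (\<Sum>j. ennreal (c j))"
      by (intro suminf_le U(3)) auto
    also have "\<dots> = ennreal (suminf c)"
      using assms by (intro suminf_ennreal2) auto
    finally show ?thesis .
  qed
  moreover have "bounded (W k)" for k using U(2) by (simp add: W_def)
  ultimately show ?thesis unfolding content_le_def by (intro exI[of _ W]) auto
qed

lemma content_null_UN:
  fixes E :: "nat \<Rightarrow> 'a :: metric_space set"
  assumes "\<And>j. content_null s (E j)"
  shows "content_null s (\<Union>j. E j)"
  unfolding content_null_def
proof (intro allI impI)
  fix c :: real assume c: "0 < c"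
  have "content_le s (\<Sum>j. c * (1/2) ^ Suc j) (\<Union>j. E j)"
    using assms c by (intro content_le_UN) (auto simp: content_null_def intro!: summable_mult)
  moreover have "(\<Sum>j. c * (1/2) ^ Suc j) = c"
    using power_half_series sums_mult[OF power_half_series, of c] sums_unique by fastforce
  ultimately show "content_le s c (\<Union>j. E j)" by simp
qed

lemma content_null_UN_countable:
  assumes "countable I" "\<And>i. i \<in> I \<Longrightarrow> content_null s (E i :: 'a :: metric_space set)"
  shows "content_null s (\<Union>i\<in>I. E i)"
proof (cases "I = {}")
  case True
  then show ?thesis unfolding content_null_def by (auto intro!: content_le_finite[of "{}"])
next
  case False
  have "content_null s (\<Union>j. E (from_nat_into I j))"
    by (rule content_null_UN) (rule assms(2)[OF from_nat_into[OF False]])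
  moreover have "(\<Union>i\<in>I. E i) \<subseteq> (\<Union>j. E (from_nat_into I j))"
    using from_nat_into_surj[OF assms(1)] by force
  ultimately show ?thesis using content_null_subset by blast
qed

text \<open>Borel-Cantelli: every tail of the sequence covers E, and the tails of a convergent
  series are arbitrarily small. Finitely many sets may violate their bound.\<close>

lemma content_null_limsup:
  fixes B :: "nat \<Rightarrow> 'a :: metric_space set"
  assumes "\<forall>\<^sub>F j in sequentially. content_le s (c j) (B j)" "\<And>j. 0 \<le> c j" "summable c"
    and "\<And>x. x \<in> E \<Longrightarrow> \<exists>\<^sub>F j in sequentially. x \<in> B j"
  shows "content_null s E"
  unfolding content_null_def
proof (intro allI impI)
  fix d :: real assume "0 < d"
  obtain j0 where j0: "\<And>j. j \<ge> j0 \<Longrightarrow> content_le s (c j) (B j)"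
    using assms(1) by (auto simp: eventually_sequentially)
  obtain N where N: "\<And>n. n \<ge> N \<Longrightarrow> norm (\<Sum>i. c (i + n)) < d"
    using suminf_exist_split[OF \<open>0 < d\<close> assms(3)] by blast
  define n where "n = max N j0"
  have "content_le s (\<Sum>i. c (i + n)) (\<Union>i. B (i + n))"
    using assms(2,3) j0 by (intro content_le_UN) (auto simp: n_def)
  moreover have "E \<subseteq> (\<Union>i. B (i + n))"
  proof
    fix x assume "x \<in> E"
    then obtain j where "j \<ge> n" "x \<in> B j"
      using assms(4) by (meson frequently_sequentially)
    then show "x \<in> (\<Union>i. B (i + n))" by (auto intro!: exI[of _ "j - n"])
  qed
  moreover have "(\<Sum>i. c (i + n)) \<le> d" using N[of n] by (simp add: n_def)
  ultimately show "content_le s d E" using content_le_mono by blast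
qed

text \<open>If the whole sum is at most \<open>\<delta> powr s\<close>, then so is every single
  term, and no covering set has diameter above \<delta>. Capping the content in this way makes the
  mesh condition automatic.\<close>

lemma hausdorff_measure_content_null:
  assumes "0 < s" "content_null s E"
  shows "hausdorff_measure s E = 0"
proof -
  have *: "hausdorff_premeasure s \<delta> E \<le> ennreal e" if \<delta>: "0 < \<delta>" and e: "0 < e" for \<delta> e
  proof -
    define c where "c = min e (\<delta> powr s)"
    have c: "0 < c" using \<delta> e by (simp add: c_def)
    then obtain U where U: "E \<subseteq> (\<Union>i. U i)" "\<And>i. bounded (U i)"
      "(\<Sum>i. ennreal (diameter (U i) powr s)) \<le> ennreal c"
      using assms(2) unfolding content_null_def content_le_def by blast
    have "diameter (U i) \<le> \<delta>" for i
    proof -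
      have "ennreal (diameter (U i) powr s) = (\<Sum>k\<in>{i}. ennreal (diameter (U k) powr s))"
        by simp
      also have "\<dots> \<le> (\<Sum>k. ennreal (diameter (U k) powr s))"
        by (rule sum_le_suminf) auto
      also have "\<dots> \<le> ennreal (\<delta> powr s)"
        using U(3) by (rule order_trans) (simp add: c_def ennreal_leI)
      finally have "diameter (U i) powr s \<le> \<delta> powr s" by simp
      then show ?thesis
        using assms(1) \<delta> powr_less_mono2[of s \<delta> "diameter (U i)"] by linarith
    qed
    then have "hausdorff_premeasure s \<delta> E \<le> (\<Sum>i. ennreal (diameter (U i) powr s))"
      unfolding hausdorff_premeasure_def using U(1,2) by (intro Inf_lower CollectI exI[of _ U]) simp
    also have "\<dots> \<le> ennreal e"
      using U(3) by (rule order_trans) (simp add: c_def ennreal_leI)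
    finally show ?thesis .
  qed
  have "hausdorff_premeasure s \<delta> E = 0" if "0 < \<delta>" for \<delta>
  proof -
    have "hausdorff_premeasure s \<delta> E \<le> 0"
      by (rule ennreal_le_epsilon) (use *[OF that] in simp)
    then show ?thesis by simp
  qed
  then show ?thesis unfolding hausdorff_measure_def by (simp add: SUP_eq_const[of _ _ 0])
qed

lemma hausdorff_dim_le:
  assumes "0 < s" "content_null s E"
  shows "hausdorff_dim E \<le> ereal s"
  unfolding hausdorff_dim_def by (rule Inf_lower) (use assms hausdorff_measure_content_null[OF assms] in blast)

section \<open>A discrete Frostman lemma\<close>

text \<open>Greedy: points are added one at a time, and each receives the smallest gap left by the
  constraints that contain it. This makes one of these constraints an equality and violates
  none.\<close>

lemma maximal_packing:
  fixes A :: "'j \<Rightarrow> 'a set" and c :: "'j \<Rightarrow> real"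
  assumes "finite X" "finite J" "\<And>j. j \<in> J \<Longrightarrow> 0 \<le> c j"
    and "\<And>x. x \<in> X \<Longrightarrow> \<exists>j\<in>J. x \<in> A j"
  shows "\<exists>\<mu>. (\<forall>x\<in>X. 0 \<le> \<mu> x) \<and> (\<forall>j\<in>J. sum \<mu> (X \<inter> A j) \<le> c j) \<and>
     (\<forall>x\<in>X. \<exists>j\<in>J. x \<in> A j \<and> sum \<mu> (X \<inter> A j) = c j)"
  using assms(1,4)
proof (induction X rule: finite_induct)
  case empty
  then show ?case using assms(3) by auto
next
  case (insert x X)
  obtain \<mu> where \<mu>: "\<forall>y\<in>X. 0 \<le> \<mu> y" "\<forall>j\<in>J. sum \<mu> (X \<inter> A j) \<le> c j"
    "\<forall>y\<in>X. \<exists>j\<in>J. y \<in> A j \<and> sum \<mu> (X \<inter> A j) = c j"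
    using insert by auto
  define gap where "gap j = c j - sum \<mu> (X \<inter> A j)" for j
  define Jx where "Jx = {j\<in>J. x \<in> A j}"
  have Jx: "finite Jx" "Jx \<noteq> {}" using insert.prems assms(2) by (auto simp: Jx_def)
  define w where "w = Min (gap ` Jx)"
  define \<nu> where "\<nu> = \<mu>(x := w)"
  have w: "0 \<le> w" using \<mu>(2) Jx by (auto simp: w_def gap_def Jx_def)
  have sum1: "sum \<nu> (insert x X \<inter> A j) = w + sum \<mu> (X \<inter> A j)" if "x \<in> A j" for j
  proof -
    have "sum \<nu> (insert x X \<inter> A j) = \<nu> x + sum \<nu> (X \<inter> A j)"
      using that insert by (simp add: Int_insert_left)
    also have "sum \<nu> (X \<inter> A j) = sum \<mu> (X \<inter> A j)"
      using insert by (intro sum.cong) (auto simp: \<nu>_def)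
    finally show ?thesis by (simp add: \<nu>_def)
  qed
  have sum2: "sum \<nu> (insert x X \<inter> A j) = sum \<mu> (X \<inter> A j)" if "x \<notin> A j" for j
    using that insert by (intro sum.cong) (auto simp: \<nu>_def)
  have le: "sum \<nu> (insert x X \<inter> A j) \<le> c j" if "j \<in> J" for j
  proof (cases "x \<in> A j")
    case True
    then have "w \<le> gap j" using Jx that by (auto simp: w_def Jx_def)
    then show ?thesis using sum1[OF True] by (simp add: gap_def)
  next
    case False
    then show ?thesis using sum2 \<mu>(2) that by simp
  qed
  have "\<exists>j\<in>J. y \<in> A j \<and> sum \<nu> (insert x X \<inter> A j) = c j" if "y \<in> insert x X" for y
  proof (cases "y = x")
    case True
    have "w \<in> gap ` Jx" using Jx by (simp add: w_def)
    then obtain j where "j \<in> J" "x \<in> A j" "w = gap j" by (auto simp: Jx_def)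
    then show ?thesis using True sum1 by (intro bexI[of _ j]) (auto simp: gap_def)
  next
    case False
    then have "y \<in> X" using that by simp
    from bspec[OF \<mu>(3) this]
    obtain j where j: "j \<in> J" "y \<in> A j" "sum \<mu> (X \<inter> A j) = c j" by blast
    \<comment> \<open>An equality for an older point persists: the sum can only grow, and it is
      still capped by \<open>c j\<close>.\<close>
    have "sum \<mu> (X \<inter> A j) \<le> sum \<nu> (insert x X \<inter> A j)"
      using sum1[of j] sum2[of j] w by (cases "x \<in> A j") auto
    then show ?thesis using j le[of j] by (intro bexI[of _ j]) auto
  qed
  moreover have "\<forall>y\<in>insert x X. 0 \<le> \<nu> y" using \<mu>(1) w by (auto simp: \<nu>_def)
  ultimately show ?case using le by blast
qed

lemma diameter_cball_le:
  fixes x :: "'a :: metric_space"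
  assumes "0 \<le> r"
  shows "diameter (cball x r) \<le> 2 * r"
proof -
  have "dist y z \<le> 2 * r" if "y \<in> cball x r" "z \<in> cball x r" for y z
    using that dist_triangle[of y z x] by (simp add: dist_commute)
  moreover have "cball x r \<noteq> {}" using assms by auto
  ultimately show ?thesis unfolding diameter_def by (auto intro!: cSUP_least)
qed

text \<open>Greedy by size: a ball of largest radius is chosen, every ball meeting it lies in its
  triple, and the balls disjoint from it are left to the induction.\<close>

lemma finite_Vitali_cover:
  fixes a :: "'j \<Rightarrow> 'a :: metric_space" and r :: "'j \<Rightarrow> real"
  assumes "finite J" "\<And>j. j \<in> J \<Longrightarrow> 0 \<le> r j"
  shows "\<exists>K\<subseteq>J. pairwise (\<lambda>i j. disjnt (cball (a i) (r i)) (cball (a j) (r j))) K \<and>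
     (\<forall>j\<in>J. \<exists>k\<in>K. cball (a j) (r j) \<subseteq> cball (a k) (3 * r k))"
  using assms
proof (induction J rule: finite_psubset_induct)
  case (psubset J)
  show ?case
  proof (cases "J = {}")
    case True
    then show ?thesis by auto
  next
    case False
    obtain m where m: "m \<in> J" "\<And>j. j \<in> J \<Longrightarrow> r j \<le> r m"
    proof -
      have "Max (r ` J) \<in> r ` J" using False psubset.hyps by (intro Max_in) auto
      then obtain m where "m \<in> J" "r m = Max (r ` J)" by force
      then show thesis using that[of m] psubset.hyps by simp
    qed
    define J' where "J' = {j\<in>J. disjnt (cball (a j) (r j)) (cball (a m) (r m))}"
    \<comment> \<open>A non-negative radius makes the ball non-empty, hence not disjoint from
      itself. This is what makes the family strictly smaller.\<close>
    have "m \<notin> J'" using psubset.prems[OF m(1)] by (auto simp: J'_def disjnt_def)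
    have "J' \<subseteq> J" by (auto simp: J'_def)
    with \<open>m \<notin> J'\<close> m(1) have psub: "J' \<subset> J" by blast
    have "0 \<le> r j" if "j \<in> J'" for j using that psubset.prems \<open>J' \<subseteq> J\<close> by blast
    from psubset.IH[OF psub this] obtain K where K: "K \<subseteq> J'" "pairwise (\<lambda>i j. disjnt (cball (a i) (r i)) (cball (a j) (r j))) K"
      "\<forall>j\<in>J'. \<exists>k\<in>K. cball (a j) (r j) \<subseteq> cball (a k) (3 * r k)"
      by blast
    have "pairwise (\<lambda>i j. disjnt (cball (a i) (r i)) (cball (a j) (r j))) (insert m K)"
      using K(1,2) by (auto simp: pairwise_insert J'_def disjnt_sym)
    moreover have "\<exists>k\<in>insert m K. cball (a j) (r j) \<subseteq> cball (a k) (3 * r k)" if jJ: "j \<in> J" for j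
    proof (cases "j \<in> J'")
      case True
      then show ?thesis using K(3) by blast
    next
      case False
      then obtain z where "dist (a j) z \<le> r j" "dist (a m) z \<le> r m"
        using jJ by (auto simp: J'_def disjnt_def)
      then have "cball (a j) (r j) \<subseteq> cball (a m) (3 * r m)"
        using m(2)[OF jJ]
        by (smt (verit) dist_commute dist_triangle mem_cball subsetI)
      then show ?thesis by blast
    qed
    moreover have "insert m K \<subseteq> J" using m K(1) by (auto simp: J'_def)
    ultimately show ?thesis by blast
  qed
qed

text \<open>A pointwise maximal \<open>\<mu>\<close> makes every point lie in a ball of full mass; a disjoint
  subfamily of these balls, enlarged, is then an efficient cover.\<close>

lemma discrete_Frostman:
  fixes X :: "'a :: metric_space set"
  assumes "finite X" "0 < \<rho>" "0 < s"
  obtains \<mu> where "\<And>x. x \<in> X \<Longrightarrow> 0 \<le> \<mu> x"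
    and "\<And>x \<delta>. x \<in> X \<Longrightarrow> \<rho> \<le> \<delta> \<Longrightarrow> sum \<mu> (X \<inter> cball x \<delta>) \<le> \<delta> powr s"
    and "content_le s (8 powr s * sum \<mu> X) (\<Union>x\<in>X. cball x \<rho>)"
proof -
  \<comment> \<open>Finitely many radii represent all of them: a ball of radius at least \<rho>
    about a point of X meets X inside the ball with the largest radius of D not exceeding its
    own.\<close>
  define D where "D = insert \<rho> ((\<lambda>(x, y). max \<rho> (dist x y)) ` (X \<times> X))"
  have D: "finite D" "\<rho> \<in> D" "\<And>d. d \<in> D \<Longrightarrow> \<rho> \<le> d"
    using assms by (auto simp: D_def)
  define A where "A = (\<lambda>(x :: 'a, d). cball x d)"
  have "\<exists>\<mu>. (\<forall>x\<in>X. 0 \<le> \<mu> x) \<and> (\<forall>j\<in>X\<times>D. sum \<mu> (X \<inter> A j) \<le> snd j powr s) \<and>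
     (\<forall>x\<in>X. \<exists>j\<in>X\<times>D. x \<in> A j \<and> sum \<mu> (X \<inter> A j) = snd j powr s)"
  proof (rule maximal_packing)
    show "\<exists>j\<in>X\<times>D. x \<in> A j" if "x \<in> X" for x
      using that D(2) assms(2) by (intro bexI[of _ "(x, \<rho>)"]) (auto simp: A_def)
  qed (use assms D in auto)
  then obtain \<mu> where \<mu>: "\<forall>x\<in>X. 0 \<le> \<mu> x" "\<forall>j\<in>X\<times>D. sum \<mu> (X \<inter> A j) \<le> snd j powr s"
     "\<forall>x\<in>X. \<exists>j\<in>X\<times>D. x \<in> A j \<and> sum \<mu> (X \<inter> A j) = snd j powr s" by blast
  show thesis
  proof
    show "0 \<le> \<mu> x" if "x \<in> X" for x using \<mu>(1) that by blast
    show "sum \<mu> (X \<inter> cball x \<delta>) \<le> \<delta> powr s" if x: "x \<in> X" and \<delta>: "\<rho> \<le> \<delta>" for x \<delta>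
    proof -
      define E where "E = {d\<in>D. d \<le> \<delta>}"
      have E: "finite E" "E \<noteq> {}" using D \<delta> by (auto simp: E_def)
      have ME: "Max E \<in> D" "Max E \<le> \<delta>" "\<rho> \<le> Max E"
        using Max_in[OF E] D(3) by (auto simp: E_def)
      have "X \<inter> cball x \<delta> \<subseteq> X \<inter> cball x (Max E)"
      proof
        fix y assume y: "y \<in> X \<inter> cball x \<delta>"
        then have "max \<rho> (dist x y) \<in> E" using x \<delta> by (simp add: E_def D_def) force
        then have "max \<rho> (dist x y) \<le> Max E" using E(1) Max_ge by blast
        then show "y \<in> X \<inter> cball x (Max E)" using y by simp
      qed
      then have "sum \<mu> (X \<inter> cball x \<delta>) \<le> sum \<mu> (X \<inter> cball x (Max E))"
        using \<mu>(1) assms(1) by (intro sum_mono2) auto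
      also have "\<dots> \<le> Max E powr s"
        using \<mu>(2) x ME(1) by (auto simp: A_def)
      also have "\<dots> \<le> \<delta> powr s"
        using ME assms by (intro powr_mono2) auto
      finally show ?thesis .
    qed
    define J where "J = {j\<in>X\<times>D. sum \<mu> (X \<inter> A j) = snd j powr s}"
    have J: "finite J" using assms(1) D(1) by (simp add: J_def)
    have J0: "0 \<le> snd j" "\<rho> \<le> snd j" if "j \<in> J" for j using that D(3) assms(2) by (force simp: J_def)+
    obtain K where K: "K \<subseteq> J" "pairwise (\<lambda>i j. disjnt (cball (fst i) (snd i)) (cball (fst j) (snd j))) K"
      "\<forall>j\<in>J. \<exists>k\<in>K. cball (fst j) (snd j) \<subseteq> cball (fst k) (3 * snd k)"
      using finite_Vitali_cover[of J snd fst] J J0 by blast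
    have Aeq: "A j = cball (fst j) (snd j)" for j by (simp add: A_def case_prod_beta)
    have fK: "finite K" using J K(1) finite_subset by blast
    \<comment> \<open>Tripled radii cover X, and one more radius, which is at least \<rho>, absorbs
      the thickening. A ball of radius \<open>4 * snd k\<close> has diameter at most
      \<open>8 * snd k\<close>, whence \<open>8 powr s\<close>.\<close>
    show "content_le s (8 powr s * sum \<mu> X) (\<Union>x\<in>X. cball x \<rho>)"
    proof (rule content_le_finite[of K _ "\<lambda>k. cball (fst k) (4 * snd k)"])
      show "(\<Union>x\<in>X. cball x \<rho>) \<subseteq> (\<Union>k\<in>K. cball (fst k) (4 * snd k))"
      proof
        fix z assume "z \<in> (\<Union>x\<in>X. cball x \<rho>)"
        then obtain x where x: "x \<in> X" "dist x z \<le> \<rho>" by auto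
        then obtain j where "j \<in> J" "x \<in> A j" using \<mu>(3) by (auto simp: J_def)
        then obtain k where k: "k \<in> K" "x \<in> cball (fst k) (3 * snd k)" using K(3) Aeq by blast
        then have "dist (fst k) z \<le> 3 * snd k + \<rho>"
          using x(2) dist_triangle[of "fst k" z x] by simp
        also have "\<dots> \<le> 4 * snd k" using J0(2)[of k] k K(1) by auto
        finally show "z \<in> (\<Union>k\<in>K. cball (fst k) (4 * snd k))" using k(1) by auto
      qed
      have "(\<Sum>k\<in>K. diameter (cball (fst k) (4 * snd k)) powr s) \<le> (\<Sum>k\<in>K. 8 powr s * sum \<mu> (X \<inter> A k))"
      proof (rule sum_mono)
        fix k assume k: "k \<in> K"
        then have kJ: "k \<in> J" using K(1) by blast
        have "diameter (cball (fst k) (4 * snd k)) \<le> 8 * snd k"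
          using diameter_cball_le[of "4 * snd k" "fst k"] J0(1)[OF kJ] by simp
        then have "diameter (cball (fst k) (4 * snd k)) powr s \<le> (8 * snd k) powr s"
          using assms(3) by (intro powr_mono2) (auto intro!: diameter_ge_0)
        also have "\<dots> = 8 powr s * snd k powr s" by (simp add: powr_mult J0 kJ)
        finally show "diameter (cball (fst k) (4 * snd k)) powr s \<le> 8 powr s * sum \<mu> (X \<inter> A k)"
          using kJ by (simp add: J_def)
      qed
      also have "\<dots> = 8 powr s * (\<Sum>k\<in>K. sum \<mu> (X \<inter> A k))" by (simp add: sum_distrib_left)
      also have "(\<Sum>k\<in>K. sum \<mu> (X \<inter> A k)) = sum \<mu> (\<Union>k\<in>K. X \<inter> A k)"
      proof (rule sum.UNION_disjoint[symmetric])
        show "\<forall>i\<in>K. \<forall>j\<in>K. i \<noteq> j \<longrightarrow> (X \<inter> A i) \<inter> (X \<inter> A j) = {}"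
          using K(2) unfolding pairwise_def disjnt_def Aeq by blast
      qed (use fK assms(1) in auto)
      also have "\<dots> \<le> sum \<mu> X" using \<mu>(1) assms(1) by (intro sum_mono2) auto
      finally show "(\<Sum>k\<in>K. diameter (cball (fst k) (4 * snd k)) powr s) \<le> 8 powr s * sum \<mu> X"
        by simp
    qed (use fK in auto)
  qed
qed

section \<open>Subspaces almost orthogonal to a vector\<close>

lemma inner_orth_proj: "v \<in> points V \<Longrightarrow> v \<bullet> orth_proj V x = v \<bullet> x"
  using orth_proj_orthogonal[of v V x]
  unfolding orthogonal_def inner_diff_left inner_commute[of v] by linarith

lemma norm_orth_proj_le: "norm (orth_proj V x) \<le> norm x"
proof -
  have "norm (orth_proj V x) * norm (orth_proj V x) = orth_proj V x \<bullet> x"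
    using inner_orth_proj[of "orth_proj V x" V x, OF orth_proj_in] by (simp add: dot_square_norm power2_eq_square)
  also have "\<dots> \<le> norm (orth_proj V x) * norm x" by (rule norm_cauchy_schwarz)
  finally show ?thesis
    by (metis mult_left_le_imp_le norm_ge_zero norm_le_zero_iff order_le_less not_le)
qed

lemma norm_minus_orth_proj_le: "norm (x - orth_proj V x) \<le> norm x"
proof -
  define y z where "y = orth_proj V x" and "z = x - orth_proj V x"
  have "orthogonal y z"
    using orth_proj_orthogonal[of "orth_proj V x" V x, OF orth_proj_in]
    unfolding y_def z_def by (subst orthogonal_commute)
  then have "(norm (y + z))\<^sup>2 = (norm y)\<^sup>2 + (norm z)\<^sup>2" by (rule norm_add_Pythagorean)
  moreover have "y + z = x" by (simp add: y_def z_def)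
  ultimately have "(norm z)\<^sup>2 \<le> (norm x)\<^sup>2" by simp
  then show ?thesis unfolding z_def by (rule power2_le_imp_le) simp
qed

lemma norm_minus_orth_proj_le_dist:
  assumes "y \<in> points V"
  shows "norm (x - orth_proj V x) \<le> norm (x - y)"
proof -
  have "orth_proj V (x - y) = orth_proj V x - y"
    by (simp add: linear_diff[OF linear_orth_proj] orth_proj_id assms)
  then show ?thesis using norm_minus_orth_proj_le[of "x - y" V] by simp
qed

text \<open>Split z into its component in V and a vector w orthogonal to V. The first is moved by at
  most \<open>c * norm z\<close>, since W comes that close to it. For
  \<open>y = orth_proj W w\<close> and x in V near y,
  \<open>norm y ^ 2 = y \<bullet> w = (y - x) \<bullet> w\<close>, which makes y small too. Each
  component contributes one c.\<close>

lemma dist_linsub_le: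
  assumes "0 \<le> c"
    and "\<And>x. x \<in> points V \<Longrightarrow> \<exists>y\<in>points W. norm (x - y) \<le> c * norm x"
    and "\<And>y. y \<in> points W \<Longrightarrow> \<exists>x\<in>points V. norm (y - x) \<le> c * norm y"
  shows "dist V W \<le> 2 * c"
  unfolding dist_linsub_def
proof (rule onorm_le)
  fix z
  define w where "w = z - orth_proj V z"
  define y where "y = orth_proj W w"
  have eq: "orth_proj V z - orth_proj W z = (orth_proj V z - orth_proj W (orth_proj V z)) - y"
    by (simp add: y_def w_def linear_diff[OF linear_orth_proj])
  have "norm (orth_proj V z - orth_proj W z)
      \<le> norm (orth_proj V z - orth_proj W (orth_proj V z)) + norm y"
    unfolding eq by (rule norm_triangle_ineq4)
  also have "norm (orth_proj V z - orth_proj W (orth_proj V z)) \<le> c * norm z"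
  proof -
    obtain x where "x \<in> points W" "norm (orth_proj V z - x) \<le> c * norm (orth_proj V z)"
      using assms(2)[OF orth_proj_in] by blast
    then have "norm (orth_proj V z - orth_proj W (orth_proj V z)) \<le> c * norm (orth_proj V z)"
      using norm_minus_orth_proj_le_dist order_trans by blast
    also have "\<dots> \<le> c * norm z" using norm_orth_proj_le assms(1) by (rule mult_left_mono)
    finally show ?thesis .
  qed
  also have "norm y \<le> c * norm z"
  proof (cases "y = 0")
    case False
    obtain x where x: "x \<in> points V" "norm (y - x) \<le> c * norm y"
      using assms(3)[OF orth_proj_in] y_def by blast
    have "norm y * norm y = y \<bullet> w"
      using inner_orth_proj[of "orth_proj W w" W w, OF orth_proj_in]
      by (simp add: y_def dot_square_norm power2_eq_square)
    also have "\<dots> = (y - x) \<bullet> w"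
      using orth_proj_orthogonal[OF x(1), of z]
      by (simp add: w_def orthogonal_def inner_diff_left inner_diff_right inner_commute)
    also have "\<dots> \<le> norm (y - x) * norm w" by (rule norm_cauchy_schwarz)
    also have "\<dots> \<le> (c * norm y) * norm z"
      using x(2) norm_minus_orth_proj_le[of z V] assms(1) by (intro mult_mono) (auto simp: w_def)
    finally have "norm y * norm y \<le> norm y * (c * norm z)" by (simp add: algebra_simps)
    then show ?thesis using False by simp
  qed (use assms(1) in simp)
  finally show "norm (orth_proj V z - orth_proj W z) \<le> 2 * c * norm z" by simp
qed

lemma dist_linsub_le_2:
  fixes V W :: "'a :: euclidean_space linsub"
  shows "dist V W \<le> 2"
proof -
  have "\<exists>y\<in>points W. norm (x - y) \<le> 1 * norm x" for x :: 'a and W :: "'a linsub"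
    by (rule bexI[of _ 0]) (auto simp: subspace_0 subspace_points)
  then show ?thesis using dist_linsub_le[of 1 V W] by simp
qed

text \<open>One representative is kept for each code that occurs. The centres lie in X itself,
  because mass bounds are only available for balls centred in the set under consideration.\<close>

lemma code_net:
  fixes X :: "'a :: metric_space set"
  assumes "finite C" "code ` X \<subseteq> C"
    and "\<And>V W. V \<in> X \<Longrightarrow> W \<in> X \<Longrightarrow> code V = code W \<Longrightarrow> dist V W \<le> r"
  shows "\<exists>Y\<subseteq>X. finite Y \<and> card Y \<le> card C \<and> X \<subseteq> (\<Union>y\<in>Y. cball y r)"
proof (intro exI conjI)
  define Y where "Y = inv_into X code ` code ` X"
  have fin: "finite (code ` X)" using assms finite_subset by blast
  show "Y \<subseteq> X" by (auto simp: Y_def inv_into_into)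
  show "finite Y" using fin by (simp add: Y_def)
  have "card Y \<le> card (code ` X)" unfolding Y_def using fin by (rule card_image_le)
  also have "\<dots> \<le> card C" using assms by (simp add: card_mono)
  finally show "card Y \<le> card C" .
  show "X \<subseteq> (\<Union>y\<in>Y. cball y r)"
  proof
    fix x assume x: "x \<in> X"
    define y where "y = inv_into X code (code x)"
    have "y \<in> Y" "y \<in> X" "code y = code x"
      using x by (auto simp: y_def Y_def inv_into_into f_inv_into_f)
    then show "x \<in> (\<Union>y\<in>Y. cball y r)" using assms(3)[of y x] x by auto
  qed
qed

lemma floor_divide_eq_imp_abs_diff_le:
  fixes a b \<delta> :: real
  assumes "\<lfloor>a / \<delta>\<rfloor> = \<lfloor>b / \<delta>\<rfloor>" "0 < \<delta>"
  shows "\<bar>a - b\<bar> \<le> \<delta>"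
proof -
  have "\<bar>a / \<delta> - b / \<delta>\<bar> \<le> 1" using assms(1) by linarith
  then have "\<bar>(a - b) / \<delta>\<bar> \<le> 1" by (simp add: diff_divide_distrib)
  then show ?thesis using assms(2) by (simp add: abs_divide)
qed

lemma linsub_finite_net:
  fixes X :: "'a :: euclidean_space linsub set"
  assumes "0 < \<epsilon>"
  shows "\<exists>Y\<subseteq>X. finite Y \<and> X \<subseteq> (\<Union>y\<in>Y. cball y \<epsilon>)"
proof -
  define B where "B = (Basis :: 'a set)"
  define n where "n = real DIM('a)"
  have n: "1 \<le> n" using DIM_positive[where 'a='a] unfolding n_def by linarith
  \<comment> \<open>The code below is the matrix of the projection rounded to multiples of \<eta>.
    Entrywise closeness costs one factor n for the norm of each column and another for the sum over
    the columns.\<close>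
  define \<eta> where "\<eta> = \<epsilon> / n\<^sup>2"
  have \<eta>: "0 < \<eta>" using assms n by (simp add: \<eta>_def)
  define code where "code V = (\<lambda>(e, e')\<in>B \<times> B. \<lfloor>(orth_proj V e \<bullet> e') / \<eta>\<rfloor>)" for V :: "'a linsub"
  define M where "M = \<lceil>1 / \<eta>\<rceil>"
  have fin: "finite (PiE (B \<times> B) (\<lambda>_. {-M..M}))"
    by (intro finite_PiE) (auto simp: B_def)
  have ran: "code ` X \<subseteq> PiE (B \<times> B) (\<lambda>_. {-M..M})"
  proof -
    have "\<lfloor>(orth_proj V e \<bullet> e') / \<eta>\<rfloor> \<in> {-M..M}" if "e \<in> B" "e' \<in> B" for V e e'
    proof -
      have "\<bar>orth_proj V e \<bullet> e'\<bar> \<le> norm (orth_proj V e) * norm e'" by (rule Cauchy_Schwarz_ineq2)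
      also have "\<dots> \<le> 1" using that norm_orth_proj_le[of V e] by (simp add: B_def)
      finally have "\<bar>(orth_proj V e \<bullet> e') / \<eta>\<bar> \<le> 1 / \<eta>"
        using \<eta> by (simp add: abs_divide divide_right_mono)
      then show ?thesis unfolding M_def atLeastAtMost_iff abs_le_iff by linarith
    qed
    then show ?thesis unfolding code_def by (intro image_subsetI) (simp add: PiE_iff split_beta)
  qed
  have "dist V W \<le> \<epsilon>" if "code V = code W" for V W
    unfolding dist_linsub_def
  proof (rule onorm_le)
    fix x :: 'a
    define D where "D y = orth_proj V y - orth_proj W y" for y
    have lin: "linear D" unfolding D_def by (intro linear_compose_sub linear_orth_proj)
    have D: "\<bar>D e \<bullet> e'\<bar> \<le> \<eta>" if "e \<in> B" "e' \<in> B" for e e'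
    proof -
      have "\<lfloor>(orth_proj V e \<bullet> e') / \<eta>\<rfloor> = \<lfloor>(orth_proj W e \<bullet> e') / \<eta>\<rfloor>"
        using fun_cong[OF \<open>code V = code W\<close>, of "(e, e')"] that by (simp add: code_def)
      then show ?thesis
        using floor_divide_eq_imp_abs_diff_le \<eta> by (simp add: D_def inner_diff_left)
    qed
    have "D x = D (\<Sum>e\<in>B. (x \<bullet> e) *\<^sub>R e)" by (simp add: B_def euclidean_representation)
    also have "\<dots> = (\<Sum>e\<in>B. (x \<bullet> e) *\<^sub>R D e)"
      by (simp add: linear_sum[OF lin] linear_cmul[OF lin])
    finally have "norm (D x) \<le> (\<Sum>e\<in>B. norm ((x \<bullet> e) *\<^sub>R D e))" using norm_sum by metis
    also have "\<dots> \<le> (\<Sum>e\<in>B. norm x * (n * \<eta>))"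
    proof (rule sum_mono)
      fix e assume e: "e \<in> B"
      have "norm (D e) \<le> (\<Sum>e'\<in>B. \<bar>D e \<bullet> e'\<bar>)" unfolding B_def by (rule norm_le_l1)
      also have "\<dots> \<le> (\<Sum>e'\<in>B. \<eta>)" using D e by (intro sum_mono)
      also have "\<dots> = n * \<eta>" by (simp add: n_def B_def)
      finally show "norm ((x \<bullet> e) *\<^sub>R D e) \<le> norm x * (n * \<eta>)"
        using Basis_le_norm[of e x] e unfolding norm_scaleR B_def by (intro mult_mono) auto
    qed
    also have "\<dots> = \<epsilon> * norm x"
      using n by (simp add: n_def[symmetric] B_def \<eta>_def power2_eq_square)
    finally show "norm (orth_proj V x - orth_proj W x) \<le> \<epsilon> * norm x" by (simp add: D_def)
  qed
  then have "\<exists>Y\<subseteq>X. finite Y \<and> card Y \<le> card (PiE (B \<times> B) (\<lambda>_. {-M..M})) \<and>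
      X \<subseteq> (\<Union>y\<in>Y. cball y \<epsilon>)"
    by (intro code_net[OF fin ran])
  then show ?thesis by (elim exE conjE) (intro exI conjI)
qed

text \<open>Gaussian elimination with full pivoting keeps the coefficients bounded.\<close>

lemma bounded_echelon_basis:
  fixes W :: "'a :: euclidean_space set"
  assumes "subspace W" "finite S"
    and "\<And>w. w \<in> W \<Longrightarrow> (\<forall>e\<in>S. w \<bullet> e = 0) \<Longrightarrow> w = 0"
  shows "\<exists>I v. I \<subseteq> S \<and> (\<forall>i\<in>I. v i \<in> W) \<and> (\<forall>i\<in>I. \<forall>l\<in>I. v i \<bullet> l = (if i = l then 1 else 0)) \<and>
     (\<forall>i\<in>I. \<forall>e\<in>S. \<bar>v i \<bullet> e\<bar> \<le> fact (card I)) \<and> (\<forall>w\<in>W. (\<forall>i\<in>I. w \<bullet> i = 0) \<longrightarrow> w = 0)"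
  using assms
proof (induction "dim W" arbitrary: W rule: less_induct)
  case less
  show ?case
  proof (cases "W \<subseteq> {0}")
    case True
    then show ?thesis by (intro exI[of _ "{}"]) auto
  next
    case False
    then obtain w0 where w0: "w0 \<in> W" "w0 \<noteq> 0" by blast
    have "S \<noteq> {}" using less.prems(3)[OF w0(1)] w0(2) by auto
    have "Max ((\<lambda>e. \<bar>w0 \<bullet> e\<bar>) ` S) \<in> (\<lambda>e. \<bar>w0 \<bullet> e\<bar>) ` S"
      using \<open>S \<noteq> {}\<close> less.prems(2) by (intro Max_in) auto
    then obtain p where p: "p \<in> S" "\<bar>w0 \<bullet> p\<bar> = Max ((\<lambda>e. \<bar>w0 \<bullet> e\<bar>) ` S)" by auto
    then have pmax: "\<bar>w0 \<bullet> e\<bar> \<le> \<bar>w0 \<bullet> p\<bar>" if "e \<in> S" for e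
      using that less.prems(2) by simp
    have p0: "w0 \<bullet> p \<noteq> 0"
    proof
      assume "w0 \<bullet> p = 0"
      then have "\<forall>e\<in>S. w0 \<bullet> e = 0" using pmax by auto
      then show False using less.prems(3) w0 by blast
    qed
    define w where "w = (1 / (w0 \<bullet> p)) *\<^sub>R w0"
    have w: "w \<in> W" "w \<bullet> p = 1" using w0 p0 less.prems(1) by (auto simp: w_def subspace_scale)
    have w1: "\<bar>w \<bullet> e\<bar> \<le> 1" if "e \<in> S" for e
      using pmax[OF that] p0 by (simp add: w_def abs_divide)
    \<comment> \<open>Vectors of W' vanish at p, so the pivots found in W' differ from p, and the
      rows found there need no correction.\<close>
    define W' where "W' = {x\<in>W. x \<bullet> p = 0}"
    have sub: "subspace W'"
      using less.prems(1) by (auto simp: W'_def subspace_def inner_add_left)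
    have "w \<notin> W'" "W' \<subseteq> W" using w(2) by (auto simp: W'_def)
    then have "W' \<subset> W" using w(1) by blast
    then have dimW': "dim W' < dim W"
      using sub less.prems(1) by (intro dim_psubset) (metis span_eq_iff)
    have sep': "\<And>x. x \<in> W' \<Longrightarrow> \<forall>e\<in>S. x \<bullet> e = 0 \<Longrightarrow> x = 0"
      using less.prems(3) by (auto simp: W'_def)
    have "\<exists>I v. I \<subseteq> S \<and> (\<forall>i\<in>I. v i \<in> W') \<and>
      (\<forall>i\<in>I. \<forall>l\<in>I. v i \<bullet> l = (if i = l then 1 else 0)) \<and>
      (\<forall>i\<in>I. \<forall>e\<in>S. \<bar>v i \<bullet> e\<bar> \<le> fact (card I)) \<and>
      (\<forall>w\<in>W'. (\<forall>i\<in>I. w \<bullet> i = 0) \<longrightarrow> w = 0)"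
      by (rule less.hyps[OF dimW' sub less.prems(2) sep'])
    then obtain I v where I: "I \<subseteq> S" "\<forall>i\<in>I. v i \<in> W'"
      "\<forall>i\<in>I. \<forall>l\<in>I. v i \<bullet> l = (if i = l then 1 else 0)"
      "\<forall>i\<in>I. \<forall>e\<in>S. \<bar>v i \<bullet> e\<bar> \<le> fact (card I)"
      "\<forall>w\<in>W'. (\<forall>i\<in>I. w \<bullet> i = 0) \<longrightarrow> w = 0"
      by (elim exE conjE) (rule that)
    have vp: "v i \<bullet> p = 0" if "i \<in> I" for i using I(2) that by (auto simp: W'_def)
    have pI: "p \<notin> I" using vp[of p] I(3) by auto
    have finI: "finite I" using I(1) less.prems(2) finite_subset by blast
    \<comment> \<open>This clears the entries of the new row at the old pivots. Those entries are at
      most 1 by the choice of p, and with \<open>k = card I\<close> the old rows are bounded by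
      \<open>fact k\<close>, so the new row is bounded by
      \<open>1 + k * fact k \<le> fact (k + 1)\<close>.\<close>
    define q where "q = w - (\<Sum>l\<in>I. (w \<bullet> l) *\<^sub>R v l)"
    define v' where "v' = v(p := q)"
    have qW: "q \<in> W"
      unfolding q_def using I(2) less.prems(1) w(1)
      by (intro subspace_diff subspace_sum subspace_scale) (auto simp: W'_def)
    have qp: "q \<bullet> p = 1"
      using vp by (simp add: q_def inner_diff_left inner_sum_left w(2))
    have qI: "q \<bullet> l = 0" if "l \<in> I" for l
    proof -
      have "(\<Sum>k\<in>I. (w \<bullet> k) * (v k \<bullet> l)) = (\<Sum>k\<in>I. if k = l then w \<bullet> k else 0)"
        using I(3) that by (intro sum.cong) auto
      then show ?thesis
        using that finI by (simp add: q_def inner_diff_left inner_sum_left)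
    qed
    have f: "(fact (card (insert p I)) :: real) = (1 + real (card I)) * fact (card I)"
      using finI pI by (simp add: algebra_simps)
    have f1: "(1::real) \<le> fact (card I)" by (rule fact_ge_1)
    have qe: "\<bar>q \<bullet> e\<bar> \<le> fact (card (insert p I))" if e: "e \<in> S" for e
    proof -
      have "\<bar>\<Sum>l\<in>I. (w \<bullet> l) * (v l \<bullet> e)\<bar> \<le> (\<Sum>l\<in>I. \<bar>(w \<bullet> l) * (v l \<bullet> e)\<bar>)" by (rule sum_abs)
      also have "\<dots> \<le> (\<Sum>l\<in>I. 1 * fact (card I))"
        unfolding abs_mult using I(1,4) w1 e by (intro sum_mono mult_mono) auto
      finally have "\<bar>\<Sum>l\<in>I. (w \<bullet> l) * (v l \<bullet> e)\<bar> \<le> real (card I) * fact (card I)" by simp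
      moreover have "q \<bullet> e = w \<bullet> e - (\<Sum>l\<in>I. (w \<bullet> l) * (v l \<bullet> e))"
        by (simp add: q_def inner_diff_left inner_sum_left)
      ultimately have "\<bar>q \<bullet> e\<bar> \<le> 1 + real (card I) * fact (card I)" using w1[OF e] by linarith
      then show ?thesis unfolding f using f1 unfolding distrib_right mult_1_left by linarith
    qed
    have ve: "\<bar>v i \<bullet> e\<bar> \<le> fact (card (insert p I))" if "i \<in> I" "e \<in> S" for i e
    proof -
      have "\<bar>v i \<bullet> e\<bar> \<le> fact (card I)" using I(4) that by blast
      also have "\<dots> \<le> (1 + real (card I)) * fact (card I)" using f1 by (simp add: algebra_simps)
      finally show ?thesis using f by simp
    qed
    show ?thesis
    proof (intro exI conjI)
      show "insert p I \<subseteq> S" using p(1) I(1) by simp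
      show "\<forall>i\<in>insert p I. v' i \<in> W" using qW I(2) pI by (auto simp: v'_def W'_def)
      show "\<forall>i\<in>insert p I. \<forall>l\<in>insert p I. v' i \<bullet> l = (if i = l then 1 else 0)"
        using qp qI vp I(3) pI by (auto simp: v'_def)
      show "\<forall>i\<in>insert p I. \<forall>e\<in>S. \<bar>v' i \<bullet> e\<bar> \<le> fact (card (insert p I))"
        using qe ve pI by (auto simp: v'_def)
      show "\<forall>w\<in>W. (\<forall>i\<in>insert p I. w \<bullet> i = 0) \<longrightarrow> w = 0"
        using I(5) by (auto simp: W'_def)
    qed
  qed
qed

text \<open>A vector of W is determined by its entries at the pivots, so x coincides with the
  combination of rows that has the same entries there. The rows thus form a basis of W.\<close>

lemma echelon_expand:
  fixes W :: "'a :: euclidean_space set"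
  assumes "subspace W" "finite I" "\<And>i. i \<in> I \<Longrightarrow> v i \<in> W"
    and "\<And>i l. i \<in> I \<Longrightarrow> l \<in> I \<Longrightarrow> v i \<bullet> l = (if i = l then 1 else 0)"
    and "\<And>w. w \<in> W \<Longrightarrow> (\<forall>i\<in>I. w \<bullet> i = 0) \<Longrightarrow> w = 0"
  shows "x \<in> W \<Longrightarrow> x = (\<Sum>i\<in>I. (x \<bullet> i) *\<^sub>R v i)" and "card I = dim W"
proof -
  have ex: "x = (\<Sum>i\<in>I. (x \<bullet> i) *\<^sub>R v i)" if "x \<in> W" for x
  proof -
    have "x - (\<Sum>i\<in>I. (x \<bullet> i) *\<^sub>R v i) = 0"
    proof (rule assms(5))
      show "x - (\<Sum>i\<in>I. (x \<bullet> i) *\<^sub>R v i) \<in> W"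
        using assms(1,3) that by (intro subspace_diff subspace_sum subspace_scale) auto
      show "\<forall>l\<in>I. (x - (\<Sum>i\<in>I. (x \<bullet> i) *\<^sub>R v i)) \<bullet> l = 0"
      proof
        fix l assume l: "l \<in> I"
        have "(\<Sum>k\<in>I. (x \<bullet> k) * (v k \<bullet> l)) = (\<Sum>k\<in>I. if k = l then x \<bullet> k else 0)"
          using assms(4) l by (intro sum.cong) auto
        then show "(x - (\<Sum>i\<in>I. (x \<bullet> i) *\<^sub>R v i)) \<bullet> l = 0"
          using l assms(2) by (simp add: inner_diff_left inner_sum_left)
      qed
    qed
    then show ?thesis by simp
  qed
  then show "x \<in> W \<Longrightarrow> x = (\<Sum>i\<in>I. (x \<bullet> i) *\<^sub>R v i)" .
  have inj: "inj_on v I"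
  proof (rule inj_onI)
    fix i l assume "i \<in> I" "l \<in> I" "v i = v l"
    then show "i = l" using assms(4)[of i l] assms(4)[of l l] by (auto split: if_splits)
  qed
  have "independent (v ` I)"
  proof (rule independent_if_scalars_zero)
    fix f y assume s: "(\<Sum>z\<in>v ` I. f z *\<^sub>R z) = 0" and "y \<in> v ` I"
    then obtain l where l: "l \<in> I" "y = v l" by blast
    have "0 = (\<Sum>i\<in>I. f (v i) *\<^sub>R v i) \<bullet> l" using s by (simp add: sum.reindex[OF inj])
    also have "\<dots> = (\<Sum>i\<in>I. if i = l then f (v i) else 0)"
      unfolding inner_sum_left using assms(4) l(1) by (intro sum.cong) auto
    also have "\<dots> = f y" using l assms(2) by simp
    finally show "f y = 0" by simp
  qed (use assms(2) in simp)
  moreover have "W \<subseteq> span (v ` I)"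
  proof
    fix x assume "x \<in> W"
    then have "x = (\<Sum>i\<in>I. (x \<bullet> i) *\<^sub>R v i)" by (rule ex)
    also have "\<dots> \<in> span (v ` I)" by (intro span_sum span_scale span_base) auto
    finally show "x \<in> span (v ` I)" .
  qed
  ultimately have "card (v ` I) = dim W"
    using assms(3) by (intro basis_card_eq_dim) auto
  then show "card I = dim W" using card_image[OF inj] by simp
qed

text \<open>For \<open>\<delta> \<le> 1/2\<close> a vector of V has at most half its norm along u,
  so its coordinates along \<open>S - {u}\<close> determine it and the pivots can avoid u. The rows
  then have entries of order \<delta> along u and of order 1 elsewhere: m of the
  \<open>m * (n - m)\<close> free entries are confined, which is the origin of the exponent
  \<open>m * (n - 1 - m)\<close>.\<close>

lemma grassmannian_echelon_coordinates:
  fixes V :: "'a :: euclidean_space linsub" and S :: "'a set" and \<delta> :: real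
  assumes V: "V \<in> grassmannian m" "norm (orth_proj V u) \<le> \<delta>" "\<delta> \<le> 1/2"
    and S: "u \<in> S" "pairwise orthogonal S" "\<And>x. x \<in> S \<Longrightarrow> norm x = 1"
      "independent S" "card S = DIM('a)" "span S = UNIV"
  shows "\<exists>I v. I \<subseteq> S - {u} \<and> card I = m \<and> (\<forall>i\<in>I. v i \<in> points V) \<and>
    (\<forall>i\<in>I. \<forall>l\<in>I. v i \<bullet> l = (if i = l then 1 else 0)) \<and>
    (\<forall>i\<in>I. \<forall>e\<in>S-{u}. \<bar>v i \<bullet> e\<bar> \<le> fact m) \<and>
    (\<forall>i\<in>I. \<bar>v i \<bullet> u\<bar> \<le> 2 * real DIM('a) * fact m * \<delta>) \<and>
    (\<forall>x\<in>points V. x = (\<Sum>i\<in>I. (x \<bullet> i) *\<^sub>R v i))"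
proof -
  have finS: "finite S" using S(4) independent_imp_finite by blast
  have expand: "(\<Sum>e\<in>S. (x \<bullet> e) *\<^sub>R e) = x" for x
    using S finS by (intro orthonormal_basis_expand) auto
  have proj: "\<bar>w \<bullet> u\<bar> \<le> norm w * \<delta>" if "w \<in> points V" for w
  proof -
    have "\<bar>w \<bullet> u\<bar> = \<bar>w \<bullet> orth_proj V u\<bar>" using inner_orth_proj[OF that, of u] by simp
    also have "\<dots> \<le> norm w * norm (orth_proj V u)" by (rule Cauchy_Schwarz_ineq2)
    also have "\<dots> \<le> norm w * \<delta>" using V(2) by (intro mult_left_mono) auto
    finally show ?thesis .
  qed
  have half: "\<bar>w \<bullet> u\<bar> \<le> norm w / 2" if "w \<in> points V" for w
  proof -
    have "norm w * \<delta> \<le> norm w * (1/2)" using V(3) by (intro mult_left_mono) auto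
    then show ?thesis using proj[OF that] by simp
  qed
  have split: "(\<Sum>e\<in>S. f e) = f u + (\<Sum>e\<in>S-{u}. f e)" for f :: "'a \<Rightarrow> 'b :: comm_monoid_add"
    using finS S(1) by (rule sum.remove)
  \<comment> \<open>Absorbing the half on the left bounds the norm by twice the sum of the other
    coordinates. This is the factor 2 in the bound for \<open>v i \<bullet> u\<close>.\<close>
  have l1: "norm w \<le> norm w / 2 + (\<Sum>e\<in>S-{u}. \<bar>w \<bullet> e\<bar>)" if "w \<in> points V" for w
  proof -
    have "norm w = norm (\<Sum>e\<in>S. (w \<bullet> e) *\<^sub>R e)" by (simp add: expand)
    also have "\<dots> \<le> (\<Sum>e\<in>S. norm ((w \<bullet> e) *\<^sub>R e))" by (rule norm_sum)
    also have "\<dots> = (\<Sum>e\<in>S. \<bar>w \<bullet> e\<bar>)" using S(3) by (intro sum.cong) auto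
    also have "\<dots> = \<bar>w \<bullet> u\<bar> + (\<Sum>e\<in>S-{u}. \<bar>w \<bullet> e\<bar>)" by (rule split)
    finally show ?thesis using half[OF that] by linarith
  qed
  have sep: "w = 0" if "w \<in> points V" "\<forall>e\<in>S-{u}. w \<bullet> e = 0" for w
  proof -
    have "(\<Sum>e\<in>S-{u}. \<bar>w \<bullet> e\<bar>) = 0" using that(2) by (intro sum.neutral) auto
    then show ?thesis using l1[OF that(1)] by simp
  qed
  obtain I v where I: "I \<subseteq> S - {u}" "\<forall>i\<in>I. v i \<in> points V"
    "\<forall>i\<in>I. \<forall>l\<in>I. v i \<bullet> l = (if i = l then 1 else 0)"
    "\<forall>i\<in>I. \<forall>e\<in>S-{u}. \<bar>v i \<bullet> e\<bar> \<le> fact (card I)"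
    "\<forall>w\<in>points V. (\<forall>i\<in>I. w \<bullet> i = 0) \<longrightarrow> w = 0"
    using bounded_echelon_basis[OF subspace_points, of "S - {u}" V] finS sep by blast
  have finI: "finite I" using I(1) finS finite_subset by blast
  have card: "card I = m"
    using echelon_expand(2)[OF subspace_points finI, of v V] I(2,3,5) V(1)
    by (simp add: grassmannian_def)
  have ex: "\<forall>x\<in>points V. x = (\<Sum>i\<in>I. (x \<bullet> i) *\<^sub>R v i)"
    using echelon_expand(1)[OF subspace_points finI, of v V] I(2,3,5) by blast
  have "\<bar>v i \<bullet> u\<bar> \<le> 2 * real DIM('a) * fact m * \<delta>" if i: "i \<in> I" for i
  proof -
    have vi: "v i \<in> points V" using I(2) i by blast
    have \<delta>0: "0 \<le> \<delta>" using V(2) norm_ge_zero order_trans by blast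
    have "(\<Sum>e\<in>S-{u}. \<bar>v i \<bullet> e\<bar>) \<le> (\<Sum>e\<in>S-{u}. fact m)"
      using I(4) card i by (intro sum_mono) auto
    also have "\<dots> \<le> (\<Sum>e\<in>S. fact m)"
      using finS by (intro sum_mono2) auto
    also have "\<dots> = real DIM('a) * fact m" using S(5) by simp
    finally have "norm (v i) \<le> 2 * (real DIM('a) * fact m)" using l1[OF vi] by linarith
    then have "norm (v i) * \<delta> \<le> 2 * (real DIM('a) * fact m) * \<delta>"
      using \<delta>0 by (rule mult_right_mono)
    then show ?thesis using proj[OF vi] by (simp add: mult.assoc)
  qed
  then show ?thesis using I(1-4) card ex by blast
qed

text \<open>The approximant of x in the other subspace is the vector with the same entries at the
  common pivots, that is, the same combination of the other rows. Each coefficient is at most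
  \<open>norm x\<close>, as the pivot vectors are unit vectors.\<close>

lemma dist_linsub_le_echelon:
  fixes V W :: "'a :: euclidean_space linsub" and \<eta> :: real
  assumes "finite I" "\<And>i. i \<in> I \<Longrightarrow> norm i = 1" "0 \<le> \<eta>"
    and "\<And>i. i \<in> I \<Longrightarrow> v i \<in> points V" "\<And>i. i \<in> I \<Longrightarrow> w i \<in> points W"
    and "\<And>x. x \<in> points V \<Longrightarrow> x = (\<Sum>i\<in>I. (x \<bullet> i) *\<^sub>R v i)"
    and "\<And>x. x \<in> points W \<Longrightarrow> x = (\<Sum>i\<in>I. (x \<bullet> i) *\<^sub>R w i)"
    and "\<And>i. i \<in> I \<Longrightarrow> norm (v i - w i) \<le> \<eta>"
  shows "dist V W \<le> 2 * (real (card I) * \<eta>)"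
proof -
  have *: "\<exists>y\<in>points W. norm (x - y) \<le> real (card I) * \<eta> * norm x"
    if x: "x = (\<Sum>i\<in>I. (x \<bullet> i) *\<^sub>R v i)" and w: "\<And>i. i \<in> I \<Longrightarrow> w i \<in> points W"
      and close: "\<And>i. i \<in> I \<Longrightarrow> norm (v i - w i) \<le> \<eta>"
    for x and v w :: "'a \<Rightarrow> 'a" and W :: "'a linsub"
  proof
    show "(\<Sum>i\<in>I. (x \<bullet> i) *\<^sub>R w i) \<in> points W"
      using w by (intro subspace_sum subspace_scale subspace_points) auto
    have "x - (\<Sum>i\<in>I. (x \<bullet> i) *\<^sub>R w i) = (\<Sum>i\<in>I. (x \<bullet> i) *\<^sub>R (v i - w i))"
      by (subst (1) x) (simp add: scaleR_diff_right sum_subtractf)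
    then have "norm (x - (\<Sum>i\<in>I. (x \<bullet> i) *\<^sub>R w i)) \<le> (\<Sum>i\<in>I. norm ((x \<bullet> i) *\<^sub>R (v i - w i)))"
      by (metis norm_sum)
    also have "\<dots> \<le> (\<Sum>i\<in>I. norm x * \<eta>)"
    proof (rule sum_mono)
      fix i assume i: "i \<in> I"
      have "\<bar>x \<bullet> i\<bar> \<le> norm x" using Cauchy_Schwarz_ineq2[of x i] assms(2)[OF i] by simp
      then show "norm ((x \<bullet> i) *\<^sub>R (v i - w i)) \<le> norm x * \<eta>"
        unfolding norm_scaleR using close[OF i] by (intro mult_mono) auto
    qed
    also have "\<dots> = real (card I) * \<eta> * norm x" by simp
    finally show "norm (x - (\<Sum>i\<in>I. (x \<bullet> i) *\<^sub>R w i)) \<le> real (card I) * \<eta> * norm x" .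
  qed
  show ?thesis
  proof (rule dist_linsub_le)
    show "\<exists>y\<in>points W. norm (x - y) \<le> real (card I) * \<eta> * norm x" if "x \<in> points V" for x
      by (rule *[OF assms(6)[OF that] assms(5,8)])
    show "\<exists>x\<in>points V. norm (y - x) \<le> real (card I) * \<eta> * norm y" if "y \<in> points W" for y
      using assms(8) by (intro *[OF assms(7)[OF that] assms(4)]) (auto simp: norm_minus_commute)
  qed (use assms(3) in simp)
qed

text \<open>Entries at pivots are 0 or 1, so a code records only I and the entries on
  \<open>I \<times> (S - I)\<close>. Each of the m rows has one entry at u and
  \<open>n - 1 - m\<close> further ones. In the application N does not depend on \<delta>, whereas M
  is of order \<open>1 / \<delta>\<close>.\<close>

lemma card_echelon_codes:
  fixes S :: "'a set" and N M :: nat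
  assumes "finite S" "u \<in> S" "card S = n" "m < n"
  defines "R \<equiv> (\<lambda>(i, e). if e = u then {- int N..int N} else {- int M..int M})"
  defines "C \<equiv> Sigma {I. I \<subseteq> S - {u} \<and> card I = m} (\<lambda>I. PiE (I \<times> (S - I)) R)"
  shows "finite C" "card C \<le> 2 ^ n * (2 * N + 1) ^ m * (2 * M + 1) ^ (m * (n - 1 - m))"
proof -
  define A where "A = {I. I \<subseteq> S - {u} \<and> card I = m}"
  have A: "finite A" "A \<subseteq> Pow S" using assms(1) by (auto simp: A_def)
  have "card A \<le> card (Pow S)" using A assms(1) by (intro card_mono) auto
  then have cA: "card A \<le> 2 ^ n" using assms(1,3) by (simp add: card_Pow)
  have int_card: "card {- int k..int k} = 2 * k + 1" for k
    by (simp add: nat_add_distrib nat_mult_distrib)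
  have fR: "finite (R p)" for p by (auto simp: R_def split: prod.split)
  have fin: "finite (PiE (I \<times> (S - I)) R)" if "I \<in> A" for I
    using fR that assms(1) finite_subset[of I S] by (intro finite_PiE finite_cartesian_product) (auto simp: A_def)
  have eq: "card (PiE (I \<times> (S - I)) R) = (2 * N + 1) ^ m * (2 * M + 1) ^ (m * (n - 1 - m))"
    if I: "I \<in> A" for I
  proof -
    have I': "I \<subseteq> S" "u \<notin> I" "card I = m" "finite I"
      using I assms(1) finite_subset[of I S] by (auto simp: A_def)
    define T where "T = S - I - {u}"
    have SI: "S - I = insert u T" "u \<notin> T" "finite T" using I' assms by (auto simp: T_def)
    have "card (S - I) = n - m" using I' assms by (simp add: card_Diff_subset)
    then have cT: "card T = n - 1 - m" using SI by simp
    have "card (PiE (I \<times> (S - I)) R) = (\<Prod>p\<in>I \<times> (S - I). card (R p))"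
      using I' assms(1) by (intro card_PiE) auto
    also have "\<dots> = (\<Prod>i\<in>I. \<Prod>e\<in>S - I. card (R (i, e)))"
      by (simp add: prod.cartesian_product)
    also have "\<dots> = (\<Prod>i\<in>I. (2 * N + 1) * (2 * M + 1) ^ (n - 1 - m))"
    proof (rule prod.cong)
      fix i
      have "(\<Prod>e\<in>S - I. card (R (i, e))) = card (R (i, u)) * (\<Prod>e\<in>T. card (R (i, e)))"
        unfolding SI(1) using SI(2,3) by simp
      also have "(\<Prod>e\<in>T. card (R (i, e))) = (\<Prod>e\<in>T. 2 * M + 1)"
        using SI(2) by (intro prod.cong) (auto simp: R_def int_card)
      finally show "(\<Prod>e\<in>S - I. card (R (i, e))) = (2 * N + 1) * (2 * M + 1) ^ (n - 1 - m)"
        using cT by (simp only: R_def prod.case refl if_True int_card) simp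
    qed simp
    also have "\<dots> = (2 * N + 1) ^ m * (2 * M + 1) ^ (m * (n - 1 - m))"
      using I'(3) by (simp only: prod_constant power_mult_distrib power_mult mult.commute[of m "n - 1 - m"])
    finally show ?thesis .
  qed
  have C: "C = Sigma A (\<lambda>I. PiE (I \<times> (S - I)) R)" by (simp add: C_def A_def)
  show "finite C" unfolding C using A(1) fin by (intro finite_SigmaI)
  have "card C = (\<Sum>I\<in>A. card (PiE (I \<times> (S - I)) R))"
    unfolding C using A(1) fin by (intro card_SigmaI) auto
  also have "\<dots> = card A * ((2 * N + 1) ^ m * (2 * M + 1) ^ (m * (n - 1 - m)))"
    using eq by simp
  also have "\<dots> \<le> 2 ^ n * ((2 * N + 1) ^ m * (2 * M + 1) ^ (m * (n - 1 - m)))"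
    using cA by (intro mult_le_mono1)
  finally show "card C \<le> 2 ^ n * (2 * N + 1) ^ m * (2 * M + 1) ^ (m * (n - 1 - m))"
    by (simp only: mult.assoc)
qed

text \<open>The subspaces almost orthogonal to \<open>u\<close> lie near the submanifold of those contained in
  the hyperplane orthogonal to \<open>u\<close>, which has dimension \<open>m * (n - 1 - m)\<close>.\<close>

lemma almost_orthogonal_cover:
  assumes "m < DIM('a :: euclidean_space)"
  obtains K where "1 \<le> K" and "\<And>(u :: 'a) \<delta> X. norm u = 1 \<Longrightarrow> 0 < \<delta> \<Longrightarrow> \<delta> \<le> 1 \<Longrightarrow>
      X \<subseteq> {V \<in> grassmannian m. norm (orth_proj V u) \<le> \<delta>} \<Longrightarrow>
      \<exists>Y\<subseteq>X. finite Y \<and> real (card Y) \<le> K * (1 / \<delta>) ^ (m * (DIM('a) - 1 - m)) \<and>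
        X \<subseteq> (\<Union>y\<in>Y. cball y (K * \<delta>))"
proof -
  define n where "n = DIM('a)"
  define p where "p = m * (n - 1 - m)"
  \<comment> \<open>The entries along u are at most \<open>2 * n * fact m * \<delta>\<close>.
    Rounded in units of \<delta> they take values in \<open>{-N..N}\<close>, whatever \<delta>
    is.\<close>
  define N :: nat where "N = 2 * n * fact m"
  \<comment> \<open>This bounds the number of codes apart from the power of
    \<open>1 / \<delta>\<close>: at most \<open>2 ^ n\<close> pivot sets, and
    \<open>2 * M + 1 \<le> (2 * fact m + 3) / \<delta>\<close> because
    \<open>M \<le> fact m / \<delta> + 1\<close> and \<open>1 \<le> 1 / \<delta>\<close>.\<close>
  define K1 :: real where "K1 = 2 ^ n * (2 * real N + 1) ^ m * (2 * fact m + 3) ^ p"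
  \<comment> \<open>The summand with \<open>m * n\<close> turns equality of codes into a distance.
    The 4 serves \<delta> > 1/2, where no echelon coordinates are available but one ball of radius
    \<open>2 \<le> K * \<delta>\<close> contains every subspace.\<close>
  define K where "K = K1 + 2 * (real m * real n) + 4"
  have K1: "0 \<le> K1" by (simp add: K1_def)
  have K: "1 \<le> K" "K1 \<le> K" "2 * (real m * real n) \<le> K" "4 \<le> K" using K1 by (auto simp: K_def)
  show thesis
  proof (rule that[OF K(1)])
    fix u :: 'a and \<delta> :: real and X
    assume u: "norm u = 1" and \<delta>: "0 < \<delta>" "\<delta> \<le> 1"
      and X: "X \<subseteq> {V \<in> grassmannian m. norm (orth_proj V u) \<le> \<delta>}"
    show "\<exists>Y\<subseteq>X. finite Y \<and> real (card Y) \<le> K * (1 / \<delta>) ^ (m * (DIM('a) - 1 - m)) \<and>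
        X \<subseteq> (\<Union>y\<in>Y. cball y (K * \<delta>))"
      unfolding n_def[symmetric] p_def[symmetric]
    proof (cases "\<delta> \<le> 1/2")
      case False
      have one: "1 \<le> (1 / \<delta>) ^ p" using \<delta> by (intro one_le_power) simp
      have "1 * 1 \<le> K * (1 / \<delta>) ^ p" using K(1) one by (intro mult_mono) auto
      then have c: "1 \<le> K * (1 / \<delta>) ^ p" by simp
      have "4 * (1/2) \<le> K * \<delta>" using K(4) False by (intro mult_mono) auto
      then have r: "2 \<le> K * \<delta>" by simp
      show "\<exists>Y\<subseteq>X. finite Y \<and> real (card Y) \<le> K * (1 / \<delta>) ^ p \<and> X \<subseteq> (\<Union>y\<in>Y. cball y (K * \<delta>))"
      proof (cases "X = {}")
        case True
        then show ?thesis using K(1) \<delta> by (intro exI[of _ "{}"]) auto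
      next
        case False
        then obtain V where "V \<in> X" by blast
        moreover have "X \<subseteq> cball V (K * \<delta>)"
          using dist_linsub_le_2 r order_trans unfolding subset_iff mem_cball by blast
        ultimately show ?thesis using c by (intro exI[of _ "{V}"]) auto
      qed
    next
      case True
      obtain S where S: "u \<in> S" "pairwise orthogonal S" "\<And>x. x \<in> S \<Longrightarrow> norm x = 1"
        "independent S" "card S = DIM('a)" "span S = UNIV"
        using vector_in_orthonormal_basis[OF u] by metis
      have finS: "finite S" using S(4) independent_imp_finite by blast
      define P where "P V I v \<longleftrightarrow> I \<subseteq> S - {u} \<and> card I = m \<and> (\<forall>i\<in>I. v i \<in> points V) \<and>
        (\<forall>i\<in>I. \<forall>l\<in>I. v i \<bullet> l = (if i = l then 1 else 0)) \<and>
        (\<forall>i\<in>I. \<forall>e\<in>S-{u}. \<bar>v i \<bullet> e\<bar> \<le> fact m) \<and>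
        (\<forall>i\<in>I. \<bar>v i \<bullet> u\<bar> \<le> 2 * real DIM('a) * fact m * \<delta>) \<and>
        (\<forall>x\<in>points V. x = (\<Sum>i\<in>I. (x \<bullet> i) *\<^sub>R v i))" for V I and v :: "'a \<Rightarrow> 'a"
      have "\<exists>I v. P V I v" if "V \<in> X" for V
        unfolding P_def using that X True S by (intro grassmannian_echelon_coordinates) auto
      then obtain I v where P: "\<And>V. V \<in> X \<Longrightarrow> P V (I V) (v V)" by metis
      have I: "I V \<subseteq> S - {u}" "card (I V) = m" if "V \<in> X" for V
        using P[OF that] unfolding P_def by blast+
      have v: "i \<in> I V \<Longrightarrow> v V i \<in> points V"
          "i \<in> I V \<Longrightarrow> l \<in> I V \<Longrightarrow> v V i \<bullet> l = (if i = l then 1 else 0)"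
          "i \<in> I V \<Longrightarrow> e \<in> S - {u} \<Longrightarrow> \<bar>v V i \<bullet> e\<bar> \<le> fact m"
          "i \<in> I V \<Longrightarrow> \<bar>v V i \<bullet> u\<bar> \<le> 2 * real DIM('a) * fact m * \<delta>"
          "x \<in> points V \<Longrightarrow> x = (\<Sum>i\<in>I V. (x \<bullet> i) *\<^sub>R v V i)"
        if "V \<in> X" for V i l e x
        using P[OF that] unfolding P_def by blast+
      define M where "M = nat \<lceil>fact m / \<delta>\<rceil>"
      define R where "R = (\<lambda>(i :: 'a, e). if e = u then {- int N..int N} else {- int M..int M})"
      define C where "C = Sigma {I. I \<subseteq> S - {u} \<and> card I = m} (\<lambda>I. PiE (I \<times> (S - I)) R)"
      define code where "code V = (I V, \<lambda>(i, e)\<in>I V \<times> (S - I V). \<lfloor>(v V i \<bullet> e) / \<delta>\<rfloor>)" for V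
      have C: "finite C" "card C \<le> 2 ^ n * (2 * N + 1) ^ m * (2 * M + 1) ^ p"
        unfolding C_def R_def p_def using card_echelon_codes[of S u n m N M] finS S(1,5) assms
        by (simp_all add: n_def)
      have M: "fact m / \<delta> \<le> real M" "real M \<le> fact m / \<delta> + 1"
        using \<delta> by (simp_all add: M_def)
      have fl: "\<lfloor>t\<rfloor> \<in> {- int k..int k}" if "\<bar>t\<bar> \<le> real k" for t k
        using that by (auto simp: abs_le_iff) linarith+
      have ran: "code ` X \<subseteq> C"
      proof (rule image_subsetI)
        fix V assume V: "V \<in> X"
        have "\<lfloor>(v V i \<bullet> e) / \<delta>\<rfloor> \<in> R (i, e)" if "i \<in> I V" "e \<in> S - I V" for i e
        proof (cases "e = u")
          case True
          have "\<bar>v V i \<bullet> u / \<delta>\<bar> \<le> real N"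
            using v(4)[OF V that(1)] \<delta> by (simp add: abs_divide N_def n_def divide_le_eq)
          then show ?thesis using True fl by (simp add: R_def)
        next
          case False
          have "\<bar>v V i \<bullet> e / \<delta>\<bar> \<le> fact m / \<delta>"
            using v(3)[OF V that(1), of e] that(2) False \<delta> by (simp add: abs_divide divide_right_mono)
          then have "\<bar>v V i \<bullet> e / \<delta>\<bar> \<le> real M" using M(1) by linarith
          then show ?thesis using False fl by (simp add: R_def)
        qed
        then show "code V \<in> C" using I[OF V] by (auto simp: code_def C_def PiE_iff)
      qed
      have close: "dist V W \<le> K * \<delta>" if V: "V \<in> X" and W: "W \<in> X" and eq: "code V = code W" for V W
      proof -
        have IW: "I W = I V" using eq by (simp add: code_def)
        have finI: "finite (I V)" using I(1)[OF V] finS finite_subset by blast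
        have coord: "\<bar>(v V i - v W i) \<bullet> e\<bar> \<le> \<delta>" if i: "i \<in> I V" and e: "e \<in> S" for i e
        proof (cases "e \<in> I V")
          case True
          then show ?thesis
            using v(2)[OF V i True] v(2)[OF W, of i e] i \<delta> IW by (simp add: inner_diff_left)
        next
          case False
          have "snd (code V) (i, e) = snd (code W) (i, e)" using eq by simp
          then have "\<lfloor>(v V i \<bullet> e) / \<delta>\<rfloor> = \<lfloor>(v W i \<bullet> e) / \<delta>\<rfloor>"
            using i e False IW by (simp add: code_def)
          then show ?thesis
            using floor_divide_eq_imp_abs_diff_le \<delta>(1) by (simp add: inner_diff_left)
        qed
        have "norm (v V i - v W i) \<le> n * \<delta>" if i: "i \<in> I V" for i
        proof -
          define w where "w = v V i - v W i"
          have "norm w = norm (\<Sum>e\<in>S. (w \<bullet> e) *\<^sub>R e)"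
            using S finS by (subst orthonormal_basis_expand) auto
          also have "\<dots> \<le> (\<Sum>e\<in>S. norm ((w \<bullet> e) *\<^sub>R e))" by (rule norm_sum)
          also have "\<dots> \<le> (\<Sum>e\<in>S. \<delta>)"
            using S(3) coord[OF i] by (intro sum_mono) (auto simp: w_def)
          also have "\<dots> = n * \<delta>" using S(5) by (simp add: n_def)
          finally show ?thesis by (simp add: w_def)
        qed
        then have "dist V W \<le> 2 * (card (I V) * (n * \<delta>))"
          using finI I(1)[OF V] S(3) \<delta> v(1,5)[OF V] v(1,5)[OF W] IW
          by (intro dist_linsub_le_echelon[of "I V" "n * \<delta>" "v V" V "v W" W]) auto
        also have "\<dots> = 2 * (real m * real n) * \<delta>" using I(2)[OF V] by simp
        also have "\<dots> \<le> K * \<delta>" using K(3) \<delta> by (intro mult_right_mono) auto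
        finally show ?thesis .
      qed
      obtain Y where Y: "Y \<subseteq> X" "finite Y" "card Y \<le> card C" "X \<subseteq> (\<Union>y\<in>Y. cball y (K * \<delta>))"
        using code_net[OF C(1) ran close] by blast
      have "real (card Y) \<le> real (2 ^ n * (2 * N + 1) ^ m * (2 * M + 1) ^ p)"
        using Y(3) C(2) by (meson of_nat_le_iff order_trans)
      also have "\<dots> = 2 ^ n * (2 * real N + 1) ^ m * (2 * real M + 1) ^ p" by (simp add: add.commute)
      also have "\<dots> \<le> 2 ^ n * (2 * real N + 1) ^ m * ((2 * fact m + 3) * (1 / \<delta>)) ^ p"
      proof (intro mult_left_mono power_mono)
        have "1 \<le> 1 / \<delta>" using \<delta> by simp
        then have "3 \<le> 3 * (1 / \<delta>)" by simp
        moreover have "2 * real M + 1 \<le> 2 * (fact m / \<delta> + 1) + 1" using M(2) by simp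
        moreover have "2 * (fact m / \<delta> + 1) + 1 = 2 * fact m * (1 / \<delta>) + 3" by simp
        moreover have "(2 * fact m + 3) * (1 / \<delta>) = 2 * fact m * (1 / \<delta>) + 3 * (1 / \<delta>)"
          by (simp add: distrib_right add_divide_distrib)
        ultimately show "2 * real M + 1 \<le> (2 * fact m + 3) * (1 / \<delta>)" by linarith
      qed auto
      also have "\<dots> = K1 * (1 / \<delta>) ^ p" by (simp add: K1_def power_mult_distrib power_divide)
      also have "\<dots> \<le> K * (1 / \<delta>) ^ p" using K(2) \<delta> by (intro mult_right_mono) auto
      finally show "\<exists>Y\<subseteq>X. finite Y \<and> real (card Y) \<le> K * (1 / \<delta>) ^ p \<and> X \<subseteq> (\<Union>y\<in>Y. cball y (K * \<delta>))"
        using Y by blast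
    qed
  qed
qed

section \<open>Separated sets and Assouad bounds\<close>

lemma bounded_diameter_le_imp_dist_le:
  fixes U :: "'a :: metric_space set"
  assumes "bounded U" "diameter U \<le> r" "x \<in> U" "y \<in> U"
  shows "dist x y \<le> r"
  using diameter_bounded_bound[OF assms(1,3,4)] assms(2) by simp

lemma covering_number_le:
  assumes "finite \<U>" "E \<subseteq> \<Union>\<U>" "\<And>U. U \<in> \<U> \<Longrightarrow> bounded U \<and> diameter U \<le> r"
  shows "covering_number r E \<le> card \<U>"
  unfolding covering_number_def using assms by (intro wellorder_Inf_le1) blast

text \<open>Total boundedness supplies one finite cover, so the infimum ranges over a non-empty set
  of naturals and is a minimum, not a default value.\<close>

lemma covering_number_attained:
  fixes E :: "'a :: euclidean_space set"
  assumes "bounded E" "0 < r"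
  obtains \<U> where "finite \<U>" "E \<subseteq> \<Union>\<U>" "\<And>U. U \<in> \<U> \<Longrightarrow> bounded U \<and> diameter U \<le> r"
    "card \<U> = covering_number r E"
proof -
  define Z where "Z = {card \<U> | \<U>. finite \<U> \<and> E \<subseteq> \<Union>\<U> \<and> (\<forall>U\<in>\<U>. bounded U \<and> diameter U \<le> r)}"
  have "compact (closure E)" using assms(1) by (simp add: compact_closure)
  then obtain k where k: "finite k" "closure E \<subseteq> (\<Union>x\<in>k. ball x (r / 2))"
    using assms(2) unfolding compact_eq_totally_bounded by (meson half_gt_zero)
  have "diameter (ball x (r / 2)) \<le> r" for x :: 'a
  proof -
    have "diameter (ball x (r / 2)) \<le> diameter (cball x (r / 2))"
      by (intro diameter_subset) auto
    also have "\<dots> \<le> r" using diameter_cball_le[of "r / 2" x] assms(2) by simp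
    finally show ?thesis .
  qed
  then have "card ((\<lambda>x. ball x (r / 2)) ` k) \<in> Z"
    using k closure_subset[of E] unfolding Z_def by (intro CollectI exI[of _ "(\<lambda>x. ball x (r / 2)) ` k"]) auto
  then have "Inf Z \<in> Z" by (intro Inf_nat_def1) auto
  moreover have "Inf Z = covering_number r E" by (simp add: Z_def covering_number_def)
  ultimately obtain \<U> where "finite \<U>" "E \<subseteq> \<Union>\<U>" "\<forall>U\<in>\<U>. bounded U \<and> diameter U \<le> r"
    "card \<U> = covering_number r E" unfolding Z_def by force
  then show thesis using that by blast
qed

lemma covering_number_mono:
  fixes E E' :: "'a :: euclidean_space set"
  assumes "E \<subseteq> E'" "bounded E'" "0 < r" "r \<le> r'"
  shows "covering_number r' E \<le> covering_number r E'"
proof -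
  obtain \<U> where "finite \<U>" "E' \<subseteq> \<Union>\<U>" "\<And>U. U \<in> \<U> \<Longrightarrow> bounded U \<and> diameter U \<le> r"
    "card \<U> = covering_number r E'"
    using covering_number_attained[OF assms(2,3)] by metis
  moreover have "covering_number r' E \<le> card \<U>"
    using calculation(1-3) assms(1,4) by (intro covering_number_le) (auto intro: order_trans)
  ultimately show ?thesis by simp
qed

lemma covering_number_pos:
  fixes E :: "'a :: euclidean_space set"
  assumes "bounded E" "0 < r" "E \<noteq> {}"
  shows "1 \<le> covering_number r E"
proof -
  obtain \<U> where \<U>: "finite \<U>" "E \<subseteq> \<Union>\<U>" "card \<U> = covering_number r E"
    using covering_number_attained[OF assms(1,2)] by metis
  then have "card \<U> \<noteq> 0" using assms(3) by auto
  then show ?thesis using \<U>(3) by simp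
qed

lemma card_separated_le:
  fixes E :: "'a :: euclidean_space set"
  assumes "bounded E" "0 < r" "A \<subseteq> E" "pairwise (\<lambda>x y. r < dist x y) A"
  shows "finite A" "card A \<le> covering_number r E"
proof -
  obtain \<U> where \<U>: "finite \<U>" "E \<subseteq> \<Union>\<U>" "\<And>U. U \<in> \<U> \<Longrightarrow> bounded U \<and> diameter U \<le> r"
    "card \<U> = covering_number r E"
    using covering_number_attained[OF assms(1,2)] by metis
  have "\<forall>a\<in>A. \<exists>U. U \<in> \<U> \<and> a \<in> U" using \<U>(2) assms(3) by blast
  then obtain f where f: "\<forall>a\<in>A. f a \<in> \<U> \<and> a \<in> f a" by metis
  have inj: "inj_on f A"
  proof (rule inj_onI, rule ccontr)
    fix a b assume ab: "a \<in> A" "b \<in> A" "f a = f b" "a \<noteq> b"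
    then have "dist a b \<le> r"
      using f \<U>(3) by (intro bounded_diameter_le_imp_dist_le[of "f a"]) auto
    moreover have "r < dist a b" using assms(4) ab by (auto simp: pairwise_def)
    ultimately show False by simp
  qed
  have im: "f ` A \<subseteq> \<U>" using f by blast
  show "finite A" using inj im \<U>(1) finite_imageD finite_subset by blast
  show "card A \<le> covering_number r E" using card_inj_on_le[OF inj im \<U>(1)] \<U>(4) by simp
qed

text \<open>A largest separated set exists since cardinalities are bounded by the covering number.
  It covers by balls of radius r, whose diameter is only known to be at most \<open>2 * r\<close>;
  this is why covering numbers of F are later taken at the doubled scale.\<close>

lemma maximal_separated:
  fixes E :: "'a :: euclidean_space set"
  assumes "bounded E" "0 < r"
  obtains A where "finite A" "A \<subseteq> E" "pairwise (\<lambda>x y. r < dist x y) A"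
    "E \<subseteq> (\<Union>a\<in>A. cball a r)" "covering_number (2 * r) E \<le> card A"
proof -
  define P where "P A \<longleftrightarrow> A \<subseteq> E \<and> pairwise (\<lambda>x y. r < dist x y) A" for A
  have "P {}" by (simp add: P_def)
  moreover have bnd: "\<forall>A. P A \<longrightarrow> card A < Suc (covering_number r E)"
    using card_separated_le(2)[OF assms] by (auto simp: P_def less_Suc_eq_le)
  ultimately obtain A where A: "P A" "\<And>B. P B \<Longrightarrow> card B \<le> card A"
    using ex_has_greatest_nat[of P "{}" card] by metis
  have fin: "finite A" using A(1) card_separated_le(1)[OF assms] by (auto simp: P_def)
  have cov: "E \<subseteq> (\<Union>a\<in>A. cball a r)"
  proof (rule ccontr)
    assume "\<not> ?thesis"
    then obtain x where "x \<in> E" "x \<notin> (\<Union>a\<in>A. cball a r)" by blast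
    then have x: "x \<in> E" "\<And>a. a \<in> A \<Longrightarrow> r < dist a x" by (auto simp: not_le)
    then have "P (insert x A)"
      using A(1) by (auto simp: P_def pairwise_insert dist_commute)
    moreover have "x \<notin> A" using x(2)[of x] assms(2) by auto
    ultimately show False using A(2)[of "insert x A"] fin by simp
  qed
  have "covering_number (2 * r) E \<le> card ((\<lambda>a. cball a r) ` A)"
  proof (rule covering_number_le)
    show "E \<subseteq> \<Union>((\<lambda>a. cball a r) ` A)" using cov by simp
    show "bounded U \<and> diameter U \<le> 2 * r" if "U \<in> (\<lambda>a. cball a r) ` A" for U
      using that assms(2) diameter_cball_le[of r] by auto
  qed (use fin in simp)
  also have "\<dots> \<le> card A" using fin by (rule card_image_le)
  finally show thesis using that[of A] A(1) fin cov by (auto simp: P_def)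
qed

text \<open>The exponent \<alpha> is admissible in the upper Assouad spectrum for every \<theta>
  below 1, while the constant may blow up as \<theta> tends to 1. In this form the hypothesis on F
  can be applied at any \<theta> and passes to subsets.\<close>

definition assouad_bound :: "real \<Rightarrow> 'a :: metric_space set \<Rightarrow> bool" where
  "assouad_bound \<alpha> F \<longleftrightarrow> (\<forall>\<theta>. 0 < \<theta> \<longrightarrow> \<theta> < 1 \<longrightarrow> (\<exists>C>0. \<forall>r R. \<forall>x\<in>F.
     0 < r \<and> r \<le> R powr (1 / \<theta>) \<and> R powr (1 / \<theta>) < R \<and> R < 1 \<longrightarrow>
     real (covering_number r (cball x R \<inter> F)) \<le> C * (R / r) powr \<alpha>))"

lemma assouad_boundE:
  assumes "assouad_bound \<alpha> F" "0 < \<theta>" "\<theta> < 1"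
  obtains C where "0 < C" "\<And>r R x. x \<in> F \<Longrightarrow> 0 < r \<Longrightarrow> r \<le> R powr (1 / \<theta>) \<Longrightarrow>
    R powr (1 / \<theta>) < R \<Longrightarrow> R < 1 \<Longrightarrow>
    real (covering_number r (cball x R \<inter> F)) \<le> C * (R / r) powr \<alpha>"
proof -
  from assms(1)[unfolded assouad_bound_def, rule_format, OF assms(2,3)]
  obtain C where "0 < C" "\<forall>r R. \<forall>x\<in>F.
     0 < r \<and> r \<le> R powr (1 / \<theta>) \<and> R powr (1 / \<theta>) < R \<and> R < 1 \<longrightarrow>
     real (covering_number r (cball x R \<inter> F)) \<le> C * (R / r) powr \<alpha>" by (elim exE conjE) (rule that)
  then show thesis by (intro that[of C]) auto
qed

lemma assouad_bound_subset:
  fixes F G :: "'a :: euclidean_space set"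
  assumes "assouad_bound \<alpha> F" "G \<subseteq> F"
  shows "assouad_bound \<alpha> G"
  unfolding assouad_bound_def
proof (intro allI impI)
  fix \<theta> :: real assume \<theta>: "0 < \<theta>" "\<theta> < 1"
  obtain C where C: "0 < C" "\<And>r R x. x \<in> F \<Longrightarrow> 0 < r \<Longrightarrow> r \<le> R powr (1 / \<theta>) \<Longrightarrow>
    R powr (1 / \<theta>) < R \<Longrightarrow> R < 1 \<Longrightarrow>
    real (covering_number r (cball x R \<inter> F)) \<le> C * (R / r) powr \<alpha>"
    using assouad_boundE[OF assms(1) \<theta>] by metis
  show "\<exists>C>0. \<forall>r R. \<forall>x\<in>G. 0 < r \<and> r \<le> R powr (1 / \<theta>) \<and> R powr (1 / \<theta>) < R \<and> R < 1 \<longrightarrow>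
     real (covering_number r (cball x R \<inter> G)) \<le> C * (R / r) powr \<alpha>"
  proof (intro exI[of _ C] conjI allI ballI impI C(1))
    fix r R x
    assume x: "x \<in> G" and r: "0 < r \<and> r \<le> R powr (1 / \<theta>) \<and> R powr (1 / \<theta>) < R \<and> R < 1"
    have "covering_number r (cball x R \<inter> G) \<le> covering_number r (cball x R \<inter> F)"
      using r assms(2) by (intro covering_number_mono) (auto intro: bounded_Int)
    then show "real (covering_number r (cball x R \<inter> G)) \<le> C * (R / r) powr \<alpha>"
      using C(2)[of x r R] r x assms(2) by force
  qed
qed

text \<open>In the range \<open>r \<le> R powr (1 / \<theta>)\<close> this is the Assouad bound. A
  smaller R is enlarged to \<open>r powr \<theta>\<close>, at the cost of at most
  \<open>r powr ((\<theta> - 1) * \<alpha>)\<close>, which is below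
  \<open>r powr (- \<epsilon>)\<close> for \<theta> near 1. For R above 1/2, finitely many balls of
  radius 1/2 cover F.\<close>

lemma assouad_bound_card:
  fixes F :: "'a :: euclidean_space set"
  assumes "bounded F" "assouad_bound \<alpha> F" "0 \<le> \<alpha>" "0 < \<epsilon>"
  obtains C r0 where "0 < C" "0 < r0" "r0 < 1"
    "\<And>r R A x. 0 < r \<Longrightarrow> r \<le> r0 \<Longrightarrow> r \<le> R \<Longrightarrow> A \<subseteq> F \<Longrightarrow> pairwise (\<lambda>x y. r < dist x y) A \<Longrightarrow> x \<in> F \<Longrightarrow>
       real (card (A \<inter> cball x R)) \<le> C * r powr (- \<epsilon>) * (R / r) powr \<alpha>"
proof -
  \<comment> \<open>Chosen such that \<open>(1 - \<theta>) * \<alpha> \<le> \<epsilon>\<close>. The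
    maximum keeps \<theta> positive, and \<open>\<alpha> + 1\<close> avoids a division by
    zero.\<close>
  define \<theta> where "\<theta> = max (1/2) (1 - \<epsilon> / (\<alpha> + 1))"
  have \<theta>: "0 < \<theta>" "\<theta> < 1" "1/2 \<le> \<theta>" using assms by (auto simp: \<theta>_def)
  have "(1 - \<theta>) * \<alpha> \<le> \<epsilon> / (\<alpha> + 1) * \<alpha>"
    using assms by (intro mult_right_mono) (auto simp: \<theta>_def)
  also have "\<dots> \<le> \<epsilon>" using assms by (simp add: field_simps)
  finally have \<theta>\<epsilon>: "(1 - \<theta>) * \<alpha> \<le> \<epsilon>" .
  obtain C where C: "0 < C" "\<And>r R x. x \<in> F \<Longrightarrow> 0 < r \<Longrightarrow> r \<le> R powr (1 / \<theta>) \<Longrightarrow>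
    R powr (1 / \<theta>) < R \<Longrightarrow> R < 1 \<Longrightarrow>
    real (covering_number r (cball x R \<inter> F)) \<le> C * (R / r) powr \<alpha>"
    using assouad_boundE[OF assms(2) \<theta>(1,2)] by metis
  \<comment> \<open>With \<open>r0 powr \<theta> = 1/2\<close> the enlarged radius \<open>R'\<close>
    stays at most 1/2, hence inside the range \<open>R < 1\<close> of the Assouad bound.\<close>
  define r0 :: real where "r0 = (1/2) powr (1 / \<theta>)"
  have "r0 < (1/2) powr 0" unfolding r0_def using \<theta> by (intro powr_less_mono') auto
  then have r0: "0 < r0" "r0 < 1" by (auto simp: r0_def)
  have small: "real (card (A \<inter> cball x R)) \<le> C * r powr (- \<epsilon>) * (R / r) powr \<alpha>"
    if r: "0 < r" "r \<le> r0" "r \<le> R" "R \<le> 1/2" and A: "A \<subseteq> F" "pairwise (\<lambda>x y. r < dist x y) A" "x \<in> F"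
    for r R A x
  proof -
    define R' where "R' = max R (r powr \<theta>)"
    have "r powr \<theta> \<le> r0 powr \<theta>" using r \<theta> by (intro powr_mono2) auto
    also have "r0 powr \<theta> = 1/2" using \<theta> by (simp add: r0_def powr_powr)
    finally have R': "0 < R'" "R' < 1" "R \<le> R'" "r powr \<theta> \<le> R'" using r by (auto simp: R'_def)
    have "r = (r powr \<theta>) powr (1 / \<theta>)" using r \<theta> by (simp add: powr_powr)
    also have "\<dots> \<le> R' powr (1 / \<theta>)" using R' \<theta> by (intro powr_mono2) auto
    finally have 1: "r \<le> R' powr (1 / \<theta>)" .
    have "R' powr (1 / \<theta>) < R' powr 1" using R' \<theta> by (intro powr_less_mono') auto
    then have 2: "R' powr (1 / \<theta>) < R'" using R' by simp
    have "card (A \<inter> cball x R) \<le> covering_number r (cball x R' \<inter> F)"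
      using A r R' by (intro card_separated_le) (auto intro: bounded_Int pairwise_subset)
    then have "real (card (A \<inter> cball x R)) \<le> C * (R' / r) powr \<alpha>"
      using C(2)[OF A(3) r(1) 1 2 R'(2)] by linarith
    also have "\<dots> \<le> C * ((R / r) * r powr (\<theta> - 1)) powr \<alpha>"
    proof (intro mult_left_mono powr_mono2)
      have rt: "r powr \<theta> / r = r powr (\<theta> - 1)" using r(1) by (simp add: powr_diff)
      have one: "1 \<le> R / r" "1 \<le> r powr (\<theta> - 1)"
      proof -
        show "1 \<le> R / r" using r by simp
        have "r powr 0 \<le> r powr (\<theta> - 1)" using r r0 \<theta> by (intro powr_mono') auto
        then show "1 \<le> r powr (\<theta> - 1)" using r by simp
      qed
      have "R / r * 1 \<le> (R / r) * r powr (\<theta> - 1)" "1 * r powr (\<theta> - 1) \<le> (R / r) * r powr (\<theta> - 1)"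
        using one by (intro mult_left_mono mult_right_mono; simp)+
      then show "R' / r \<le> (R / r) * r powr (\<theta> - 1)"
        by (auto simp: R'_def max_def rt)
    qed (use C(1) R' r assms(3) in auto)
    also have "\<dots> = C * ((R / r) powr \<alpha> * r powr ((\<theta> - 1) * \<alpha>))"
      by (simp only: powr_mult powr_powr)
    also have "\<dots> \<le> C * ((R / r) powr \<alpha> * r powr (- \<epsilon>))"
    proof (intro mult_left_mono)
      have "- \<epsilon> \<le> (\<theta> - 1) * \<alpha>" using \<theta>\<epsilon> by (simp add: algebra_simps)
      then show "r powr ((\<theta> - 1) * \<alpha>) \<le> r powr (- \<epsilon>)"
        using r r0 by (intro powr_mono') auto
    qed (use C(1) in auto)
    finally show ?thesis by (simp add: mult_ac)
  qed
  obtain Y where Y: "finite Y" "Y \<subseteq> F" "F \<subseteq> (\<Union>a\<in>Y. cball a (1/2))"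
    using maximal_separated[OF assms(1), of "1/2"] by (metis half_gt_zero_iff zero_less_one)
  define C' where "C' = (1 + real (card Y)) * C"
  have C': "0 < C'" "C \<le> C'" "real (card Y) * C \<le> C'" using C(1) by (auto simp: C'_def distrib_right intro: add_pos_nonneg)
  show thesis
  proof (rule that[of C' r0])
    fix r R A x
    assume r: "0 < r" "r \<le> r0" "r \<le> R" and A: "A \<subseteq> F" "pairwise (\<lambda>x y. r < dist x y) A" "x \<in> F"
    have finA: "finite A" using card_separated_le(1)[OF assms(1) r(1) A(1,2)] .
    show "real (card (A \<inter> cball x R)) \<le> C' * r powr (- \<epsilon>) * (R / r) powr \<alpha>"
    proof (cases "R \<le> 1/2")
      case True
      then have "real (card (A \<inter> cball x R)) \<le> C * r powr (- \<epsilon>) * (R / r) powr \<alpha>"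
        using small r A by blast
      also have "\<dots> \<le> C' * r powr (- \<epsilon>) * (R / r) powr \<alpha>"
        using C' by (intro mult_right_mono) auto
      finally show ?thesis .
    next
      case False
      have half: "r \<le> 1/2"
      proof -
        have "r0 \<le> (1/2) powr 1" unfolding r0_def using \<theta> by (intro powr_mono') auto
        then show ?thesis using r(2) by simp
      qed
      have "A \<inter> cball x R \<subseteq> (\<Union>y\<in>Y. A \<inter> cball y (1/2))" using A(1) Y(3) by blast
      then have "card (A \<inter> cball x R) \<le> card (\<Union>y\<in>Y. A \<inter> cball y (1/2))"
        using Y(1) finA by (intro card_mono) auto
      also have "\<dots> \<le> (\<Sum>y\<in>Y. card (A \<inter> cball y (1/2)))" using Y(1) by (rule card_UN_le)
      finally have "real (card (A \<inter> cball x R)) \<le> (\<Sum>y\<in>Y. real (card (A \<inter> cball y (1/2))))"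
        by (metis of_nat_le_iff of_nat_sum)
      also have "\<dots> \<le> (\<Sum>y\<in>Y. C * r powr (- \<epsilon>) * (1/2 / r) powr \<alpha>)"
        using small[OF r(1,2) half _ A(1,2)] Y(2) by (intro sum_mono) auto
      also have "\<dots> = real (card Y) * C * r powr (- \<epsilon>) * (1/2 / r) powr \<alpha>" by simp
      also have "\<dots> \<le> C' * r powr (- \<epsilon>) * (R / r) powr \<alpha>"
        using C' C(1) r assms(3) False
        by (intro mult_mono[OF mult_right_mono] powr_mono2 divide_right_mono) auto
      finally show ?thesis .
    qed
  qed (use C' r0 in auto)
qed

text \<open>Dyadic shells: about \<open>2 powr (\<alpha> * k) * r powr (- \<epsilon>)\<close> points
  lie within \<open>2 ^ k * r\<close> of x, and those of the k-th shell weigh about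
  \<open>2 powr (- t * k)\<close> each. Since \<alpha> < t, the shells form a convergent geometric
  series.\<close>

lemma assouad_bound_kernel_sum:
  fixes F :: "'a :: euclidean_space set"
  assumes "bounded F" "assouad_bound \<alpha> F" "0 \<le> \<alpha>" "0 < \<epsilon>" "\<alpha> < t"
  obtains C r0 where "0 < C" "0 < r0" "r0 < 1"
    "\<And>r A x. 0 < r \<Longrightarrow> r \<le> r0 \<Longrightarrow> A \<subseteq> F \<Longrightarrow> pairwise (\<lambda>x y. r < dist x y) A \<Longrightarrow> x \<in> A \<Longrightarrow>
       (\<Sum>y\<in>A-{x}. (r / dist x y) powr t) \<le> C * r powr (- \<epsilon>)"
proof -
  obtain C r0 where C: "0 < C" "0 < r0" "r0 < 1"
    "\<And>r R A x. 0 < r \<Longrightarrow> r \<le> r0 \<Longrightarrow> r \<le> R \<Longrightarrow> A \<subseteq> F \<Longrightarrow> pairwise (\<lambda>x y. r < dist x y) A \<Longrightarrow> x \<in> F \<Longrightarrow>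
       real (card (A \<inter> cball x R)) \<le> C * r powr (- \<epsilon>) * (R / r) powr \<alpha>"
    using assouad_bound_card[OF assms(1-4)] by metis
  define q where "q = (2 :: real) powr (\<alpha> - t)"
  have q: "0 < q" "q < 1" using assms(5) by (auto simp: q_def powr_less_one)
  define C' where "C' = 2 powr t * C * (1 / (1 - q))"
  have C': "0 < C'" using C(1) q by (simp add: C'_def)
  show thesis
  proof (rule that[OF C' C(2,3)])
    fix r A x assume r: "0 < r" "r \<le> r0" and A: "A \<subseteq> F" "pairwise (\<lambda>x y. r < dist x y) A" "x \<in> A"
    have finA: "finite A" using card_separated_le(1)[OF assms(1) r(1) A(1,2)] .
    define D where "D = (\<Sum>y\<in>A. dist x y)"
    \<comment> \<open>K only makes the number of shells finite. The final bound is that of the whole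
      series and does not depend on K.\<close>
    obtain K where K: "D / r < 2 ^ K" using real_arch_pow[of 2 "D / r"] by auto
    have dK: "dist x y \<le> 2 ^ K * r" if "y \<in> A" for y
    proof -
      have "dist x y \<le> D" unfolding D_def using that finA by (intro member_le_sum) auto
      then show ?thesis using K r(1) by (simp add: divide_less_eq)
    qed
    \<comment> \<open>This is \<open>(2 / 2 ^ k) powr t\<close>. In the k-th shell the distance
      exceeds \<open>2 ^ (k - 1) * r\<close>, and the factor \<open>2 powr t\<close> pays for this
      shift by one.\<close>
    define h where "h k = (2 :: real) powr t * (2 powr (- t)) ^ k" for k
    have h0: "0 \<le> h k" for k by (simp add: h_def)
    have pt: "(r / dist x y) powr t \<le> (\<Sum>k\<le>K. if dist x y \<le> 2 ^ k * r then h k else 0)"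
      if y: "y \<in> A - {x}" for y
    proof -
      have d: "r < dist x y" using A(2,3) y by (auto simp: pairwise_def)
      define k where "k = (LEAST k. dist x y \<le> 2 ^ k * r)"
      have k: "dist x y \<le> 2 ^ k * r" unfolding k_def by (rule LeastI[of _ K]) (use dK y in auto)
      have kK: "k \<le> K" unfolding k_def by (rule Least_le) (use dK y in auto)
      have "k \<noteq> 0" using k d by (intro notI) simp
      then obtain j where j: "k = Suc j" using not0_implies_Suc by blast
      have "\<not> dist x y \<le> 2 ^ j * r" using not_less_Least[of j "\<lambda>k. dist x y \<le> 2 ^ k * r"] j
        by (simp add: k_def)
      then have "r / dist x y \<le> r / (2 ^ j * r)" using r by (intro frac_le) auto
      also have "\<dots> = 1 / 2 ^ j" using r by simp
      also have "\<dots> = 2 * 2 powr (- real k)" 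
      proof -
        have "(2 :: real) powr (- real k) = 1 / 2 ^ k" by (simp add: powr_minus_divide powr_realpow)
        then show ?thesis by (simp add: j)
      qed
      finally have "(r / dist x y) powr t \<le> (2 * 2 powr (- real k)) powr t"
        using r d assms(3,5) by (intro powr_mono2) auto
      also have "\<dots> = h k"
        by (simp add: h_def powr_mult powr_powr powr_realpow[symmetric] mult.commute)
      also have "\<dots> = (\<Sum>i\<in>{k}. if dist x y \<le> 2 ^ i * r then h i else 0)" using k by simp
      also have "\<dots> \<le> (\<Sum>k\<le>K. if dist x y \<le> 2 ^ k * r then h k else 0)"
        using kK h0 by (intro sum_mono2) auto
      finally show ?thesis .
    qed
    have "(\<Sum>y\<in>A-{x}. (r / dist x y) powr t)
        \<le> (\<Sum>y\<in>A-{x}. \<Sum>k\<le>K. if dist x y \<le> 2 ^ k * r then h k else 0)"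
      using pt by (rule sum_mono)
    also have "\<dots> \<le> (\<Sum>y\<in>A. \<Sum>k\<le>K. if dist x y \<le> 2 ^ k * r then h k else 0)"
      using finA h0 by (intro sum_mono2 sum_nonneg) auto
    also have "\<dots> = (\<Sum>k\<le>K. \<Sum>y\<in>A. if dist x y \<le> 2 ^ k * r then h k else 0)" by (rule sum.swap)
    also have "\<dots> = (\<Sum>k\<le>K. h k * real (card (A \<inter> cball x (2 ^ k * r))))"
    proof (rule sum.cong)
      fix k
      have "(\<Sum>y\<in>A. if dist x y \<le> 2 ^ k * r then h k else 0) = (\<Sum>y\<in>{y\<in>A. dist x y \<le> 2 ^ k * r}. h k)"
        using finA by (rule sum.inter_filter[symmetric])
      also have "{y\<in>A. dist x y \<le> 2 ^ k * r} = A \<inter> cball x (2 ^ k * r)" by auto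
      finally show "(\<Sum>y\<in>A. if dist x y \<le> 2 ^ k * r then h k else 0)
          = h k * real (card (A \<inter> cball x (2 ^ k * r)))" by simp
    qed simp
    also have "\<dots> \<le> (\<Sum>k\<le>K. 2 powr t * C * r powr (- \<epsilon>) * q ^ k)"
    proof (rule sum_mono)
      fix k
      have "r \<le> 2 ^ k * r" using r(1) by simp
      then have "real (card (A \<inter> cball x (2 ^ k * r))) \<le> C * r powr (- \<epsilon>) * (2 ^ k * r / r) powr \<alpha>"
        using C(4)[OF r _ A(1,2)] A(1,3) by blast
      also have "(2 ^ k * r / r) powr \<alpha> = (2 powr \<alpha>) ^ k"
        using r(1) by (simp add: powr_realpow[symmetric] powr_powr mult.commute)
      finally have "h k * real (card (A \<inter> cball x (2 ^ k * r))) \<le> h k * (C * r powr (- \<epsilon>) * (2 powr \<alpha>) ^ k)"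
        using h0 by (rule mult_left_mono)
      also have "\<dots> = 2 powr t * C * r powr (- \<epsilon>) * (2 powr (- t) * 2 powr \<alpha>) ^ k"
        by (simp add: h_def power_mult_distrib mult_ac)
      also have "2 powr (- t) * 2 powr \<alpha> = q" by (simp add: q_def powr_add[symmetric])
      finally show "h k * real (card (A \<inter> cball x (2 ^ k * r))) \<le> 2 powr t * C * r powr (- \<epsilon>) * q ^ k" .
    qed
    also have "\<dots> = 2 powr t * C * r powr (- \<epsilon>) * (\<Sum>k\<le>K. q ^ k)" by (simp add: sum_distrib_left)
    also have "\<dots> \<le> 2 powr t * C * r powr (- \<epsilon>) * (1 / (1 - q))"
    proof (intro mult_left_mono)
      have "(\<Sum>k\<le>K. q ^ k) \<le> (\<Sum>k. q ^ k)"
        using q by (intro sum_le_suminf summable_geometric) auto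
      then show "(\<Sum>k\<le>K. q ^ k) \<le> 1 / (1 - q)" using q by (simp add: suminf_geometric)
    qed (use C(1) in auto)
    finally show "(\<Sum>y\<in>A-{x}. (r / dist x y) powr t) \<le> C' * r powr (- \<epsilon>)"
      by (simp add: C'_def mult_ac)
  qed
qed

section \<open>The energy estimate\<close>

lemma sum_le_sum_cover:
  fixes \<mu> :: "'a \<Rightarrow> real"
  assumes "finite X" "finite Y" "X' \<subseteq> X" "X' \<subseteq> (\<Union>y\<in>Y. B y)" "\<And>x. x \<in> X \<Longrightarrow> 0 \<le> \<mu> x"
  shows "sum \<mu> X' \<le> (\<Sum>y\<in>Y. sum \<mu> (X \<inter> B y))"
proof -
  have "sum \<mu> X' \<le> sum \<mu> (\<Union>y\<in>Y. X \<inter> B y)"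
    using assms by (intro sum_mono2) auto
  also have "\<dots> \<le> (\<Sum>y\<in>Y. sum \<mu> (X \<inter> B y))"
    using assms(2)
  proof (induction Y rule: finite_induct)
    case (insert y Y)
    have "sum \<mu> (X \<inter> B y \<union> (\<Union>y\<in>Y. X \<inter> B y)) + sum \<mu> (X \<inter> B y \<inter> (\<Union>y\<in>Y. X \<inter> B y))
        = sum \<mu> (X \<inter> B y) + sum \<mu> (\<Union>y\<in>Y. X \<inter> B y)"
      using assms(1) insert by (intro sum.union_inter) auto
    moreover have "0 \<le> sum \<mu> (X \<inter> B y \<inter> (\<Union>y\<in>Y. X \<inter> B y))"
      using assms(5) by (intro sum_nonneg) auto
    ultimately show ?case using insert by simp
  qed simp
  finally show ?thesis .
qed

text \<open>Cauchy-Schwarz for the sizes of the fibres: these sum to \<open>card A\<close>, and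
  their squares sum to the number of pairs with equal image.\<close>

lemma card_squared_le_pairs:
  assumes "finite A" "finite B" "f ` A \<subseteq> B"
  shows "(real (card A))\<^sup>2 \<le> real (card B) * real (card {(x, y) \<in> A \<times> A. f x = f y})"
proof -
  define g where "g b = {x\<in>A. f x = b}" for b
  have fing: "finite (g b)" for b using assms(1) by (simp add: g_def)
  have disj: "g b \<inter> g c = {}" if "b \<noteq> c" for b c using that by (auto simp: g_def)
  have "A = (\<Union>b\<in>B. g b)" using assms(3) by (auto simp: g_def)
  then have "card A = card (\<Union>b\<in>B. g b)" by simp
  also have "\<dots> = (\<Sum>b\<in>B. card (g b))"
    using assms(2) fing disj by (intro card_UN_disjoint) auto
  finally have cA: "real (card A) = (\<Sum>b\<in>B. real (card (g b)))" by simp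
  have "{(x, y) \<in> A \<times> A. f x = f y} = (\<Union>b\<in>B. g b \<times> g b)" using assms(3) by (auto simp: g_def)
  then have "card {(x, y) \<in> A \<times> A. f x = f y} = card (\<Union>b\<in>B. g b \<times> g b)" by simp
  also have "\<dots> = (\<Sum>b\<in>B. card (g b \<times> g b))"
    using assms(2) fing by (intro card_UN_disjoint) (auto simp: Times_Int_Times disj)
  finally have cP: "real (card {(x, y) \<in> A \<times> A. f x = f y}) = (\<Sum>b\<in>B. (real (card (g b)))\<^sup>2)"
    by (simp add: power2_eq_square card_cartesian_product)
  have "(real (card A))\<^sup>2 \<le> (\<Sum>b\<in>B. (real (card (g b)))\<^sup>2) * card B"
    unfolding cA by (rule sum_squared_le_sum_of_squares)
  then show ?thesis unfolding cP by (simp add: mult.commute)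
qed

text \<open>Each point is assigned to one member of an optimal cover that contains its image. Points
  with the same member have images at distance at most r.\<close>

lemma covering_number_ge_pairs:
  fixes E :: "'b :: euclidean_space set"
  assumes "bounded E" "0 < r" "finite A" "f ` A \<subseteq> E"
  shows "(real (card A))\<^sup>2
    \<le> real (covering_number r E) * real (card {(x, y) \<in> A \<times> A. dist (f x) (f y) \<le> r})"
proof -
  obtain \<U> where \<U>: "finite \<U>" "E \<subseteq> \<Union>\<U>" "\<And>U. U \<in> \<U> \<Longrightarrow> bounded U \<and> diameter U \<le> r"
    "card \<U> = covering_number r E"
    using covering_number_attained[OF assms(1,2)] by metis
  have "\<forall>a\<in>A. \<exists>U. U \<in> \<U> \<and> f a \<in> U" using \<U>(2) assms(4) by blast
  then obtain h where h: "\<forall>a\<in>A. h a \<in> \<U> \<and> f a \<in> h a" by metis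
  have "(real (card A))\<^sup>2 \<le> real (card \<U>) * real (card {(x, y) \<in> A \<times> A. h x = h y})"
    using h by (intro card_squared_le_pairs[OF assms(3) \<U>(1)]) auto
  also have "\<dots> \<le> real (card \<U>) * real (card {(x, y) \<in> A \<times> A. dist (f x) (f y) \<le> r})"
  proof (intro mult_left_mono of_nat_mono card_mono)
    have "dist (f x) (f y) \<le> r" if "x \<in> A" "y \<in> A" "h x = h y" for x y
      using \<U>(3)[of "h x"] h that by (intro bounded_diameter_le_imp_dist_le[of "h x"]) auto
    then show "{(x, y) \<in> A \<times> A. h x = h y} \<subseteq> {(x, y) \<in> A \<times> A. dist (f x) (f y) \<le> r}" by auto
    show "finite {(x, y) \<in> A \<times> A. dist (f x) (f y) \<le> r}"
      by (rule finite_subset[of _ "A \<times> A"]) (use assms(3) in auto)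
  qed simp
  finally show ?thesis using \<U>(4) by simp
qed

text \<open>Put \<open>\<delta> = r / norm w\<close> and let p be \<open>m * (n - 1 - m)\<close>.
  The subspaces in question are almost orthogonal to the unit vector along w, so a constant times
  \<open>\<delta> powr (- p)\<close> balls of radius \<open>K * \<delta>\<close> contain them, each
  of mass at most \<open>(K * \<delta>) powr s\<close>, and \<open>s - p = t\<close>. The condition
  on \<rho> ensures that the mass bound applies at this radius.\<close>

lemma transversality:
  assumes "m < DIM('a :: euclidean_space)" "0 < s" "s = real (m * (DIM('a) - 1 - m)) + t"
  obtains C where "0 < C" and "\<And>X \<mu> \<rho> r (w :: 'a). finite X \<Longrightarrow> X \<subseteq> grassmannian m \<Longrightarrow>
      (\<And>V. V \<in> X \<Longrightarrow> 0 \<le> \<mu> V) \<Longrightarrow>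
      (\<And>V \<delta>. V \<in> X \<Longrightarrow> \<rho> \<le> \<delta> \<Longrightarrow> sum \<mu> (X \<inter> cball V \<delta>) \<le> \<delta> powr s) \<Longrightarrow>
      0 < r \<Longrightarrow> w \<noteq> 0 \<Longrightarrow> \<rho> \<le> r / norm w \<Longrightarrow> r \<le> norm w \<Longrightarrow>
      sum \<mu> {V\<in>X. norm (orth_proj V w) \<le> r} \<le> C * (r / norm w) powr t"
proof -
  define p where "p = m * (DIM('a) - 1 - m)"
  obtain K where K: "1 \<le> K" and cover: "\<And>(u :: 'a) \<delta> X. norm u = 1 \<Longrightarrow> 0 < \<delta> \<Longrightarrow> \<delta> \<le> 1 \<Longrightarrow>
      X \<subseteq> {V \<in> grassmannian m. norm (orth_proj V u) \<le> \<delta>} \<Longrightarrow>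
      \<exists>Y\<subseteq>X. finite Y \<and> real (card Y) \<le> K * (1 / \<delta>) ^ p \<and> X \<subseteq> (\<Union>y\<in>Y. cball y (K * \<delta>))"
    apply (rule almost_orthogonal_cover[OF assms(1), folded p_def])
    subgoal premises prems by (rule prems(1)[OF prems(2,3)])
    done
  define C where "C = K * K powr s"
  have C: "0 < C" using K by (simp add: C_def)
  show thesis
  proof (rule that[OF C])
    fix X and \<mu> :: "'a linsub \<Rightarrow> real" and \<rho> r :: real and w :: 'a
    assume X: "finite X" "X \<subseteq> grassmannian m" and \<mu>: "\<And>V. V \<in> X \<Longrightarrow> 0 \<le> \<mu> V"
      and ball: "\<And>V \<delta>. V \<in> X \<Longrightarrow> \<rho> \<le> \<delta> \<Longrightarrow> sum \<mu> (X \<inter> cball V \<delta>) \<le> \<delta> powr s"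
      and r: "0 < r" "w \<noteq> 0" "\<rho> \<le> r / norm w" "r \<le> norm w"
    define \<delta> where "\<delta> = r / norm w"
    define u where "u = (1 / norm w) *\<^sub>R w"
    have \<delta>: "0 < \<delta>" "\<delta> \<le> 1" "\<rho> \<le> \<delta>" using r by (auto simp: \<delta>_def)
    have u: "norm u = 1" using r(2) by (simp add: u_def)
    define X' where "X' = {V\<in>X. norm (orth_proj V w) \<le> r}"
    have "norm (orth_proj V u) \<le> \<delta>" if "V \<in> X'" for V
    proof -
      have "norm (orth_proj V u) = norm (orth_proj V w) / norm w"
        by (simp add: u_def linear_cmul[OF linear_orth_proj])
      then show ?thesis using that by (simp add: \<delta>_def X'_def divide_right_mono)
    qed
    then have "X' \<subseteq> {V \<in> grassmannian m. norm (orth_proj V u) \<le> \<delta>}" using X(2) by (auto simp: X'_def)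
    from cover[OF u \<delta>(1,2) this] obtain Y where Y: "Y \<subseteq> X'" "finite Y"
      "real (card Y) \<le> K * (1 / \<delta>) ^ p" "X' \<subseteq> (\<Union>y\<in>Y. cball y (K * \<delta>))" by blast
    have "1 * \<delta> \<le> K * \<delta>" using \<delta>(1) K by (intro mult_right_mono) auto
    then have K\<delta>: "\<rho> \<le> K * \<delta>" using \<delta>(3) by linarith
    have "sum \<mu> X' \<le> (\<Sum>y\<in>Y. sum \<mu> (X \<inter> cball y (K * \<delta>)))"
      using X(1) Y(2,4) \<mu> by (intro sum_le_sum_cover) (auto simp: X'_def)
    also have "\<dots> \<le> (\<Sum>y\<in>Y. (K * \<delta>) powr s)"
      using Y(1) K\<delta> by (intro sum_mono ball) (auto simp: X'_def)
    also have "\<dots> = real (card Y) * (K * \<delta>) powr s" by simp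
    also have "\<dots> \<le> K * (1 / \<delta>) ^ p * (K * \<delta>) powr s"
      using Y(3) by (intro mult_right_mono) auto
    also have "(1 / \<delta>) ^ p = \<delta> powr (- real p)"
      using \<delta>(1) by (simp add: powr_minus_divide powr_realpow power_one_over)
    also have "K * \<delta> powr (- real p) * (K * \<delta>) powr s = C * (\<delta> powr (- real p) * \<delta> powr s)"
      using K \<delta> by (simp add: powr_mult C_def)
    also have "\<delta> powr (- real p) * \<delta> powr s = \<delta> powr t"
      by (simp add: powr_add[symmetric] assms(3) p_def)
    finally show "sum \<mu> {V\<in>X. norm (orth_proj V w) \<le> r} \<le> C * (r / norm w) powr t"
      by (simp add: X'_def \<delta>_def)
  qed
qed

lemma bounded_orth_proj_image: "bounded F \<Longrightarrow> bounded (orth_proj V ` F)"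
  by (intro bounded_linear_image) (simp_all add: linear_orth_proj linear_conv_bounded_linear[symmetric])

text \<open>Triples (V, x, y) with \<open>orth_proj V x\<close> and \<open>orth_proj V y\<close>
  close are counted with weight \<open>\<mu> V\<close>. Each bad V contributes at least
  \<open>r powr (- 2 * \<epsilon>) * card A\<close> pairs, while each x accounts for at most a
  constant times \<open>r powr (- \<epsilon>)\<close>. Hence the total mass, and with it the
  content, is at most a constant times \<open>r powr \<epsilon>\<close>.\<close>

lemma small_projection_cover:
  fixes F :: "'a :: euclidean_space set"
  assumes "bounded F" "F \<noteq> {}" "assouad_bound \<alpha> F" "0 \<le> \<alpha>" "\<alpha> < t" "m < DIM('a)" "0 < \<epsilon>"
  defines "s \<equiv> real (m * (DIM('a) - 1 - m)) + t"
  obtains C r0 where "0 < C" "0 < r0" "r0 < 1" "\<And>r. 0 < r \<Longrightarrow> r \<le> r0 \<Longrightarrow>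
     content_le s (C * r powr \<epsilon>) {V \<in> grassmannian m.
       real (covering_number r (orth_proj V ` F)) \<le> r powr (2 * \<epsilon>) * real (covering_number (2 * r) F)}"
proof -
  have s: "0 < s" using assms(4,5) by (simp add: s_def add_nonneg_pos)
  obtain C1 where C1: "0 < C1" and trans: "\<And>X \<mu> \<rho> r (w :: 'a). finite X \<Longrightarrow> X \<subseteq> grassmannian m \<Longrightarrow>
      (\<And>V. V \<in> X \<Longrightarrow> 0 \<le> \<mu> V) \<Longrightarrow>
      (\<And>V \<delta>. V \<in> X \<Longrightarrow> \<rho> \<le> \<delta> \<Longrightarrow> sum \<mu> (X \<inter> cball V \<delta>) \<le> \<delta> powr s) \<Longrightarrow>
      0 < r \<Longrightarrow> w \<noteq> 0 \<Longrightarrow> \<rho> \<le> r / norm w \<Longrightarrow> r \<le> norm w \<Longrightarrow>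
      sum \<mu> {V\<in>X. norm (orth_proj V w) \<le> r} \<le> C1 * (r / norm w) powr t"
    apply (rule transversality[OF assms(6) s s_def[THEN meta_eq_to_obj_eq]])
    subgoal premises prems by (rule prems(1)[OF prems(2,3)])
    done
  obtain C2 r0 where C2: "0 < C2" "0 < r0" "r0 < 1"
    and kernel: "\<And>r A x. 0 < r \<Longrightarrow> r \<le> r0 \<Longrightarrow> A \<subseteq> F \<Longrightarrow> pairwise (\<lambda>x y. r < dist x y) A \<Longrightarrow> x \<in> A \<Longrightarrow>
       (\<Sum>y\<in>A-{x}. (r / dist x y) powr t) \<le> C2 * r powr (- \<epsilon>)"
    apply (rule assouad_bound_kernel_sum[OF assms(1,3,4,7,5)])
    subgoal premises prems by (rule prems(1)[OF prems(2-5)])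
    done
  define L where "L = max 1 (diameter F)"
  have L: "1 \<le> L" "\<And>x y. x \<in> F \<Longrightarrow> y \<in> F \<Longrightarrow> dist x y \<le> L"
    using diameter_bounded_bound[OF assms(1)] by (auto simp: L_def le_max_iff_disj)
  define C where "C = 8 powr s * (2 powr s + C1 * C2)"
  have C: "0 < C" using C1 C2(1) by (simp add: C_def add_pos_pos)
  show thesis
  proof (rule that[OF C C2(2,3)])
    fix r :: real assume r: "0 < r" "r \<le> r0"
    have r1: "r < 1" using r C2(3) by simp
    \<comment> \<open>Distances in F are at most L, so \<open>r / norm (x - y)\<close> is at least
      \<rho> for all distinct x, y in A. Ball bounds from radius \<rho> on are all that
      \<open>trans\<close> requires.\<close>
    define \<rho> where "\<rho> = r / L"
    have \<rho>: "0 < \<rho>" "\<rho> \<le> r" using r L(1) by (auto simp: \<rho>_def divide_le_eq mult_le_cancel_left1)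
    define Bad where "Bad = {V \<in> grassmannian m. real (covering_number r (orth_proj V ` F))
       \<le> r powr (2 * \<epsilon>) * real (covering_number (2 * r) F)}"
    obtain A where A: "finite A" "A \<subseteq> F" "pairwise (\<lambda>x y. r < dist x y) A"
      "covering_number (2 * r) F \<le> card A" "F \<subseteq> (\<Union>a\<in>A. cball a r)"
      using maximal_separated[OF assms(1) r(1)] by metis
    have "A \<noteq> {}" using A(5) assms(2) by auto
    then have N: "0 < real (card A)" using A(1) by (simp add: card_gt_0_iff)
    obtain X where X: "X \<subseteq> Bad" "finite X" "Bad \<subseteq> (\<Union>y\<in>X. cball y \<rho>)"
      using linsub_finite_net[OF \<rho>(1)] by metis
    have XG: "X \<subseteq> grassmannian m" using X(1) by (auto simp: Bad_def)
    obtain \<mu> where \<mu>: "\<And>V. V \<in> X \<Longrightarrow> 0 \<le> \<mu> V"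
      and ball: "\<And>V \<delta>. V \<in> X \<Longrightarrow> \<rho> \<le> \<delta> \<Longrightarrow> sum \<mu> (X \<inter> cball V \<delta>) \<le> \<delta> powr s"
      and cover: "content_le s (8 powr s * sum \<mu> X) (\<Union>V\<in>X. cball V \<rho>)"
      apply (rule discrete_Frostman[OF X(2) \<rho>(1) s])
    subgoal premises prems by (rule prems(1)[OF prems(2-4)])
    done
    \<comment> \<open>A ball of radius 2 contains all subspaces, so the ball bound also limits the
      total mass. This pays for the diagonal pairs (x, x), to which the kernel does not
      apply.\<close>
    have total: "sum \<mu> X \<le> 2 powr s"
    proof (cases "X = {}")
      case False
      then obtain V where V: "V \<in> X" by blast
      have "X \<inter> cball V 2 = X" using dist_linsub_le_2 by auto
      then show ?thesis using ball[OF V, of 2] \<rho> r1 by simp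
    qed simp
    define P where "P V = {(x, y) \<in> A \<times> A. dist (orth_proj V x) (orth_proj V y) \<le> r}" for V
    have finP: "finite (P V)" for V
      by (rule finite_subset[of _ "A \<times> A"]) (use A(1) in \<open>auto simp: P_def\<close>)
    \<comment> \<open>At a bad V the covering number of the projection is at most
      \<open>r powr (2 * \<epsilon>) * card A\<close>, so one factor \<open>card A\<close> cancels
      in the Cauchy-Schwarz bound.\<close>
    have many: "real (card A) \<le> r powr (2 * \<epsilon>) * real (card (P V))" if V: "V \<in> X" for V
    proof -
      have "(real (card A))\<^sup>2 \<le> real (covering_number r (orth_proj V ` F)) * real (card (P V))"
        unfolding P_def using A(2)
        by (intro covering_number_ge_pairs[OF bounded_orth_proj_image[OF assms(1)] r(1) A(1)]) auto
      also have "\<dots> \<le> (r powr (2 * \<epsilon>) * real (covering_number (2 * r) F)) * real (card (P V))"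
        using X(1) V by (intro mult_right_mono) (auto simp: Bad_def)
      also have "\<dots> \<le> (r powr (2 * \<epsilon>) * real (card A)) * real (card (P V))"
        using A(4) by (intro mult_right_mono mult_left_mono) auto
      finally have "real (card A) * real (card A) \<le> real (card A) * (r powr (2 * \<epsilon>) * real (card (P V)))"
        by (simp add: power2_eq_square mult_ac)
      then show ?thesis using N by simp
    qed
    have pair: "sum \<mu> {V\<in>X. (x, y) \<in> P V} \<le> C1 * (r / dist x y) powr t"
      if x: "x \<in> A" and y: "y \<in> A - {x}" for x y
    proof -
      have "r < dist x y" using A(3) x y by (auto simp: pairwise_def)
      moreover have "dist x y \<le> L" using L(2) x y A(2) by auto
      ultimately have w: "x - y \<noteq> 0" "\<rho> \<le> r / norm (x - y)" "r \<le> norm (x - y)"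
        using r L(1) y by (auto simp: \<rho>_def dist_norm intro!: divide_left_mono)
      have "{V\<in>X. (x, y) \<in> P V} = {V\<in>X. norm (orth_proj V (x - y)) \<le> r}"
        using x y by (auto simp: P_def dist_norm linear_diff[OF linear_orth_proj])
      then show ?thesis
        using trans[OF X(2) XG \<mu> ball r(1) w(1,2,3)] by (simp add: dist_norm)
    qed
    have row: "(\<Sum>y\<in>A. sum \<mu> {V\<in>X. (x, y) \<in> P V}) \<le> 2 powr s + C1 * C2 * r powr (- \<epsilon>)"
      if x: "x \<in> A" for x
    proof -
      have "sum \<mu> {V\<in>X. (x, x) \<in> P V} \<le> sum \<mu> X"
        using X(2) \<mu> by (intro sum_mono2) auto
      then have "sum \<mu> {V\<in>X. (x, x) \<in> P V} \<le> 2 powr s" using total by simp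
      moreover have "(\<Sum>y\<in>A-{x}. sum \<mu> {V\<in>X. (x, y) \<in> P V}) \<le> (\<Sum>y\<in>A-{x}. C1 * (r / dist x y) powr t)"
        using pair[OF x] by (rule sum_mono)
      moreover have "\<dots> = C1 * (\<Sum>y\<in>A-{x}. (r / dist x y) powr t)" by (simp add: sum_distrib_left)
      moreover have "\<dots> \<le> C1 * (C2 * r powr (- \<epsilon>))"
        using kernel[OF r A(2,3) x] C1 by (intro mult_left_mono) auto
      moreover have "(\<Sum>y\<in>A. sum \<mu> {V\<in>X. (x, y) \<in> P V})
          = sum \<mu> {V\<in>X. (x, x) \<in> P V} + (\<Sum>y\<in>A-{x}. sum \<mu> {V\<in>X. (x, y) \<in> P V})"
        using A(1) x by (rule sum.remove)
      ultimately show ?thesis by simp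
    qed
    \<comment> \<open>The double count: the lower bound for pairs is summed against \<mu>, the order
      of summation is exchanged, and \<open>row\<close> bounds the contribution of each x. The
      factor \<open>card A\<close> appears on both sides.\<close>
    have "sum \<mu> X * real (card A) = (\<Sum>V\<in>X. \<mu> V * real (card A))" by (simp add: sum_distrib_right)
    also have "\<dots> \<le> (\<Sum>V\<in>X. \<mu> V * (r powr (2 * \<epsilon>) * real (card (P V))))"
      using many \<mu> by (intro sum_mono mult_left_mono) auto
    also have "\<dots> = r powr (2 * \<epsilon>) * (\<Sum>V\<in>X. \<mu> V * real (card (P V)))"
      by (simp add: sum_distrib_left mult_ac)
    also have "(\<Sum>V\<in>X. \<mu> V * real (card (P V))) = (\<Sum>V\<in>X. \<Sum>q\<in>A\<times>A. if q \<in> P V then \<mu> V else 0)"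
    proof (rule sum.cong)
      fix V
      have "(\<Sum>q\<in>A\<times>A. if q \<in> P V then \<mu> V else 0) = (\<Sum>q\<in>{q\<in>A\<times>A. q \<in> P V}. \<mu> V)"
        using A(1) by (intro sum.inter_filter[symmetric]) auto
      also have "{q\<in>A\<times>A. q \<in> P V} = P V" by (auto simp: P_def)
      finally show "\<mu> V * real (card (P V)) = (\<Sum>q\<in>A\<times>A. if q \<in> P V then \<mu> V else 0)"
        by (simp add: mult.commute)
    qed simp
    also have "\<dots> = (\<Sum>q\<in>A\<times>A. \<Sum>V\<in>X. if q \<in> P V then \<mu> V else 0)" by (rule sum.swap)
    also have "\<dots> = (\<Sum>q\<in>A\<times>A. sum \<mu> {V\<in>X. q \<in> P V})"
      using X(2) by (simp add: sum.inter_filter)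
    also have "\<dots> = (\<Sum>x\<in>A. \<Sum>y\<in>A. sum \<mu> {V\<in>X. (x, y) \<in> P V})"
      by (simp add: sum.cartesian_product case_prod_beta)
    also have "r powr (2 * \<epsilon>) * \<dots> \<le> r powr (2 * \<epsilon>) * (\<Sum>x\<in>A. 2 powr s + C1 * C2 * r powr (- \<epsilon>))"
      using row by (intro mult_left_mono sum_mono) auto
    also have "\<dots> = (r powr (2 * \<epsilon>) * (2 powr s + C1 * C2 * r powr (- \<epsilon>))) * real (card A)" by simp
    finally have "sum \<mu> X \<le> r powr (2 * \<epsilon>) * (2 powr s + C1 * C2 * r powr (- \<epsilon>))"
      using N by (metis mult_right_le_imp_le)
    also have "\<dots> \<le> r powr (2 * \<epsilon>) * ((2 powr s + C1 * C2) * r powr (- \<epsilon>))"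
    proof (intro mult_left_mono)
      have "r powr 0 \<le> r powr (- \<epsilon>)" using r r1 assms(7) by (intro powr_mono') auto
      then have "2 powr s * 1 \<le> 2 powr s * r powr (- \<epsilon>)" using r by (intro mult_left_mono) auto
      then show "2 powr s + C1 * C2 * r powr (- \<epsilon>) \<le> (2 powr s + C1 * C2) * r powr (- \<epsilon>)"
        by (simp add: distrib_right)
    qed simp
    also have "\<dots> = (2 powr s + C1 * C2) * (r powr (2 * \<epsilon>) * r powr (- \<epsilon>))" by (simp only: mult_ac)
    also have "r powr (2 * \<epsilon>) * r powr (- \<epsilon>) = r powr \<epsilon>" by (simp add: powr_add[symmetric])
    finally have "8 powr s * sum \<mu> X \<le> 8 powr s * ((2 powr s + C1 * C2) * r powr \<epsilon>)"
      by (intro mult_left_mono) auto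
    then have "8 powr s * sum \<mu> X \<le> C * r powr \<epsilon>" by (simp add: C_def mult.assoc)
    then show "content_le s (C * r powr \<epsilon>) {V \<in> grassmannian m. real (covering_number r (orth_proj V ` F))
       \<le> r powr (2 * \<epsilon>) * real (covering_number (2 * r) F)}"
      using content_le_mono[OF cover X(3)] unfolding Bad_def by blast
  qed
qed

section \<open>Box dimensions of projections\<close>

text \<open>Borel-Cantelli over the scales \<open>r j\<close>: the contents
  \<open>C * r j powr \<epsilon>\<close> are dominated by a geometric series. The scales only need
  this decay, so they can be adapted to F.\<close>

lemma content_null_frequently_small_projection:
  fixes F :: "'a :: euclidean_space set"
  assumes "bounded F" "F \<noteq> {}" "assouad_bound \<alpha> F" "0 \<le> \<alpha>" "\<alpha> < t" "m < DIM('a)" "0 < \<epsilon>"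
    and r: "\<And>j. 0 < r j" "\<And>j. r j \<le> (1/2) ^ j"
    and E: "E \<subseteq> grassmannian m"
      "\<And>V. V \<in> E \<Longrightarrow> \<exists>\<^sub>F j in sequentially. real (covering_number (r j) (orth_proj V ` F))
          \<le> r j powr (2 * \<epsilon>) * real (covering_number (2 * r j) F)"
  shows "content_null (real (m * (DIM('a) - 1 - m)) + t) E"
proof -
  define s where "s = real (m * (DIM('a) - 1 - m)) + t"
  obtain C r0 where C: "0 < C" "0 < r0" "r0 < 1" and cover: "\<And>r. 0 < r \<Longrightarrow> r \<le> r0 \<Longrightarrow>
     content_le s (C * r powr \<epsilon>) {V \<in> grassmannian m.
       real (covering_number r (orth_proj V ` F)) \<le> r powr (2 * \<epsilon>) * real (covering_number (2 * r) F)}"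
    apply (rule small_projection_cover[OF assms(1-7), folded s_def])
    subgoal premises prems by (rule prems(1)[OF prems(2-5)])
    done
  define B where "B j = {V \<in> grassmannian m. real (covering_number (r j) (orth_proj V ` F))
      \<le> r j powr (2 * \<epsilon>) * real (covering_number (2 * r j) F)}" for j
  define c where "c j = C * ((1/2) powr \<epsilon>) ^ j" for j
  have "(\<lambda>j. (1/2 :: real) ^ j) \<longlonglongrightarrow> 0" by (rule LIMSEQ_realpow_zero) auto
  then have "\<forall>\<^sub>F j in sequentially. (1/2 :: real) ^ j < r0" using C(2) by (rule order_tendstoD)
  then have ev: "\<forall>\<^sub>F j in sequentially. content_le s (c j) (B j)"
  proof eventually_elim
    case (elim j)
    have "content_le s (C * r j powr \<epsilon>) (B j)"
      unfolding B_def using r[of j] elim by (intro cover) auto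
    moreover have "C * r j powr \<epsilon> \<le> c j"
    proof -
      have "r j powr \<epsilon> \<le> ((1/2) ^ j) powr \<epsilon>"
        using r[of j] assms(7) by (intro powr_mono2) auto
      also have "\<dots> = ((1/2) powr \<epsilon>) ^ j"
        by (simp add: powr_realpow[symmetric] powr_powr mult.commute)
      finally show ?thesis using C(1) by (simp add: c_def)
    qed
    ultimately show ?case using content_le_mono by blast
  qed
  have "(1/2 :: real) powr \<epsilon> < (1/2) powr 0" using assms(7) by (intro powr_less_mono') auto
  then have "summable c" unfolding c_def by (intro summable_mult summable_geometric) simp
  moreover have "0 \<le> c j" for j using C(1) by (simp add: c_def)
  moreover have "\<exists>\<^sub>F j in sequentially. V \<in> B j" if "V \<in> E" for V
    using E that by (auto simp: B_def)
  ultimately have "content_null s E" by (intro content_null_limsup[OF ev])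
  then show ?thesis by (simp add: s_def)
qed

section \<open>Box dimensions in terms of covering numbers at single scales\<close>

lemma ln_ratio_less_iff:
  fixes r N a :: real
  assumes "0 < r" "r < 1" "0 < N"
  shows "ln N / - ln r < a \<longleftrightarrow> N < r powr (- a)" "a < ln N / - ln r \<longleftrightarrow> r powr (- a) < N"
proof -
  have l: "0 < - ln r" using assms by simp
  have p: "ln (r powr (- a)) = a * - ln r" using assms by (simp add: ln_powr)
  have rp: "0 < r powr (- a)" using assms by simp
  have "N < r powr (- a) \<longleftrightarrow> ln N < ln (r powr (- a))" using assms(3) rp by (rule ln_less_cancel_iff[symmetric])
  then show "ln N / - ln r < a \<longleftrightarrow> N < r powr (- a)"
    unfolding p using pos_divide_less_eq[OF l] by blast
  have "r powr (- a) < N \<longleftrightarrow> ln (r powr (- a)) < ln N" using rp assms(3) by (rule ln_less_cancel_iff[symmetric])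
  then show "a < ln N / - ln r \<longleftrightarrow> r powr (- a) < N"
    unfolding p using pos_less_divide_eq[OF l] by blast
qed

text \<open>The gap between a and b is halved: one half is kept as the gain
  \<open>r powr ((b - a) / 2)\<close>, the other absorbs the constants c and \<open>2 powr b\<close>
  for small r.\<close>

lemma powr_comparison_near_0:
  fixes a b c :: real
  assumes "a < b" "0 < c"
  obtains \<delta> where "0 < \<delta>" "\<And>r. 0 < r \<Longrightarrow> r \<le> \<delta> \<Longrightarrow>
    c * r powr (- a) \<le> r powr ((b - a) / 2) * (2 * r) powr (- b)"
proof -
  define e where "e = (b - a) / 2"
  have e: "0 < e" using assms by (simp add: e_def)
  define d where "d = 1 / (c * 2 powr b)"
  have d: "0 < d" using assms by (simp add: d_def)
  show thesis
  proof (rule that[of "d powr (1 / e)"])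
    show "0 < d powr (1 / e)" using d by simp
    fix r :: real assume r: "0 < r" "r \<le> d powr (1 / e)"
    have "r powr e \<le> (d powr (1 / e)) powr e" using r e by (intro powr_mono2) auto
    also have "\<dots> = d" using d e by (simp add: powr_powr)
    finally have "c * r powr e \<le> c * d" using assms by simp
    also have "c * d = 2 powr (- b)" using assms by (simp add: d_def powr_minus_divide)
    finally have *: "c * r powr e \<le> 2 powr (- b)" .
    have "c * r powr (- a) = (c * r powr e) * r powr (e - b)"
      by (simp add: mult.assoc powr_add[symmetric] e_def field_simps)
    also have "\<dots> \<le> 2 powr (- b) * r powr (e - b)" using * by (intro mult_right_mono) auto
    also have "\<dots> = r powr e * (2 * r) powr (- b)"
      using r by (simp add: powr_mult powr_diff powr_minus_divide)
    finally show "c * r powr (- a) \<le> r powr ((b - a) / 2) * (2 * r) powr (- b)" by (simp add: e_def)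
  qed
qed

lemma real_covering_number_pos:
  fixes E :: "'a :: euclidean_space set"
  shows "bounded E \<Longrightarrow> E \<noteq> {} \<Longrightarrow> 0 < r \<Longrightarrow> 0 < real (covering_number r E)"
  using covering_number_pos[of E r] by simp

lemma upper_box_dim_lessD:
  fixes E :: "'a :: euclidean_space set"
  assumes "bounded E" "E \<noteq> {}" "upper_box_dim E < ereal a"
  shows "\<exists>\<delta>>0. \<forall>r. 0 < r \<longrightarrow> r < \<delta> \<longrightarrow> real (covering_number r E) < r powr (- a)"
proof -
  have "\<forall>\<^sub>F r in at_right 0. ereal (ln (real (covering_number r E)) / - ln r) < ereal a"
    using assms(3) unfolding upper_box_dim_def by (rule Limsup_lessD)
  then obtain b where b: "0 < b" "\<And>r. 0 < r \<Longrightarrow> r < b \<Longrightarrow> ln (real (covering_number r E)) / - ln r < a"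
    unfolding eventually_at_right_field by auto
  show ?thesis
  proof (intro exI[of _ "min b 1"] conjI allI impI)
    fix r assume r: "0 < r" "r < min b 1"
    then show "real (covering_number r E) < r powr (- a)"
      using ln_ratio_less_iff(1)[of r] real_covering_number_pos[OF assms(1,2)] b(2)[of r] by simp
  qed (use b(1) in simp)
qed

lemma upper_box_dim_greaterD:
  fixes E :: "'a :: euclidean_space set"
  assumes "bounded E" "E \<noteq> {}" "ereal a < upper_box_dim E" "0 < \<delta>"
  shows "\<exists>r>0. r < \<delta> \<and> r powr (- a) < real (covering_number r E)"
proof (rule ccontr)
  assume n: "\<not> ?thesis"
  have "\<forall>\<^sub>F r in at_right 0. ereal (ln (real (covering_number r E)) / - ln r) \<le> ereal a"
    unfolding eventually_at_right_field
  proof (intro exI[of _ "min \<delta> 1"] conjI allI impI)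
    fix r :: real assume r: "0 < r" "r < min \<delta> 1"
    then have "\<not> r powr (- a) < real (covering_number r E)" using n by auto
    then show "ereal (ln (real (covering_number r E)) / - ln r) \<le> ereal a"
      using ln_ratio_less_iff(2)[of r "real (covering_number r E)" a]
        real_covering_number_pos[OF assms(1,2) r(1)] r by simp
  qed (use assms(4) in simp)
  then have "upper_box_dim E \<le> ereal a" unfolding upper_box_dim_def by (rule Limsup_bounded)
  then show False using assms(3) by simp
qed

lemma lower_box_dim_greaterD:
  fixes E :: "'a :: euclidean_space set"
  assumes "bounded E" "E \<noteq> {}" "ereal a < lower_box_dim E"
  shows "\<exists>\<delta>>0. \<forall>r. 0 < r \<longrightarrow> r < \<delta> \<longrightarrow> r powr (- a) < real (covering_number r E)"
proof -
  have "\<forall>\<^sub>F r in at_right 0. ereal a < ereal (ln (real (covering_number r E)) / - ln r)"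
    using assms(3) unfolding lower_box_dim_def by (rule less_LiminfD)
  then obtain b where b: "0 < b" "\<And>r. 0 < r \<Longrightarrow> r < b \<Longrightarrow> a < ln (real (covering_number r E)) / - ln r"
    unfolding eventually_at_right_field by auto
  show ?thesis
  proof (intro exI[of _ "min b 1"] conjI allI impI)
    fix r assume r: "0 < r" "r < min b 1"
    then show "r powr (- a) < real (covering_number r E)"
      using ln_ratio_less_iff(2)[of r] real_covering_number_pos[OF assms(1,2)] b(2)[of r] by simp
  qed (use b(1) in simp)
qed

lemma lower_box_dim_lessD:
  fixes E :: "'a :: euclidean_space set"
  assumes "bounded E" "E \<noteq> {}" "lower_box_dim E < ereal a" "0 < \<delta>"
  shows "\<exists>r>0. r < \<delta> \<and> real (covering_number r E) < r powr (- a)"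
proof (rule ccontr)
  assume n: "\<not> ?thesis"
  have "\<forall>\<^sub>F r in at_right 0. ereal a \<le> ereal (ln (real (covering_number r E)) / - ln r)"
    unfolding eventually_at_right_field
  proof (intro exI[of _ "min \<delta> 1"] conjI allI impI)
    fix r :: real assume r: "0 < r" "r < min \<delta> 1"
    then have "\<not> real (covering_number r E) < r powr (- a)" using n by auto
    then show "ereal a \<le> ereal (ln (real (covering_number r E)) / - ln r)"
      using ln_ratio_less_iff(1)[of r "real (covering_number r E)" a]
        real_covering_number_pos[OF assms(1,2) r(1)] r by simp
  qed (use assms(4) in simp)
  then have "ereal a \<le> lower_box_dim E" unfolding lower_box_dim_def by (rule Liminf_bounded)
  then show False using assms(3) by simp
qed

text \<open>A drop leaves room for two rationals a < b between \<open>f V\<close> and d, and there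
  are countably many such pairs. The fixed gap \<open>b - a\<close> is what becomes a power of
  r.\<close>

lemma content_null_rational_gap:
  fixes f :: "'a :: euclidean_space linsub \<Rightarrow> ereal" and d :: ereal
  assumes "\<And>a b. a < b \<Longrightarrow> ereal b < d \<Longrightarrow> content_null s {V \<in> G. f V < ereal a}"
  shows "content_null s {V \<in> G. f V < d}"
proof -
  define I where "I = {p \<in> \<rat> \<times> \<rat>. fst p < snd p \<and> ereal (snd p) < d}"
  have "content_null s (\<Union>p\<in>I. {V \<in> G. f V < ereal (fst p)})"
  proof (rule content_null_UN_countable)
    show "countable I" unfolding I_def
      by (rule countable_subset[of _ "\<rat> \<times> \<rat>"]) (auto intro: countable_SIGMA countable_rat)
  qed (use assms in \<open>auto simp: I_def\<close>)
  moreover have "{V \<in> G. f V < d} \<subseteq> (\<Union>p\<in>I. {V \<in> G. f V < ereal (fst p)})"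
  proof
    fix V assume V: "V \<in> {V \<in> G. f V < d}"
    \<comment> \<open>Intermediate reals are inserted since d may be infinite, while the rationals
      are found between two reals.\<close>
    then obtain z where z: "f V < ereal z" "ereal z < d" using ereal_dense2 by blast
    obtain z' where z': "ereal z < ereal z'" "ereal z' < d" using ereal_dense2[OF z(2)] by blast
    then obtain z'' where z'': "ereal z' < ereal z''" "ereal z'' < d" using ereal_dense2[OF z'(2)] by blast
    obtain a b where "a \<in> \<rat>" "z < a" "a < z'" "b \<in> \<rat>" "z' < b" "b < z''"
      using Rats_dense_in_real[of z z'] Rats_dense_in_real[of z' z''] z' z'' by auto
    moreover have "ereal b < d" using z''(2) calculation(6) by (meson ereal_less_eq(3) le_less_trans less_imp_le)
    moreover have "f V < ereal a" using z(1) calculation(2) by (meson less_ereal.simps(1) less_trans)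
    ultimately show "V \<in> (\<Union>p\<in>I. {V \<in> G. f V < ereal (fst p)})"
      using V by (intro UN_I[of "(a, b)"]) (auto simp: I_def)
  qed
  ultimately show ?thesis by (rule content_null_subset)
qed

text \<open>F is large along some sequence of scales, which is chosen once and for all. A small
  upper box dimension of the projection bounds its covering numbers at all small scales, hence along
  this sequence, whatever V is.\<close>

theorem content_null_upper_box_dim_drop:
  fixes F :: "'a :: euclidean_space set"
  assumes "bounded F" "F \<noteq> {}" "assouad_bound \<alpha> F" "0 \<le> \<alpha>" "\<alpha> < t" "m < DIM('a)"
  shows "content_null (real (m * (DIM('a) - 1 - m)) + t)
    {V \<in> grassmannian m. upper_box_dim (orth_proj V ` F) < upper_box_dim F}"
proof (rule content_null_rational_gap)
  have four: "2 * ((b - a) / 4) = (b - a) / 2" for a b :: real by simp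
  fix a b assume ab: "a < b" "ereal b < upper_box_dim F"
  have "\<exists>r>0. r < (1/2) ^ j \<and> r powr (- b) < real (covering_number r F)" for j
    by (rule upper_box_dim_greaterD[OF assms(1,2) ab(2)]) simp
  then obtain q where q: "\<And>j. 0 < q j" "\<And>j. q j < (1/2) ^ j"
    "\<And>j. q j powr (- b) < real (covering_number (q j) F)" by metis
  \<comment> \<open>Halved because badness at scale r compares with the covering number of F at
    \<open>2 * r\<close>.\<close>
  define r where "r j = q j / 2" for j
  have r: "0 < r j" "r j \<le> (1/2) ^ j" "2 * r j = q j" for j
    using q(1,2)[of j] by (auto simp: r_def)
  obtain \<delta> where \<delta>: "0 < \<delta>" "\<And>r. 0 < r \<Longrightarrow> r \<le> \<delta> \<Longrightarrow>
    1 * r powr (- a) \<le> r powr ((b - a) / 2) * (2 * r) powr (- b)"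
    using powr_comparison_near_0[OF ab(1) zero_less_one] by metis
  have "\<exists>\<^sub>F j in sequentially. real (covering_number (r j) (orth_proj V ` F))
          \<le> r j powr (2 * ((b - a) / 4)) * real (covering_number (2 * r j) F)"
    if V: "upper_box_dim (orth_proj V ` F) < ereal a" for V
  proof -
    obtain \<delta>' where \<delta>': "0 < \<delta>'" "\<And>r. 0 < r \<Longrightarrow> r < \<delta>' \<Longrightarrow>
        real (covering_number r (orth_proj V ` F)) < r powr (- a)"
      using upper_box_dim_lessD[OF bounded_orth_proj_image[OF assms(1)] _ V] assms(2) by auto
    have "(\<lambda>j. (1/2 :: real) ^ j) \<longlonglongrightarrow> 0" by (rule LIMSEQ_realpow_zero) auto
    then have "\<forall>\<^sub>F j in sequentially. (1/2 :: real) ^ j < min \<delta> \<delta>'"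
      using \<delta>(1) \<delta>'(1) by (intro order_tendstoD) auto
    then have "\<forall>\<^sub>F j in sequentially. real (covering_number (r j) (orth_proj V ` F))
          \<le> r j powr (2 * ((b - a) / 4)) * real (covering_number (2 * r j) F)"
    proof eventually_elim
      case (elim j)
      have "real (covering_number (r j) (orth_proj V ` F)) \<le> 1 * r j powr (- a)"
        using \<delta>'(2)[of "r j"] r[of j] elim by simp
      also have "\<dots> \<le> r j powr ((b - a) / 2) * (2 * r j) powr (- b)"
        using r[of j] elim by (intro \<delta>(2)) auto
      also have "\<dots> \<le> r j powr ((b - a) / 2) * real (covering_number (2 * r j) F)"
        using q(3)[of j] r(3)[of j] by (intro mult_left_mono) auto
      finally show ?case unfolding four .
    qed
    then show ?thesis by (rule eventually_frequently[rotated]) simp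
  qed
  then show "content_null (real (m * (DIM('a) - 1 - m)) + t)
     {V \<in> grassmannian m. upper_box_dim (orth_proj V ` F) < ereal a}"
    using ab(1) r by (intro content_null_frequently_small_projection[OF assms, of "(b - a) / 4" r]) auto
qed

text \<open>The roles are reversed: F is large at all small scales, but the scales at which a
  projection is small depend on V. Rounded up to powers of 1/2 they belong to one fixed sequence,
  and the rounding costs a constant factor.\<close>

theorem content_null_lower_box_dim_drop:
  fixes F :: "'a :: euclidean_space set"
  assumes "bounded F" "F \<noteq> {}" "assouad_bound \<alpha> F" "0 \<le> \<alpha>" "\<alpha> < t" "m < DIM('a)"
  shows "content_null (real (m * (DIM('a) - 1 - m)) + t)
    {V \<in> grassmannian m. lower_box_dim (orth_proj V ` F) < lower_box_dim F}"
proof (rule content_null_rational_gap)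
  have four: "2 * ((b - a) / 4) = (b - a) / 2" for a b :: real by simp
  fix a b assume ab: "a < b" "ereal b < lower_box_dim F"
  obtain \<delta>' where \<delta>': "0 < \<delta>'" "\<And>r. 0 < r \<Longrightarrow> r < \<delta>' \<Longrightarrow> r powr (- b) < real (covering_number r F)"
    using lower_box_dim_greaterD[OF assms(1,2) ab(2)] by auto
  define r :: "nat \<Rightarrow> real" where "r j = (1/2) ^ j" for j
  have r: "0 < r j" "r (Suc j) = r j / 2" for j by (auto simp: r_def)
  \<comment> \<open>The rounding factor: \<open>\<rho> / r j\<close> lies between 1/2 and 1, so its
    power with exponent \<open>- a\<close> is at most \<open>2 powr \<bar>a\<bar>\<close>. The sign
    of a is not known.\<close>
  define c :: real where "c = 2 powr \<bar>a\<bar>"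
  obtain \<delta> where \<delta>: "0 < \<delta>" "\<And>r. 0 < r \<Longrightarrow> r \<le> \<delta> \<Longrightarrow>
    c * r powr (- a) \<le> r powr ((b - a) / 2) * (2 * r) powr (- b)"
    using powr_comparison_near_0[OF ab(1), of c] by (auto simp: c_def)
  have "\<exists>\<^sub>F j in sequentially. real (covering_number (r j) (orth_proj V ` F))
          \<le> r j powr (2 * ((b - a) / 4)) * real (covering_number (2 * r j) F)"
    if V: "lower_box_dim (orth_proj V ` F) < ereal a" for V
    unfolding frequently_sequentially
  proof
    fix N
    have "(\<lambda>j. (1/2 :: real) ^ j) \<longlonglongrightarrow> 0" by (rule LIMSEQ_realpow_zero) auto
    then have "\<forall>\<^sub>F j in sequentially. (1/2 :: real) ^ j < min \<delta> (\<delta>' / 2)"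
      using \<delta>(1) \<delta>'(1) by (intro order_tendstoD) auto
    then obtain N' where N': "\<And>j. N' \<le> j \<Longrightarrow> r j < min \<delta> (\<delta>' / 2)"
      by (auto simp: eventually_sequentially r_def)
    define k where "k = max N N'"
    have bV: "bounded (orth_proj V ` F)" using assms(1) by (rule bounded_orth_proj_image)
    obtain \<rho> where \<rho>: "0 < \<rho>" "\<rho> < r k" "real (covering_number \<rho> (orth_proj V ` F)) < \<rho> powr (- a)"
      using lower_box_dim_lessD[OF bV _ V r(1)] assms(2) by auto
    obtain j1 where "r j1 < \<rho>"
      using real_arch_pow_inv[of \<rho> "1/2"] \<rho>(1) by (auto simp: r_def)
    \<comment> \<open>The predecessor j of the least index with \<open>r i < \<rho>\<close>
      satisfies \<open>\<rho> \<le> r j < 2 * \<rho>\<close>, and it is at least k because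
      \<open>\<rho> < r k\<close>.\<close>
    define i where "i = (LEAST i. r i < \<rho>)"
    have i: "r i < \<rho>" unfolding i_def by (rule LeastI[of _ j1]) fact
    have "k < i"
    proof (rule ccontr)
      assume "\<not> k < i"
      then have "r k \<le> r i" by (simp add: r_def power_decreasing)
      then show False using i \<rho>(2) by simp
    qed
    then obtain j where j: "i = Suc j" "k \<le> j" by (cases i) auto
    have "\<not> r j < \<rho>" using not_less_Least[of j "\<lambda>i. r i < \<rho>"] j(1) by (simp add: i_def)
    then have \<rho>j: "\<rho> \<le> r j" "r j / 2 < \<rho>" using i j(1) r(2) by auto
    have "real (covering_number (r j) (orth_proj V ` F)) \<le> real (covering_number \<rho> (orth_proj V ` F))"
      using \<rho>j(1) \<rho>(1) bV by (intro of_nat_mono covering_number_mono) auto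
    also have "\<dots> \<le> \<rho> powr (- a)" using \<rho>(3) by simp
    also have "\<dots> = (\<rho> / r j) powr (- a) * r j powr (- a)"
      using \<rho>(1) r(1)[of j] by (simp add: powr_mult[symmetric])
    also have "\<dots> \<le> c * r j powr (- a)"
    proof (intro mult_right_mono)
      have x: "1/2 \<le> \<rho> / r j" "\<rho> / r j \<le> 1" using \<rho>j r(1)[of j] by (auto simp: field_simps)
      have "(\<rho> / r j) powr (- a) \<le> (\<rho> / r j) powr (- \<bar>a\<bar>)"
        using x by (intro powr_mono') linarith+
      also have "\<dots> \<le> (1/2) powr (- \<bar>a\<bar>)" using x by (intro powr_mono2') auto
      also have "\<dots> = c" by (simp add: c_def powr_minus_divide powr_divide)
      finally show "(\<rho> / r j) powr (- a) \<le> c" .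
    qed simp
    also have "\<dots> \<le> r j powr ((b - a) / 2) * (2 * r j) powr (- b)"
      using N'[of j] j(2) r(1)[of j] by (intro \<delta>(2)) (auto simp: k_def)
    also have "\<dots> \<le> r j powr ((b - a) / 2) * real (covering_number (2 * r j) F)"
      using \<delta>'(2)[of "2 * r j"] N'[of j] j(2) r(1)[of j]
      by (intro mult_left_mono) (auto simp: k_def)
    finally show "\<exists>n\<ge>N. real (covering_number (r n) (orth_proj V ` F))
          \<le> r n powr (2 * ((b - a) / 4)) * real (covering_number (2 * r n) F)"
      unfolding four using j(2) by (intro exI[of _ j]) (auto simp: k_def)
  qed
  then show "content_null (real (m * (DIM('a) - 1 - m)) + t)
     {V \<in> grassmannian m. lower_box_dim (orth_proj V ` F) < ereal a}"
    using ab(1) r(1)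
    by (intro content_null_frequently_small_projection[OF assms, of "(b - a) / 4" r]) (auto simp: r_def)
qed

section \<open>Packing dimensions of projections\<close>

text \<open>The first entry of the sequence names the set \<open>C n\<close>, and the shifted
  sequence is the witness for membership in its projection.\<close>

lemma closed_sets_projection_UN:
  fixes C :: "nat \<Rightarrow> ('a :: topological_space \<times> (nat \<Rightarrow> nat)) set"
  assumes "\<And>n. closed (C n)"
  shows "\<exists>D :: ('a \<times> (nat \<Rightarrow> nat)) set. closed D \<and> fst ` D = (\<Union>n. fst ` C n)"
proof (intro exI conjI)
  define g where "g p = (fst p, \<lambda>k. snd p (Suc k))" for p :: "'a \<times> (nat \<Rightarrow> nat)"
  have g: "continuous_on UNIV g"
    unfolding g_def
    by (intro continuous_intros continuous_on_coordinatewise_then_product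
        continuous_on_product_then_coordinatewise[where f = snd])
  define h where "h p = snd p 0" for p :: "'a \<times> (nat \<Rightarrow> nat)"
  have h: "continuous_on UNIV h"
    unfolding h_def by (intro continuous_on_product_then_coordinatewise[where f = snd] continuous_intros)
  \<comment> \<open>"If the first entry is n, then the shifted point lies in \<open>C n\<close>",
    for all n: an intersection of closed conditions, as the naturals are discrete.\<close>
  define D where "D = (\<Inter>n. h -` (- {n}) \<union> g -` C n)"
  have "closed (- {n :: nat})" for n by (simp add: open_discrete closed_def)
  then show "closed D"
    unfolding D_def using assms g h by (intro closed_INT ballI closed_Un closed_vimage)
  have D: "(x, y) \<in> D \<longleftrightarrow> (x, \<lambda>k. y (Suc k)) \<in> C (y 0)" for x y
    by (auto simp: D_def g_def h_def)
  show "fst ` D = (\<Union>n. fst ` C n)"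
  proof
    show "fst ` D \<subseteq> (\<Union>n. fst ` C n)" using D by force
    show "(\<Union>n. fst ` C n) \<subseteq> fst ` D"
    proof
      fix x assume "x \<in> (\<Union>n. fst ` C n)"
      then obtain n y where "(x, y) \<in> C n" by force
      then have "(x, case_nat n y) \<in> D" by (simp add: D)
      then show "x \<in> fst ` D" by force
    qed
  qed
qed

text \<open>One sequence stores a witness for every n, the n-th of them at the positions
  \<open>prod_encode (n, k)\<close>.\<close>

lemma closed_sets_projection_INT:
  fixes C :: "nat \<Rightarrow> ('a :: topological_space \<times> (nat \<Rightarrow> nat)) set"
  assumes "\<And>n. closed (C n)"
  shows "\<exists>D :: ('a \<times> (nat \<Rightarrow> nat)) set. closed D \<and> fst ` D = (\<Inter>n. fst ` C n)"
proof (intro exI conjI)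
  define g where "g n p = (fst p, \<lambda>k. snd p (prod_encode (n, k)))" for n and p :: "'a \<times> (nat \<Rightarrow> nat)"
  have g: "continuous_on UNIV (g n)" for n
    unfolding g_def
    by (intro continuous_intros continuous_on_coordinatewise_then_product
        continuous_on_product_then_coordinatewise[where f = snd])
  define D where "D = (\<Inter>n. g n -` C n)"
  show "closed D" unfolding D_def using assms g by (intro closed_INT ballI closed_vimage)
  have D: "(x, y) \<in> D \<longleftrightarrow> (\<forall>n. (x, \<lambda>k. y (prod_encode (n, k))) \<in> C n)" for x y
    by (auto simp: D_def g_def)
  show "fst ` D = (\<Inter>n. fst ` C n)"
  proof
    show "fst ` D \<subseteq> (\<Inter>n. fst ` C n)" using D by force
    show "(\<Inter>n. fst ` C n) \<subseteq> fst ` D"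
    proof
      fix x assume "x \<in> (\<Inter>n. fst ` C n)"
      then have "\<forall>n. \<exists>y. (x, y) \<in> C n" by force
      then obtain y where "\<forall>n. (x, y n) \<in> C n" by metis
      then have "(x, \<lambda>i. y (fst (prod_decode i)) (snd (prod_decode i))) \<in> D" by (simp add: D)
      then show "x \<in> fst ` D" by force
    qed
  qed
qed

text \<open>Projections of closed sets are not closed under complements, so the induction treats a Borel
  set together with its complement.\<close>

lemma borel_projection_closed:
  fixes A :: "'a :: euclidean_space set"
  assumes "A \<in> sets borel"
  shows "\<exists>C :: ('a \<times> (nat \<Rightarrow> nat)) set. closed C \<and> fst ` C = A"
proof -
  define P where "P A \<longleftrightarrow> (\<exists>C :: ('a \<times> (nat \<Rightarrow> nat)) set. closed C \<and> fst ` C = A)" for A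
  have P_closed: "P A" if "closed A" for A
    unfolding P_def using that by (intro exI[of _ "A \<times> UNIV"]) (simp add: closed_Times)
  have P_UN: "P (\<Union>n. B n)" if "\<And>n. P (B n)" for B :: "nat \<Rightarrow> 'a set"
  proof -
    obtain C :: "nat \<Rightarrow> ('a \<times> (nat \<Rightarrow> nat)) set" where "\<And>n. closed (C n)" "\<And>n. fst ` C n = B n"
      using \<open>\<And>n. P (B n)\<close> unfolding P_def by metis
    then show ?thesis using closed_sets_projection_UN[of C] by (simp add: P_def)
  qed
  have P_INT: "P (\<Inter>n. B n)" if "\<And>n. P (B n)" for B :: "nat \<Rightarrow> 'a set"
  proof -
    obtain C :: "nat \<Rightarrow> ('a \<times> (nat \<Rightarrow> nat)) set" where "\<And>n. closed (C n)" "\<And>n. fst ` C n = B n"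
      using \<open>\<And>n. P (B n)\<close> unfolding P_def by metis
    then show ?thesis using closed_sets_projection_INT[of C] by (simp add: P_def)
  qed
  have P_open: "P S" if S: "open S" for S
  proof -
    obtain D where D: "countable D" "\<And>X. X \<in> D \<Longrightarrow> \<exists>a b. X = cbox a b" "\<Union>D = S"
      using open_countable_Union_open_cbox[OF S] by metis
    show ?thesis
    proof (cases "D = {}")
      case True
      then show ?thesis using D(3) P_closed[of "{}"] by simp
    next
      case False
      have "P (from_nat_into D n)" for n
        using D(2)[OF from_nat_into[OF False, of n]] P_closed closed_cbox by metis
      then have "P (\<Union>n. from_nat_into D n)" by (rule P_UN)
      moreover have "(\<Union>n. from_nat_into D n) = S"
        using D(3) range_from_nat_into[OF False D(1)] by simp
      ultimately show ?thesis by simp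
    qed
  qed
  have "A \<in> sigma_sets UNIV (Collect open)"
    using assms by (simp add: borel_def)
  then have "P A \<and> P (UNIV - A)"
  proof (induction rule: sigma_sets.induct)
    case (Basic a)
    then show ?case using P_open P_closed[of "UNIV - a"] by (simp add: Compl_eq_Diff_UNIV[symmetric] closed_Compl)
  next
    case Empty
    then show ?case using P_closed[of "{}"] P_closed[of UNIV] by simp
  next
    case (Compl a)
    then show ?case by (simp add: Diff_Diff_Int)
  next
    case (Union a)
    have "UNIV - (\<Union>i. a i) = (\<Inter>i. UNIV - a i)" by auto
    then show ?case using P_UN[of a] P_INT[of "\<lambda>i. UNIV - a i"] Union.IH by simp
  qed
  then show ?thesis by (simp add: P_def)
qed

text \<open>Discrete spaces are completely metrizable, and countable products preserve this. It
  gives Baire's theorem on closed subsets of the space above the Borel set.\<close>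

lemma completely_metrizable_euclidean_sequences:
  "completely_metrizable_space (euclidean :: ('a :: complete_space \<times> (nat \<Rightarrow> nat)) topology)"
proof -
  have "discrete_topology (UNIV :: nat set) = euclidean"
    unfolding discrete_topology_unique by (simp add: open_discrete)
  then have "completely_metrizable_space (euclidean :: nat topology)"
    using completely_metrizable_space_discrete_topology[of "UNIV :: nat set"] by simp
  then have "completely_metrizable_space (product_topology (\<lambda>_ :: nat. euclidean :: nat topology) UNIV)"
    unfolding completely_metrizable_space_product_topology by simp
  then have "completely_metrizable_space (euclidean :: (nat \<Rightarrow> nat) topology)"
    by (simp only: euclidean_product_topology)
  then have "completely_metrizable_space
      (prod_topology (euclidean :: 'a topology) (euclidean :: (nat \<Rightarrow> nat) topology))"
    unfolding completely_metrizable_space_prod_topology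
    using completely_metrizable_space_euclidean by simp
  then show ?thesis by (simp only: prod_topology_euclidean)
qed

lemma Baire_countable_closed_cover:
  fixes T :: "('a :: complete_space \<times> (nat \<Rightarrow> nat)) set" and D :: "nat \<Rightarrow> _ set"
  assumes "closed T" "T \<noteq> {}" "T \<subseteq> (\<Union>j. D j)" "\<And>j. closed (D j)"
  shows "\<exists>j U. open U \<and> T \<inter> U \<noteq> {} \<and> T \<inter> U \<subseteq> D j"
proof (rule ccontr)
  assume n: "\<not> ?thesis"
  define X where "X = subtopology euclidean T"
  have X: "completely_metrizable_space X"
    unfolding X_def using assms(1) completely_metrizable_euclidean_sequences
    by (intro completely_metrizable_space_closedin) auto
  have "X interior_of \<Union>(range (\<lambda>j. T \<inter> D j)) = {}"
  proof (rule Baire_category_alt)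
    fix S assume "S \<in> range (\<lambda>j. T \<inter> D j)"
    then obtain j where S: "S = T \<inter> D j" by blast
    have "X interior_of S = {}"
    proof (rule ccontr)
      assume ne: "X interior_of S \<noteq> {}"
      have "openin X (X interior_of S)" by (rule openin_interior_of)
      then obtain U where "open U" "X interior_of S = T \<inter> U"
        unfolding X_def openin_open by blast
      moreover have "X interior_of S \<subseteq> S" by (rule interior_of_subset)
      ultimately show False using n ne S by blast
    qed
    moreover have "closedin X S"
      unfolding X_def S closedin_closed using assms(4) by blast
    ultimately show "closedin X S \<and> X interior_of S = {}" by blast
  qed (use X in auto)
  moreover have "\<Union>(range (\<lambda>j. T \<inter> D j)) = topspace X" using assms(3) by (auto simp: X_def)
  ultimately have "topspace X = {}" by simp
  then show False using assms(2) by (simp add: X_def)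
qed

section \<open>Countable compact covers of bounded upper box dimension\<close>

lemma upper_box_dim_mono_covering:
  fixes A :: "'a :: euclidean_space set" and B :: "'b :: euclidean_space set"
  assumes "bounded A" "A \<noteq> {}" "\<And>r. 0 < r \<Longrightarrow> covering_number r A \<le> covering_number r B"
  shows "upper_box_dim A \<le> upper_box_dim B"
  unfolding upper_box_dim_def
proof (rule Limsup_mono)
  have "ereal (ln (real (covering_number r A)) / - ln r) \<le> ereal (ln (real (covering_number r B)) / - ln r)"
    if r: "0 < r" "r < 1" for r
  proof -
    have "ln (real (covering_number r A)) \<le> ln (real (covering_number r B))"
      using assms(3)[OF r(1)] real_covering_number_pos[OF assms(1,2) r(1)] by (subst ln_le_cancel_iff) auto
    then have "ln (real (covering_number r A)) / - ln r \<le> ln (real (covering_number r B)) / - ln r"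
      using r by (intro divide_right_mono) auto
    then show ?thesis by simp
  qed
  then show "\<forall>\<^sub>F r in at_right 0. ereal (ln (real (covering_number r A)) / - ln r)
      \<le> ereal (ln (real (covering_number r B)) / - ln r)"
    unfolding eventually_at_right_field by (intro exI[of _ 1]) auto
qed

text \<open>A strong form of \<open>packing_dim A \<le> d\<close> in which one cover realises the
  bound. It is stable under countable unions and subsets without any \<epsilon>.\<close>

definition sigma_box_le :: "ereal \<Rightarrow> 'a :: metric_space set \<Rightarrow> bool" where
  "sigma_box_le d A \<longleftrightarrow> (\<exists>K :: nat \<Rightarrow> 'a set. A \<subseteq> (\<Union>j. K j) \<and> (\<forall>j. compact (K j) \<and> upper_box_dim (K j) \<le> d))"

lemma sigma_box_le_subset: "sigma_box_le d B \<Longrightarrow> A \<subseteq> B \<Longrightarrow> sigma_box_le d A"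
  unfolding sigma_box_le_def by (meson order_trans)

lemma sigma_box_le_UN:
  fixes A :: "nat \<Rightarrow> 'a :: metric_space set"
  assumes "\<And>n. sigma_box_le d (A n)"
  shows "sigma_box_le d (\<Union>n. A n)"
proof -
  have "\<forall>n. \<exists>K :: nat \<Rightarrow> 'a set. A n \<subseteq> (\<Union>j. K j) \<and> (\<forall>j. compact (K j) \<and> upper_box_dim (K j) \<le> d)"
    using assms by (simp add: sigma_box_le_def)
  then obtain K :: "nat \<Rightarrow> nat \<Rightarrow> 'a set" where K: "\<And>n. A n \<subseteq> (\<Union>j. K n j)"
    "\<And>n j. compact (K n j) \<and> upper_box_dim (K n j) \<le> d" by metis
  define L where "L i = K (fst (prod_decode i)) (snd (prod_decode i))" for i
  have "(\<Union>n. A n) \<subseteq> (\<Union>i. L i)"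
  proof
    fix x assume "x \<in> (\<Union>n. A n)"
    then obtain n j where "x \<in> K n j" using K(1) by blast
    then have "x \<in> L (prod_encode (n, j))" by (simp add: L_def)
    then show "x \<in> (\<Union>i. L i)" by blast
  qed
  then show ?thesis unfolding sigma_box_le_def using K(2) by (intro exI[of _ L]) (simp add: L_def)
qed

text \<open>The covering number is 0 and \<open>ln 0 = 0\<close>. Empty members of a cover are
  therefore harmless only for bounds \<open>0 \<le> d\<close>, which forces negative bounds to be
  treated separately.\<close>

lemma upper_box_dim_empty: "upper_box_dim ({} :: 'a :: metric_space set) = 0"
proof -
  have "covering_number r ({} :: 'a set) = 0" for r
    using covering_number_le[of "{}" "{} :: 'a set" r] by simp
  then show ?thesis by (simp add: upper_box_dim_def Limsup_const zero_ereal_def)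
qed

lemma sigma_box_le_empty: "0 \<le> d \<Longrightarrow> sigma_box_le d {}"
  unfolding sigma_box_le_def by (intro exI[of _ "\<lambda>_. {}"]) (simp add: upper_box_dim_empty)

lemma sigma_box_le_UN_countable:
  fixes A :: "'i \<Rightarrow> 'a :: metric_space set"
  assumes "0 \<le> d" "countable I" "\<And>i. i \<in> I \<Longrightarrow> sigma_box_le d (A i)"
  shows "sigma_box_le d (\<Union>i\<in>I. A i)"
proof (cases "I = {}")
  case True
  then show ?thesis using sigma_box_le_empty[OF assms(1)] by simp
next
  case False
  have "sigma_box_le d (\<Union>n. A (from_nat_into I n))"
    by (rule sigma_box_le_UN) (rule assms(3)[OF from_nat_into[OF False]])
  moreover have "(\<Union>i\<in>I. A i) \<subseteq> (\<Union>n. A (from_nat_into I n))"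
    using from_nat_into_surj[OF assms(2)] by force
  ultimately show ?thesis by (rule sigma_box_le_subset)
qed

text \<open>Closing the members of a finite cover keeps their diameters and covers the closure, so
  the compact set \<open>closure A\<close> alone serves as the cover.\<close>

lemma sigma_box_le_bounded:
  fixes A :: "'a :: euclidean_space set"
  assumes "bounded A" "upper_box_dim A \<le> d"
  shows "sigma_box_le d A"
proof -
  have "upper_box_dim (closure A) \<le> upper_box_dim A"
  proof (cases "A = {}")
    case False
    have "covering_number r (closure A) \<le> covering_number r A" if r: "0 < r" for r
    proof -
      obtain \<U> where \<U>: "finite \<U>" "A \<subseteq> \<Union>\<U>" "\<And>U. U \<in> \<U> \<Longrightarrow> bounded U \<and> diameter U \<le> r"
        "card \<U> = covering_number r A"
        using covering_number_attained[OF assms(1) r] by metis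
      have "covering_number r (closure A) \<le> card (closure ` \<U>)"
      proof (rule covering_number_le)
        have "A \<subseteq> \<Union>(closure ` \<U>)" using \<U>(2) closure_subset by blast
        then show "closure A \<subseteq> \<Union>(closure ` \<U>)"
          using \<U>(1) by (intro closure_minimal closed_Union) auto
      qed (use \<U> in \<open>auto simp: diameter_closure\<close>)
      also have "\<dots> \<le> covering_number r A" using card_image_le[OF \<U>(1)] \<U>(4) by metis
      finally show ?thesis .
    qed
    then show ?thesis using assms(1) False by (intro upper_box_dim_mono_covering) auto
  qed simp
  then show ?thesis
    unfolding sigma_box_le_def using assms closure_subset[of A]
    by (intro exI[of _ "\<lambda>_. closure A"]) (auto simp: compact_closure)
qed

lemma packing_dim_le_if_sigma_box_le: "sigma_box_le d F \<Longrightarrow> packing_dim F \<le> d"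
  unfolding sigma_box_le_def packing_dim_def
  by (elim exE conjE) (rule Inf_lower2[OF CollectI], blast, simp add: SUP_le_iff)

theorem content_null_packing_dim_drop:
  fixes F :: "'a :: euclidean_space set"
  assumes "F \<in> sets borel" "assouad_bound \<alpha> F" "0 \<le> \<alpha>" "\<alpha> < t" "m < DIM('a)"
  shows "content_null (real (m * (DIM('a) - 1 - m)) + t)
    {V \<in> grassmannian m. packing_dim (orth_proj V ` F) < packing_dim F}"
proof -
  define s where "s = real (m * (DIM('a) - 1 - m)) + t"
  have "content_null s {V \<in> grassmannian m. packing_dim (orth_proj V ` F) < ereal a}"
    if ab: "a < b" "ereal b < packing_dim F" for a b
  proof (cases "0 \<le> b")
    case False
    \<comment> \<open>Here a is negative. A non-empty compact set has covering numbers at least 1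
      and an empty one has upper box dimension 0, so no packing dimension lies below a.\<close>
    have "\<not> packing_dim E < ereal a" for E :: "'a set"
    proof
      assume "packing_dim E < ereal a"
      then obtain K :: "nat \<Rightarrow> 'a set" where "\<forall>j. compact (K j)" "(SUP j. upper_box_dim (K j)) < ereal a"
        unfolding packing_dim_def Inf_less_iff by blast
      moreover have "upper_box_dim (K 0) \<le> (SUP j. upper_box_dim (K j))" by (rule SUP_upper) simp
      ultimately have K: "compact (K 0)" "upper_box_dim (K 0) < ereal a"
        by (blast, metis le_less_trans)
      show False
      proof (cases "K 0 = {}")
        case True
        then show False using K(2) False ab(1) by (simp add: upper_box_dim_empty)
      next
        case ne: False
        obtain \<delta> where \<delta>: "0 < \<delta>" "\<And>r. 0 < r \<Longrightarrow> r < \<delta> \<Longrightarrow> real (covering_number r (K 0)) < r powr (- a)"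
          using upper_box_dim_lessD[OF compact_imp_bounded[OF K(1)] ne K(2)] by auto
        define r where "r = min (\<delta> / 2) 1"
        have r: "0 < r" "r < \<delta>" "r \<le> 1" using \<delta>(1) by (auto simp: r_def)
        have "1 \<le> real (covering_number r (K 0))"
          using covering_number_pos[OF compact_imp_bounded[OF K(1)] r(1) ne] by simp
        also have "\<dots> < r powr (- a)" using \<delta>(2) r by blast
        also have "\<dots> \<le> 1 powr (- a)" using r False ab(1) by (intro powr_mono2) auto
        finally show False by simp
      qed
    qed
    then have eq: "{V \<in> grassmannian m. packing_dim (orth_proj V ` F) < ereal a} = {}" by blast
    show ?thesis unfolding eq using content_null_UN_countable[of "{}" s "\<lambda>_. {}"] by simp
  next
    case b: True
    have not_small: "\<not> sigma_box_le b F" using packing_dim_le_if_sigma_box_le ab(2) not_less by blast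
    have "F \<subseteq> (\<Union>n. F \<inter> cball 0 (real n))" using real_arch_simple by fastforce
    \<comment> \<open>Some bounded part of F is still large, as otherwise F would be a countable
      union of small sets. Boundedness is required by the box dimension result.\<close>
    then obtain n where n: "\<not> sigma_box_le b (F \<inter> cball 0 (real n))"
      using not_small sigma_box_le_UN[of b "\<lambda>n. F \<inter> cball 0 (real n)"] sigma_box_le_subset by blast
    define F' where "F' = F \<inter> cball 0 (real n)"
    have F': "F' \<subseteq> F" "bounded F'" "F' \<in> sets borel" using assms(1) by (auto simp: F'_def)
    obtain C :: "('a \<times> (nat \<Rightarrow> nat)) set" where C: "closed C" "fst ` C = F'"
      using borel_projection_closed[OF F'(3)] by blast
    obtain \<B> :: "('a \<times> (nat \<Rightarrow> nat)) set set" where \<B>: "countable \<B>" "topological_basis \<B>"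
      using ex_countable_basis by blast
    have \<B>_open: "open B" if "B \<in> \<B>" for B using \<B>(2) that by (rule topological_basis_open)
    have \<B>_sub: "\<exists>B\<in>\<B>. p \<in> B \<and> B \<subseteq> U" if "open U" "p \<in> U" for p U
      using topological_basisE[OF \<B>(2) that] by metis
    \<comment> \<open>The removed sets come from a countable basis, so that the union of their
      images is again \<open>sigma_box_le b\<close>.\<close>
    define \<S> where "\<S> = {B \<in> \<B>. sigma_box_le b (fst ` (C \<inter> B))}"
    have \<S>: "countable \<S>" using \<B>(1) by (simp add: \<S>_def)
    define T where "T = C - \<Union>\<S>"
    have T: "closed T"
      unfolding T_def using C(1) \<B>_open by (intro closed_Diff open_Union) (auto simp: \<S>_def)
    have small: "sigma_box_le b (\<Union>B\<in>\<S>. fst ` (C \<inter> B))"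
      using b \<S> by (intro sigma_box_le_UN_countable) (auto simp: \<S>_def)
    have un: "sigma_box_le b (A \<union> A')" if "sigma_box_le b A" "sigma_box_le b A'" for A A' :: "'a set"
      using sigma_box_le_UN_countable[of b "{A, A'}" id] b that by auto
    have "T \<noteq> {}"
    proof
      assume "T = {}"
      then have "F' \<subseteq> (\<Union>B\<in>\<S>. fst ` (C \<inter> B))" unfolding C(2)[symmetric] T_def by blast
      then show False using small sigma_box_le_subset n unfolding F'_def by blast
    qed
    \<comment> \<open>If the piece of T were small, so would be the piece of C, since the two differ
      by removed parts. Then B itself would have been removed and could not meet T.\<close>
    have big: "\<not> sigma_box_le b (fst ` (T \<inter> B))" if B: "B \<in> \<B>" "T \<inter> B \<noteq> {}" for B
    proof
      assume "sigma_box_le b (fst ` (T \<inter> B))"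
      moreover have "fst ` (C \<inter> B) \<subseteq> fst ` (T \<inter> B) \<union> (\<Union>B\<in>\<S>. fst ` (C \<inter> B))"
        unfolding T_def by blast
      ultimately have "sigma_box_le b (fst ` (C \<inter> B))" using un[OF _ small] sigma_box_le_subset by blast
      then have "B \<in> \<S>" using B(1) by (simp add: \<S>_def)
      then show False using B(2) by (auto simp: T_def)
    qed
    define I where "I = {B \<in> \<B>. T \<inter> B \<noteq> {}}"
    define E where "E B = {V \<in> grassmannian m.
      upper_box_dim (orth_proj V ` (fst ` (T \<inter> B))) < upper_box_dim (fst ` (T \<inter> B))}" for B
    have sub: "fst ` (T \<inter> B) \<subseteq> F'" for B using C(2) by (auto simp: T_def)
    have "content_null s (\<Union>B\<in>I. E B)"
    proof (rule content_null_UN_countable)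
      show "countable I" using \<B>(1) by (simp add: I_def)
      fix B assume B: "B \<in> I"
      show "content_null s (E B)"
        unfolding E_def s_def
      proof (rule content_null_upper_box_dim_drop)
        show "bounded (fst ` (T \<inter> B))" by (rule bounded_subset[OF F'(2) sub])
        show "fst ` (T \<inter> B) \<noteq> {}" using B by (simp add: I_def)
        show "assouad_bound \<alpha> (fst ` (T \<inter> B))"
          by (rule assouad_bound_subset[OF assms(2) order_trans[OF sub F'(1)]])
      qed (use assms in auto)
    qed
    moreover have "{V \<in> grassmannian m. packing_dim (orth_proj V ` F) < ereal a} \<subseteq> (\<Union>B\<in>I. E B)"
    proof
      fix V assume "V \<in> {V \<in> grassmannian m. packing_dim (orth_proj V ` F) < ereal a}"
      then have V: "V \<in> grassmannian m" "packing_dim (orth_proj V ` F) < ereal a" by auto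
      from V(2) obtain K :: "nat \<Rightarrow> 'a set" where K: "orth_proj V ` F \<subseteq> (\<Union>j. K j)" "\<forall>j. compact (K j)"
        "(SUP j. upper_box_dim (K j)) < ereal a"
        unfolding packing_dim_def Inf_less_iff by blast
      \<comment> \<open>The compact cover of the projection is pulled back to the space containing
        T, since Baire's theorem is applied to the closed set T rather than to the Borel set
        F.\<close>
      define D where "D j = (\<lambda>p :: 'a \<times> (nat \<Rightarrow> nat). orth_proj V (fst p)) -` K j" for j
      have "continuous_on UNIV (\<lambda>p :: 'a \<times> (nat \<Rightarrow> nat). orth_proj V (fst p))"
        by (intro continuous_on_compose2[OF linear_continuous_on[of "orth_proj V"]] continuous_intros)
          (auto simp: linear_orth_proj linear_conv_bounded_linear[symmetric])
      then have "closed (D j)" for j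
        unfolding D_def using K(2) by (intro closed_vimage compact_imp_closed) auto
      moreover have "T \<subseteq> (\<Union>j. D j)"
      proof
        fix p assume "p \<in> T"
        then have "fst p \<in> F" using C(2) F'(1) by (auto simp: T_def)
        then obtain j where "orth_proj V (fst p) \<in> K j" using K(1) by blast
        then show "p \<in> (\<Union>j. D j)" by (auto simp: D_def)
      qed
      ultimately obtain j U where U: "open U" "T \<inter> U \<noteq> {}" "T \<inter> U \<subseteq> D j"
        using Baire_countable_closed_cover[OF T \<open>T \<noteq> {}\<close>] by metis
      then obtain p where p: "p \<in> T" "p \<in> U" by blast
      \<comment> \<open>Shrinking U to a basic set leaves countably many possible pieces, none of
        which depends on V.\<close>
      then obtain B where B: "B \<in> \<B>" "p \<in> B" "B \<subseteq> U" using \<B>_sub[OF U(1)] by blast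
      have ne: "T \<inter> B \<noteq> {}" using p B by blast
      define G where "G = fst ` (T \<inter> B)"
      have G: "bounded G" "G \<noteq> {}" using bounded_subset[OF F'(2) sub] ne by (auto simp: G_def)
      have "orth_proj V ` G \<subseteq> K j" using U(3) B(3) unfolding G_def D_def by blast
      then have "upper_box_dim (orth_proj V ` G) \<le> upper_box_dim (K j)"
        using K(2) G compact_imp_bounded
        by (intro upper_box_dim_mono_covering covering_number_mono bounded_orth_proj_image) auto
      also have "\<dots> \<le> (SUP j. upper_box_dim (K j))" by (rule SUP_upper) simp
      also have "\<dots> < ereal b" using K(3) ab(1) by (meson less_ereal.simps(1) less_trans)
      \<comment> \<open>Otherwise the bounded set G would itself be \<open>sigma_box_le b\<close>,
        contrary to \<open>big\<close>.\<close>
      also have "\<dots> < upper_box_dim G"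
        using big[OF B(1) ne] sigma_box_le_bounded[OF G(1)] unfolding G_def by (meson not_less)
      finally have "V \<in> E B" using V(1) by (simp add: E_def G_def)
      then show "V \<in> (\<Union>B\<in>I. E B)" using B(1) ne by (auto simp: I_def)
    qed
    ultimately show ?thesis by (rule content_null_subset)
  qed
  then show ?thesis unfolding s_def[symmetric] by (rule content_null_rational_gap)
qed

section \<open>The quasi-Assouad dimension\<close>

text \<open>For \<alpha> < 0 the bound \<open>C * (R / r) powr \<alpha>\<close> tends to 0 with r at
  fixed R, whereas a non-empty set has covering number at least 1.\<close>

lemma upper_assouad_spectrum_nonneg:
  fixes F :: "'a :: euclidean_space set"
  assumes "F \<noteq> {}" "0 < \<theta>" "\<theta> < 1"
  shows "0 \<le> upper_assouad_spectrum \<theta> F"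
  unfolding upper_assouad_spectrum_def
proof (rule Inf_greatest, elim CollectE exE conjE)
  fix \<alpha> C :: real and z
  assume z: "z = ereal \<alpha>" and C: "0 < C" "\<forall>r R. \<forall>x\<in>F.
      0 < r \<and> r \<le> R powr (1 / \<theta>) \<and> R powr (1 / \<theta>) < R \<and> R < 1 \<longrightarrow>
      real (covering_number r (cball x R \<inter> F)) \<le> C * (R / r) powr \<alpha>"
  have "0 \<le> \<alpha>"
  proof (rule ccontr)
    assume "\<not> 0 \<le> \<alpha>"
    then have \<alpha>: "\<alpha> < 0" by simp
    obtain x where x: "x \<in> F" using assms(1) by blast
    define R :: real where "R = 1/2"
    \<comment> \<open>The ratio at which \<open>C * Q powr \<alpha> = 1/2\<close>. As \<alpha> is
      negative, every larger ratio \<open>R / r\<close> does as well.\<close>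
    define Q where "Q = (2 * C) powr (- 1 / \<alpha>)"
    have "Q powr \<alpha> = (2 * C) powr (- 1)" unfolding Q_def powr_powr using \<alpha> by simp
    then have Q: "0 < Q" "Q powr \<alpha> = 1 / (2 * C)"
      using C(1) by (simp_all add: Q_def powr_minus_divide)
    define r where "r = min (R powr (1 / \<theta>)) (R / Q)"
    have r: "0 < r" "r \<le> R powr (1 / \<theta>)" "Q \<le> R / r"
    proof -
      show "0 < r" using Q(1) by (simp add: r_def R_def)
      have "r \<le> R / Q" by (simp add: r_def)
      then show "Q \<le> R / r" using Q(1) \<open>0 < r\<close> by (simp add: field_simps)
    qed (simp add: r_def)
    have "R powr (1 / \<theta>) < R powr 1" unfolding R_def using assms by (intro powr_less_mono') auto
    then have R: "R powr (1 / \<theta>) < R" "R < 1" by (auto simp: R_def)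
    have "x \<in> cball x R \<inter> F" using x by (simp add: R_def)
    then have "cball x R \<inter> F \<noteq> {}" by blast
    then have "1 \<le> real (covering_number r (cball x R \<inter> F))"
      using covering_number_pos[of "cball x R \<inter> F" r] r(1) by (simp add: bounded_Int)
    also have "\<dots> \<le> C * (R / r) powr \<alpha>" using C(2) x r(1,2) R by blast
    also have "\<dots> \<le> C * Q powr \<alpha>"
      using C(1) Q(1) r(3) \<alpha> by (intro mult_left_mono powr_mono2') auto
    also have "\<dots> < 1" using C(1) Q(2) by simp
    finally show False by simp
  qed
  then show "0 \<le> z" using z by simp
qed

text \<open>For R < 1 a larger \<theta> increases \<open>R powr (1 / \<theta>)\<close>, so more
  pairs r, R are constrained and fewer exponents are admissible.\<close>

lemma upper_assouad_spectrum_mono: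
  assumes "0 < \<theta>" "\<theta> \<le> \<theta>'" "\<theta>' < 1"
  shows "upper_assouad_spectrum \<theta> F \<le> upper_assouad_spectrum \<theta>' F"
proof -
  have *: "0 < r \<and> r \<le> R powr (1 / \<theta>') \<and> R powr (1 / \<theta>') < R \<and> R < 1"
    if h: "0 < r \<and> r \<le> R powr (1 / \<theta>) \<and> R powr (1 / \<theta>) < R \<and> R < 1" for r R :: real
  proof -
    have R: "0 < R" "R < 1" using h le_less_trans[OF powr_ge_zero, of R "1 / \<theta>" R] by auto
    have "R powr (1 / \<theta>) \<le> R powr (1 / \<theta>')"
      using R assms by (intro powr_mono' divide_left_mono) auto
    moreover have "R powr (1 / \<theta>') < R powr 1"
      using R assms by (intro powr_less_mono') auto
    ultimately show ?thesis using h R by simp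
  qed
  show ?thesis
    unfolding upper_assouad_spectrum_def
  proof (rule Inf_superset_mono, rule Collect_mono, rule impI)
    fix z assume "\<exists>\<alpha>. z = ereal \<alpha> \<and> (\<exists>C>0. \<forall>r R. \<forall>x\<in>F.
            0 < r \<and> r \<le> R powr (1 / \<theta>') \<and> R powr (1 / \<theta>') < R \<and> R < 1 \<longrightarrow>
            real (covering_number r (cball x R \<inter> F)) \<le> C * (R / r) powr \<alpha>)"
    then obtain \<alpha> C where "z = ereal \<alpha>" "0 < C" and C: "\<forall>r R. \<forall>x\<in>F.
            0 < r \<and> r \<le> R powr (1 / \<theta>') \<and> R powr (1 / \<theta>') < R \<and> R < 1 \<longrightarrow>
            real (covering_number r (cball x R \<inter> F)) \<le> C * (R / r) powr \<alpha>"
      by (elim exE conjE) (rule that)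
    moreover have "\<forall>r R. \<forall>x\<in>F.
            0 < r \<and> r \<le> R powr (1 / \<theta>) \<and> R powr (1 / \<theta>) < R \<and> R < 1 \<longrightarrow>
            real (covering_number r (cball x R \<inter> F)) \<le> C * (R / r) powr \<alpha>"
      using C * by meson
    ultimately show "\<exists>\<alpha>. z = ereal \<alpha> \<and> (\<exists>C>0. \<forall>r R. \<forall>x\<in>F.
            0 < r \<and> r \<le> R powr (1 / \<theta>) \<and> R powr (1 / \<theta>) < R \<and> R < 1 \<longrightarrow>
            real (covering_number r (cball x R \<inter> F)) \<le> C * (R / r) powr \<alpha>)"
      by (intro exI[of _ \<alpha>] conjI exI[of _ C])
  qed
qed

lemma quasi_assouad_dim_eq_SUP:
  "quasi_assouad_dim F = (SUP \<theta>\<in>{0<..<1}. upper_assouad_spectrum \<theta> F)"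
proof -
  define q where "q = (SUP \<theta>\<in>{0<..<1}. upper_assouad_spectrum \<theta> F)"
  have "((\<lambda>\<theta>. upper_assouad_spectrum \<theta> F) \<longlongrightarrow> q) (at_left 1)"
  proof (rule order_tendstoI)
    fix a assume "a < q"
    then obtain \<theta>0 where \<theta>0: "\<theta>0 \<in> {0<..<1}" "a < upper_assouad_spectrum \<theta>0 F"
      unfolding q_def less_SUP_iff by blast
    show "\<forall>\<^sub>F \<theta> in at_left 1. a < upper_assouad_spectrum \<theta> F"
      unfolding eventually_at_left_field
    proof (intro exI[of _ \<theta>0] conjI allI impI)
      fix \<theta> assume "\<theta>0 < \<theta>" "\<theta> < 1"
      then have "upper_assouad_spectrum \<theta>0 F \<le> upper_assouad_spectrum \<theta> F"
        using \<theta>0(1) by (intro upper_assouad_spectrum_mono) auto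
      then show "a < upper_assouad_spectrum \<theta> F" using \<theta>0(2) by simp
    qed (use \<theta>0 in simp)
  next
    fix a assume "q < a"
    moreover have "upper_assouad_spectrum \<theta> F \<le> q" if "0 < \<theta>" "\<theta> < 1" for \<theta>
      unfolding q_def using that by (intro SUP_upper) auto
    ultimately show "\<forall>\<^sub>F \<theta> in at_left 1. upper_assouad_spectrum \<theta> F < a"
      unfolding eventually_at_left_field by (intro exI[of _ 0]) (auto intro: le_less_trans)
  qed
  then show ?thesis
    unfolding quasi_assouad_dim_def q_def[symmetric] by (intro tendsto_Lim) simp
qed

text \<open>By monotonicity in \<theta> the dimension bounds every spectrum value, so each \<theta>
  admits some exponent \<beta> < \<alpha>. It may depend on \<theta>, but raising it to \<alpha> is
  harmless because \<open>1 \<le> R / r\<close>.\<close>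

lemma assouad_bound_if_quasi_assouad_dim_less:
  fixes F :: "'a :: metric_space set"
  assumes "quasi_assouad_dim F < ereal \<alpha>"
  shows "assouad_bound \<alpha> F"
  unfolding assouad_bound_def
proof (intro allI impI)
  fix \<theta> :: real assume \<theta>: "0 < \<theta>" "\<theta> < 1"
  have "upper_assouad_spectrum \<theta> F \<le> quasi_assouad_dim F"
    unfolding quasi_assouad_dim_eq_SUP using \<theta> by (intro SUP_upper) auto
  then have "upper_assouad_spectrum \<theta> F < ereal \<alpha>" using assms by simp
  then obtain z where "z \<in> {ereal \<alpha> | \<alpha>. \<exists>C>0. \<forall>r R. \<forall>x\<in>F.
            0 < r \<and> r \<le> R powr (1 / \<theta>) \<and> R powr (1 / \<theta>) < R \<and> R < 1 \<longrightarrow>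
            real (covering_number r (cball x R \<inter> F)) \<le> C * (R / r) powr \<alpha>}" "z < ereal \<alpha>"
    unfolding upper_assouad_spectrum_def Inf_less_iff by (elim bexE) (rule that)
  then obtain \<beta> C where \<beta>: "z = ereal \<beta>" "0 < C" and C: "\<forall>r R. \<forall>x\<in>F.
            0 < r \<and> r \<le> R powr (1 / \<theta>) \<and> R powr (1 / \<theta>) < R \<and> R < 1 \<longrightarrow>
            real (covering_number r (cball x R \<inter> F)) \<le> C * (R / r) powr \<beta>"
    by (elim CollectE exE conjE) (rule that)
  have "\<beta> < \<alpha>" using \<beta>(1) \<open>z < ereal \<alpha>\<close> by simp
  show "\<exists>C>0. \<forall>r R. \<forall>x\<in>F. 0 < r \<and> r \<le> R powr (1 / \<theta>) \<and> R powr (1 / \<theta>) < R \<and> R < 1 \<longrightarrow>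
            real (covering_number r (cball x R \<inter> F)) \<le> C * (R / r) powr \<alpha>"
  proof (intro exI[of _ C] conjI allI ballI impI \<beta>(2))
    fix r R x
    assume x: "x \<in> F" and h: "0 < r \<and> r \<le> R powr (1 / \<theta>) \<and> R powr (1 / \<theta>) < R \<and> R < 1"
    have "real (covering_number r (cball x R \<inter> F)) \<le> C * (R / r) powr \<beta>" using C x h by blast
    also have "1 \<le> R / r" using h by simp
    then have "C * (R / r) powr \<beta> \<le> C * (R / r) powr \<alpha>"
      using \<beta>(2) \<open>\<beta> < \<alpha>\<close> by (intro mult_left_mono powr_mono) auto
    finally show "real (covering_number r (cball x R \<inter> F)) \<le> C * (R / r) powr \<alpha>" .
  qed
qed

lemma quasi_assouad_dim_nonneg:
  fixes F :: "'a :: euclidean_space set"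
  assumes "F \<noteq> {}"
  shows "0 \<le> quasi_assouad_dim F"
proof -
  have "0 \<le> upper_assouad_spectrum (1/2) F" using assms by (intro upper_assouad_spectrum_nonneg) auto
  also have "\<dots> \<le> quasi_assouad_dim F"
    unfolding quasi_assouad_dim_eq_SUP by (intro SUP_upper) auto
  finally show ?thesis .
qed

theorem corollary1p4:
  fixes F :: "(real ^ 'n) set" and m :: nat
  assumes "1 \<le> m" and "m < CARD('n)"
    and "F \<noteq> {}"
    and "quasi_assouad_dim F < ereal (real m)"
  shows
    "(bounded F \<longrightarrow>
        hausdorff_dim {V \<in> grassmannian m. upper_box_dim (orth_proj V ` F) < upper_box_dim F}
          \<le> ereal (real (m * (CARD('n) - m))) - (ereal (real m) - quasi_assouad_dim F) \<and>
        hausdorff_dim {V \<in> grassmannian m. lower_box_dim (orth_proj V ` F) < lower_box_dim F}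
          \<le> ereal (real (m * (CARD('n) - m))) - (ereal (real m) - quasi_assouad_dim F)) \<and>
     (F \<in> sets borel \<longrightarrow>
        hausdorff_dim {V \<in> grassmannian m. packing_dim (orth_proj V ` F) < packing_dim F}
          \<le> ereal (real (m * (CARD('n) - m))) - (ereal (real m) - quasi_assouad_dim F))"
proof -
  \<comment> \<open>The dimension lies between 0 and m, hence is a real number and the subtraction
    in the bound is an ordinary one.\<close>
  obtain q where q: "quasi_assouad_dim F = ereal q" "0 \<le> q"
    using quasi_assouad_dim_nonneg[OF assms(3)] assms(4)
    by (cases "quasi_assouad_dim F") auto
  define p where "p = real (m * (DIM(real ^ 'n) - 1 - m))"
  have m: "m < DIM(real ^ 'n)" using assms(2) by simp
  have "CARD('n) - m = Suc (CARD('n) - 1 - m)" using assms(2) by simp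
  then have "real (m * (CARD('n) - m)) = p + real m" by (simp add: p_def algebra_simps)
  then have bound: "ereal (real (m * (CARD('n) - m))) - (ereal (real m) - quasi_assouad_dim F) = ereal (p + q)"
    by (simp add: q(1))
  have main: "hausdorff_dim E \<le> ereal (p + q)"
    if null: "\<And>\<alpha> t. assouad_bound \<alpha> F \<Longrightarrow> 0 \<le> \<alpha> \<Longrightarrow> \<alpha> < t \<Longrightarrow> content_null (p + t) E"
    for E :: "(real ^ 'n) linsub set"
  proof (rule ereal_le_epsilon2)
    fix e :: real assume e: "0 < e"
    \<comment> \<open>An Assouad bound needs an exponent above q, and t has to exceed that exponent
      in turn; \<open>q + e / 2\<close> and \<open>q + e\<close> both tend to q. The positive e also
      makes the Hausdorff exponent positive.\<close>
    have "assouad_bound (q + e / 2) F"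
      using e by (intro assouad_bound_if_quasi_assouad_dim_less) (simp add: q(1))
    then have "content_null (p + (q + e)) E" using e q(2) by (intro null[of "q + e / 2"]) auto
    then have "hausdorff_dim E \<le> ereal (p + (q + e))"
      using e q(2) by (intro hausdorff_dim_le) (simp_all add: p_def add_nonneg_pos)
    then show "hausdorff_dim E \<le> ereal (p + q) + ereal e" by (simp add: add.assoc)
  qed
  show ?thesis
    unfolding bound
  proof (intro conjI impI)
    assume F: "bounded F"
    show "hausdorff_dim {V \<in> grassmannian m. upper_box_dim (orth_proj V ` F) < upper_box_dim F} \<le> ereal (p + q)"
      unfolding p_def by (rule main[unfolded p_def]) (rule content_null_upper_box_dim_drop[OF F assms(3) _ _ _ m])
    show "hausdorff_dim {V \<in> grassmannian m. lower_box_dim (orth_proj V ` F) < lower_box_dim F} \<le> ereal (p + q)"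
      unfolding p_def by (rule main[unfolded p_def]) (rule content_null_lower_box_dim_drop[OF F assms(3) _ _ _ m])
  next
    assume F: "F \<in> sets borel"
    show "hausdorff_dim {V \<in> grassmannian m. packing_dim (orth_proj V ` F) < packing_dim F} \<le> ereal (p + q)"
      unfolding p_def by (rule main[unfolded p_def]) (rule content_null_packing_dim_drop[OF F _ _ _ m])
  qed
qed

end
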